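(* There is an absolute constant $C>0$ such that the following holds. Let $n_1,n_2,d_1,d_2,r$ be positive integers with $r\le d_1\le n_1$, $r\le d_2\le n_2$, and let $n=\max\{n_1,n_2\}$. Let $A\in\mathbb R^{n_1\times d_1}$ and $B\in\mathbb R^{n_2\times d_2}$ be $\mu$-incoherent isometries, and let $X^*\in\mathbb R^{n_1\times n_2}$ be a rank-$r$ matrix whose column space is contained in the span of the columns of $A$ and whose row space is contained in the span of the columns of $B$; write $X^*=AM^*B^\top$ with $M^*=A^\top X^*B\in\mathbb R^{d_1\times d_2}$ (of rank $r$). Let $\Omega\subseteq[n_1]\times[n_2]$ be drawn uniformly at random among all subsets of size $|\Omega|$, with $|\Omega|\ge C\mu^2 d_1d_2\log n$, and let $Y=\mathcal P_\Omega(X^* )$. Then, with probability at least $1-2n^{-2}$, every critical point $(U,V)$, $U\in\mathbb R^{d_1\times r}$, $V\in\mathbb R^{d_2\times r}$, of $$g(U,V)=\|\mathcal P_\Omega(AUV^\top B^\top)-Y\|_F^2$$ is either a global minimum with $UV^\top=M^*$, or a strict saddle point (a point at which the Hessian of $g$ has at least one strictly negative eigenvalue).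
   Context: A matrix $A\in\mathbb R^{n_1\times d_1}$ is an isometry if $A^\top A=I_{d_1}$. For a matrix $X$, $\|X\|_{2,\infty}$ denotes the largest Euclidean norm of a row of $X$. An isometry $A\in\mathbb R^{n_1\times d_1}$ is $\mu$-incoherent if $\|A\|_{2,\infty}\le\sqrt{\mu d_1/n_1}$ (equivalently, in the general definition: a rank-$k$ matrix with thin SVD $U\Sigma V^\top$ is $\mu$-incoherent if $\|U\|_{2,\infty}\le\sqrt{\mu k/n_1}$ and $\|V\|_{2,\infty}\le\sqrt{\mu k/n_2}$). $[n]=\{1,\dots,n\}$. The sampling operator $\mathcal P_\Omega:\mathbb R^{n_1\times n_2}\to\mathbb R^{n_1\times n_2}$ is defined by $[\mathcal P_\Omega(X)]_{ij}=X_{ij}$ if $(i,j)\in\Omega$ and $0$ otherwise. *)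

theory Defs
  imports "Jordan_Normal_Form.DL_Rank" "Jordan_Normal_Form.Char_Poly" "HOL-Probability.Probability"
begin

definition isometry :: "real mat \<Rightarrow> bool" where
  "isometry A \<longleftrightarrow> A\<^sup>T * A = 1\<^sub>m (dim_col A)"

definition norm_2inf :: "real mat \<Rightarrow> real" where
  "norm_2inf X = Max ((\<lambda>i. sqrt (\<Sum>k<dim_col X. (X $$ (i,k))\<^sup>2)) ` {..<dim_row X})"

definition incoherent_isometry :: "real \<Rightarrow> real mat \<Rightarrow> bool" where
  "incoherent_isometry \<mu> A \<longleftrightarrow> isometry A \<and>
     norm_2inf A \<le> sqrt (\<mu> * real (dim_col A) / real (dim_row A))"

definition P_Omega :: "(nat \<times> nat) set \<Rightarrow> real mat \<Rightarrow> real mat" where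
  "P_Omega \<Omega> X = Matrix.mat (dim_row X) (dim_col X) (\<lambda>(i,j). if (i,j) \<in> \<Omega> then X $$ (i,j) else 0)"

definition frob_sq :: "real mat \<Rightarrow> real" where
  "frob_sq X = (\<Sum>i<dim_row X. \<Sum>j<dim_col X. (X $$ (i,j))\<^sup>2)"

definition g_obj :: "real mat \<Rightarrow> real mat \<Rightarrow> (nat \<times> nat) set \<Rightarrow> real mat \<Rightarrow> real mat \<Rightarrow> real mat \<Rightarrow> real" where
  "g_obj A B \<Omega> Y U V = frob_sq (P_Omega \<Omega> (A * U * V\<^sup>T * B\<^sup>T) - Y)"

text \<open>The parameter (U,V) with U d1 x r and V d2 x r is identified with a vector of
  d1*r + d2*r coordinates: coordinate p < d1*r is U(p div r, p mod r), coordinate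
  d1*r + q is V(q div r, q mod r).  Unit directions:\<close>
definition dirU :: "nat \<Rightarrow> nat \<Rightarrow> nat \<Rightarrow> real mat" where
  "dirU d1 r p = Matrix.mat d1 r (\<lambda>(i,k). if p < d1 * r \<and> i = p div r \<and> k = p mod r then 1 else 0)"

definition dirV :: "nat \<Rightarrow> nat \<Rightarrow> nat \<Rightarrow> nat \<Rightarrow> real mat" where
  "dirV d1 d2 r p = Matrix.mat d2 r (\<lambda>(j,k). if d1 * r \<le> p \<and> j = (p - d1 * r) div r \<and> k = (p - d1 * r) mod r then 1 else 0)"

definition pderiv_UV :: "(real mat \<Rightarrow> real mat \<Rightarrow> real) \<Rightarrow> nat \<Rightarrow> nat \<Rightarrow> nat \<Rightarrow> nat \<Rightarrow> real mat \<Rightarrow> real mat \<Rightarrow> real" where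
  "pderiv_UV f d1 d2 r p U V = deriv (\<lambda>t. f (U + t \<cdot>\<^sub>m dirU d1 r p) (V + t \<cdot>\<^sub>m dirV d1 d2 r p)) 0"

definition hessian_UV :: "(real mat \<Rightarrow> real mat \<Rightarrow> real) \<Rightarrow> nat \<Rightarrow> nat \<Rightarrow> nat \<Rightarrow> real mat \<Rightarrow> real mat \<Rightarrow> real mat" where
  "hessian_UV f d1 d2 r U V = Matrix.mat (d1 * r + d2 * r) (d1 * r + d2 * r)
     (\<lambda>(p,q). deriv (\<lambda>s. pderiv_UV f d1 d2 r q (U + s \<cdot>\<^sub>m dirU d1 r p) (V + s \<cdot>\<^sub>m dirV d1 d2 r p)) 0)"

definition critical_point_UV :: "(real mat \<Rightarrow> real mat \<Rightarrow> real) \<Rightarrow> nat \<Rightarrow> nat \<Rightarrow> nat \<Rightarrow> real mat \<Rightarrow> real mat \<Rightarrow> bool" where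
  "critical_point_UV f d1 d2 r U V \<longleftrightarrow> (\<forall>p < d1 * r + d2 * r. pderiv_UV f d1 d2 r p U V = 0)"

definition global_min_UV :: "(real mat \<Rightarrow> real mat \<Rightarrow> real) \<Rightarrow> nat \<Rightarrow> nat \<Rightarrow> nat \<Rightarrow> real mat \<Rightarrow> real mat \<Rightarrow> bool" where
  "global_min_UV f d1 d2 r U V \<longleftrightarrow>
     (\<forall>U' \<in> carrier_mat d1 r. \<forall>V' \<in> carrier_mat d2 r. f U V \<le> f U' V')"

definition strict_saddle_UV :: "(real mat \<Rightarrow> real mat \<Rightarrow> real) \<Rightarrow> nat \<Rightarrow> nat \<Rightarrow> nat \<Rightarrow> real mat \<Rightarrow> real mat \<Rightarrow> bool" where
  "strict_saddle_UV f d1 d2 r U V \<longleftrightarrow> (\<exists>e<0. eigenvalue (hessian_UV f d1 d2 r U V) e)"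

end

theory Submission
  imports Defs
begin

text \<open>
  The entries of \<open>A * M * B\<^sup>T\<close> are the inner products of \<open>M\<close> with the rank-one matrices formed by a row of \<open>A\<close> and a
  row of \<open>B\<close>. Since \<open>A\<close> and \<open>B\<close> are isometries, these \<open>N = n1 * n2\<close> matrices form a Parseval frame, and
  incoherence bounds their squared norms by \<open>\<mu>\<^sup>2 * d1 * d2 / N\<close>. Drawing the sample one element at a time, the
  frame operator of the sample, centered and divided by the number of elements not yet drawn, is a
  matrix martingale. A Golden--Thompson argument bounds its exponential moments, and so with probability at least
  \<open>1 - 2 / n\<^sup>2\<close> the sampled frame operator is within a factor \<open>1 \<plusminus> 1/4\<close> of its mean.

  Given this, let \<open>G\<close> be the gradient with respect to \<open>X = U * V\<^sup>T\<close>. Criticality says \<open>G * V = 0\<close> and \<open>G\<^sup>T * U = 0\<close>.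
  If \<open>U\<close> is not injective, a positive semidefinite Hessian forces \<open>G = 0\<close>. Otherwise the rank-one directions of the
  Hessian bound the operator norm of \<open>G\<close> by \<open>\<kappa>\<close>, the upper isometry constant, times the least singular value of \<open>X\<close>,
  so \<open>X\<close> is a best rank-\<open>r\<close> approximation of \<open>X - G / \<kappa>\<close>. Comparing with the rank-\<open>r\<close> target and using strong
  convexity gives that \<open>X\<close> is the target.
\<close>

unbundle no inner_syntax
hide_type (open) Finite_Cartesian_Product.vec
hide_const (open) Finite_Cartesian_Product.vec Finite_Cartesian_Product.mat Finite_Cartesian_Product.row
  Determinants.det

section \<open>Trace inequalities\<close>

text \<open>Exponentials enter only through the powers \<open>euler n k X ^\<^sub>m (2 ^ k)\<close>.
  For fixed \<open>k\<close> the Golden--Thompson comparison holds only up to an error that vanishes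
  as \<open>k\<close> grows, so the moment estimates carry null sequences, and the limit is taken
  once, at the end of the tail bound. Spectral decompositions are replaced by quadratic forms,
  Cauchy--Schwarz and infima.

  The rescaling of the martingale is forced: given \<open>k\<close> draws out of \<open>N\<close>,
  the expected deviation of the frame operator from its mean shrinks by the factor
  \<open>(N - k - 1) / (N - k)\<close> at the next draw, and dividing by \<open>N - k\<close> undoes
  this. The step variances then grow, but their sum telescopes to order
  \<open>m / (N * (N - m)^2)\<close>, and \<open>(N - m)^2\<close> cancels when the rescaling is
  undone. So the tail bound does not deteriorate as \<open>m\<close> approaches \<open>N\<close>.

  The tolerance 1/4 comes from the landscape part: with isometry constants
  \<open>1 - \<delta>\<close> and \<open>1 + \<delta>\<close> the last comparison requires
  \<open>1 + \<delta> < 2 * (1 - \<delta>)\<close>, that is \<open>\<delta> < 1/3\<close>.\<close>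

definition mtrace :: "real mat \<Rightarrow> real" where
  "mtrace A = (\<Sum>i<dim_row A. A $$ (i,i))"

lemma index_mult_mat_sum:
  assumes "A \<in> carrier_mat a b" "B \<in> carrier_mat b c" "i < a" "j < c"
  shows "(A * B) $$ (i,j) = (\<Sum>k<b. A $$ (i,k) * B $$ (k,j))"
  using assms by (auto simp: scalar_prod_def lessThan_atLeast0)

lemma mtrace_mult:
  assumes "A \<in> carrier_mat a b" "B \<in> carrier_mat b a"
  shows "mtrace (A * B) = (\<Sum>i<a. \<Sum>k<b. A $$ (i,k) * B $$ (k,i))"
proof -
  have "dim_row (A * B) = a" using assms by auto
  then show ?thesis unfolding mtrace_def using assms by (auto intro!: sum.cong simp: index_mult_mat_sum simp del: index_mult_mat)
qed

lemma mtrace_comm: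
  assumes "A \<in> carrier_mat a b" "B \<in> carrier_mat b a"
  shows "mtrace (A * B) = mtrace (B * A)"
  using assms by (simp add: mtrace_mult[of _ a b] mtrace_mult[of _ b a] mult.commute)
    (rule sum.swap)

lemma mtrace_minus:
  assumes "A \<in> carrier_mat n n" "B \<in> carrier_mat n n"
  shows "mtrace (A - B) = mtrace A - mtrace B"
  using assms by (simp add: mtrace_def sum_subtractf)

lemma mtrace_one: "mtrace (1\<^sub>m n) = n"
  by (simp add: mtrace_def)

lemma mtrace_mult_transpose:
  assumes "A \<in> carrier_mat a b" "B \<in> carrier_mat a b"
  shows "mtrace (A * B\<^sup>T) = (\<Sum>i<a. \<Sum>k<b. A $$ (i,k) * B $$ (i,k))"
proof -
  have "B\<^sup>T \<in> carrier_mat b a" using assms by auto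
  from mtrace_mult[OF assms(1) this] show ?thesis using assms by auto
qed

lemma frob_sq_trace: "A \<in> carrier_mat a b \<Longrightarrow> frob_sq A = mtrace (A * A\<^sup>T)"
  by (simp add: mtrace_mult_transpose[of _ a b] frob_sq_def power2_eq_square)

lemma frob_sq_nonneg: "0 \<le> frob_sq A"
  by (simp add: frob_sq_def sum_nonneg)

lemma frob_sq_transpose: "frob_sq A\<^sup>T = frob_sq A"
  by (simp add: frob_sq_def) (rule sum.swap)

lemma mtrace_Cauchy_Schwarz:
  assumes "A \<in> carrier_mat a b" "B \<in> carrier_mat a b"
  shows "(mtrace (A * B\<^sup>T))\<^sup>2 \<le> frob_sq A * frob_sq B"
proof -
  let ?S = "{..<a} \<times> {..<b}"
  have "mtrace (A * B\<^sup>T) = (\<Sum>x\<in>?S. A $$ x * B $$ x)"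
    using assms by (simp add: mtrace_mult_transpose sum.cartesian_product case_prod_unfold)
  moreover have "frob_sq A = (\<Sum>x\<in>?S. (A $$ x)\<^sup>2)" "frob_sq B = (\<Sum>x\<in>?S. (B $$ x)\<^sup>2)"
    using assms by (simp_all add: frob_sq_def sum.cartesian_product case_prod_unfold)
  ultimately show ?thesis using Cauchy_Schwarz_ineq_sum[of "\<lambda>x. A $$ x" "\<lambda>x. B $$ x" ?S] by simp
qed

section \<open>Powers of square matrices and the traces of powers of products\<close>

context
  fixes n :: nat
begin

lemma sq_mult_carrier [simp, intro]:
  fixes A :: "real mat"
  shows "A \<in> carrier_mat n n \<Longrightarrow> B \<in> carrier_mat n n \<Longrightarrow> A * B \<in> carrier_mat n n"
  by auto

lemma sq_assoc:
  fixes A :: "real mat"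
  shows "A \<in> carrier_mat n n \<Longrightarrow> B \<in> carrier_mat n n \<Longrightarrow> C \<in> carrier_mat n n \<Longrightarrow> A * B * C = A * (B * C)"
  by (rule assoc_mult_mat)

lemma sq_pow_add:
  fixes A :: "real mat"
  assumes "A \<in> carrier_mat n n"
  shows "A ^\<^sub>m (j + k) = A ^\<^sub>m j * A ^\<^sub>m k"
proof (induction k)
  case 0
  show ?case using assms by simp
next
  case (Suc k)
  then show ?case using assms by (simp add: sq_assoc)
qed

lemma sq_pow_mult:
  fixes A :: "real mat"
  assumes "A \<in> carrier_mat n n"
  shows "A ^\<^sub>m (j * k) = (A ^\<^sub>m j) ^\<^sub>m k"
proof (induction k)
  case 0
  show ?case using assms by simp
next
  case (Suc k)
  have "A ^\<^sub>m (j * Suc k) = A ^\<^sub>m (j * k + j)" by (simp add: add.commute)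
  then show ?case using assms Suc by (simp add: sq_pow_add)
qed

lemma sq_pow_2: "(A :: real mat) \<in> carrier_mat n n \<Longrightarrow> A ^\<^sub>m 2 = A * A"
  by (simp add: numeral_2_eq_2)

lemma sq_pow_commute:
  fixes A :: "real mat"
  assumes "A \<in> carrier_mat n n"
  shows "A ^\<^sub>m k * A = A * A ^\<^sub>m k"
  using assms sq_pow_add[OF assms, of 1 k] by simp

lemma sq_transpose_pow:
  fixes A :: "real mat"
  assumes A: "A \<in> carrier_mat n n"
  shows "(A ^\<^sub>m k)\<^sup>T = A\<^sup>T ^\<^sub>m k"
proof (induction k)
  case 0
  show ?case using assms by simp
next
  case (Suc k)
  have "(A ^\<^sub>m Suc k)\<^sup>T = (A * A ^\<^sub>m k)\<^sup>T" using A by (simp add: sq_pow_commute)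
  also have "\<dots> = (A ^\<^sub>m k)\<^sup>T * A\<^sup>T" by (rule transpose_mult[of _ n n _ n]) (use A in auto)
  finally show ?case using Suc by simp
qed

lemma sq_pow_mult_Suc:
  fixes A :: "real mat"
  assumes A: "A \<in> carrier_mat n n" and B: "B \<in> carrier_mat n n"
  shows "(A * B) ^\<^sub>m Suc k = A * (B * A) ^\<^sub>m k * B"
proof (induction k)
  case 0
  show ?case using A B by simp
next
  case (Suc k)
  have P: "(B * A) ^\<^sub>m k \<in> carrier_mat n n" using A B by auto
  have "(A * B) ^\<^sub>m Suc (Suc k) = A * (B * A) ^\<^sub>m k * B * (A * B)" using Suc by simp
  also have "\<dots> = A * (B * A) ^\<^sub>m Suc k * B" using A B P by (simp add: sq_assoc)
  finally show ?case .
qed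

text \<open>Cyclicity inside a power: for positive \<open>k\<close>, \<open>(A * B)^k\<close> is
  \<open>A * (B * A)^(k-1) * B\<close>, and the outer factors rotate under the trace. This regroups
  the products in the power inequality below.\<close>

lemma mtrace_pow_comm:
  assumes A: "A \<in> carrier_mat n n" and B: "B \<in> carrier_mat n n"
  shows "mtrace ((A * B) ^\<^sub>m k) = mtrace ((B * A) ^\<^sub>m k)"
proof (cases k)
  case 0
  then show ?thesis using A B by simp
next
  case (Suc j)
  have P: "(B * A) ^\<^sub>m j \<in> carrier_mat n n" using A B by auto
  have "mtrace ((A * B) ^\<^sub>m k) = mtrace (A * ((B * A) ^\<^sub>m j * B))"
    unfolding Suc sq_pow_mult_Suc[OF A B] using A B P by (simp add: sq_assoc)
  also have "\<dots> = mtrace ((B * A) ^\<^sub>m j * B * A)"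
    using A B P by (intro mtrace_comm) auto
  also have "\<dots> = mtrace ((B * A) ^\<^sub>m k)" using A B P Suc by (simp add: sq_assoc)
  finally show ?thesis .
qed

lemma mtrace_pow_even_sym:
  assumes A: "A \<in> carrier_mat n n" and "A\<^sup>T = A"
  shows "mtrace (A ^\<^sub>m (2 * k)) = frob_sq (A ^\<^sub>m k)"
  using assms by (simp add: frob_sq_trace[of _ n n] sq_transpose_pow mult_2 sq_pow_add)

text \<open>Cauchy--Schwarz for \<open>Z\<close> against its own transpose, which has the same
  Frobenius norm. This is the base case of the induction below.\<close>

lemma abs_mtrace_square_le:
  assumes Z: "Z \<in> carrier_mat n n"
  shows "\<bar>mtrace (Z * Z)\<bar> \<le> mtrace (Z * Z\<^sup>T)"
proof -
  have "(mtrace (Z * (Z\<^sup>T)\<^sup>T))\<^sup>2 \<le> frob_sq Z * frob_sq Z\<^sup>T"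
    using Z by (intro mtrace_Cauchy_Schwarz[of _ n n]) auto
  then have "(mtrace (Z * Z))\<^sup>2 \<le> (frob_sq Z)\<^sup>2" by (simp add: frob_sq_transpose power2_eq_square)
  then have "\<bar>mtrace (Z * Z)\<bar> \<le> frob_sq Z" using frob_sq_nonneg[of Z] by (simp add: abs_le_square_iff[symmetric])
  then show ?thesis using Z by (simp add: frob_sq_trace)
qed

text \<open>Both bounds are proved by one simultaneous induction: the first for \<open>j\<close> yields the second for
  \<open>j + 1\<close> with \<open>Z = X * Y\<close>, and the second applied to \<open>Z\<^sup>T * Z\<close> and \<open>Z * Z\<^sup>T\<close> lifts the first.\<close>
lemma mtrace_pow2_bounds:
  shows "\<And>Z. Z \<in> carrier_mat n n \<Longrightarrow> \<bar>mtrace (Z ^\<^sub>m (2 * 2 ^ j))\<bar> \<le> mtrace ((Z * Z\<^sup>T) ^\<^sub>m (2 ^ j))"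
    and "\<And>X Y. X \<in> carrier_mat n n \<Longrightarrow> Y \<in> carrier_mat n n \<Longrightarrow> X\<^sup>T = X \<Longrightarrow> Y\<^sup>T = Y \<Longrightarrow>
      \<bar>mtrace ((X * Y) ^\<^sub>m (2 ^ j))\<bar> \<le> \<bar>mtrace (X ^\<^sub>m (2 ^ j) * Y ^\<^sub>m (2 ^ j))\<bar>"
proof (induction j)
  case 0
  { case (1 Z)
    then show ?case using abs_mtrace_square_le[of Z] by (simp add: sq_pow_2)
  next
    case (2 X Y)
    then show ?case by simp }
next
  case (Suc j)
  have B: "\<bar>mtrace ((X * Y) ^\<^sub>m (2 ^ Suc j))\<bar> \<le> \<bar>mtrace (X ^\<^sub>m (2 ^ Suc j) * Y ^\<^sub>m (2 ^ Suc j))\<bar>"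
    if X: "X \<in> carrier_mat n n" and Y: "Y \<in> carrier_mat n n" and sX: "X\<^sup>T = X" and sY: "Y\<^sup>T = Y" for X Y
  proof -
    have t: "(X * Y)\<^sup>T = Y * X" using transpose_mult[OF X Y] sX sY by simp
    have tX: "(X * X)\<^sup>T = X * X" "(Y * Y)\<^sup>T = Y * Y"
      using transpose_mult[OF X X] transpose_mult[OF Y Y] sX sY by simp_all
    have "\<bar>mtrace ((X * Y) ^\<^sub>m (2 ^ Suc j))\<bar> \<le> mtrace ((X * Y * (Y * X)) ^\<^sub>m (2 ^ j))"
      using Suc(1)[of "X * Y"] X Y t by simp
    also have "X * Y * (Y * X) = X * ((Y * Y) * X)" using X Y by (simp add: sq_assoc)
    also have "mtrace ((X * ((Y * Y) * X)) ^\<^sub>m (2 ^ j)) = mtrace (((Y * Y) * X * X) ^\<^sub>m (2 ^ j))"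
      using X Y by (intro mtrace_pow_comm) auto
    also have "(Y * Y) * X * X = (Y * Y) * (X * X)" using X Y by (simp add: sq_assoc)
    also have "mtrace (((Y * Y) * (X * X)) ^\<^sub>m (2 ^ j)) = mtrace (((X * X) * (Y * Y)) ^\<^sub>m (2 ^ j))"
      using X Y by (intro mtrace_pow_comm) auto
    also have "\<dots> \<le> \<bar>mtrace ((X * X) ^\<^sub>m (2 ^ j) * (Y * Y) ^\<^sub>m (2 ^ j))\<bar>"
      using Suc(2)[of "X * X" "Y * Y"] X Y tX by auto
    also have "(X * X) ^\<^sub>m (2 ^ j) = X ^\<^sub>m (2 ^ Suc j)" using X by (simp add: sq_pow_mult sq_pow_2)
    also have "(Y * Y) ^\<^sub>m (2 ^ j) = Y ^\<^sub>m (2 ^ Suc j)" using Y by (simp add: sq_pow_mult sq_pow_2)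
    finally show ?thesis .
  qed
  { case (1 Z)
    then have Z: "Z \<in> carrier_mat n n" by simp
    have ZT: "Z\<^sup>T \<in> carrier_mat n n" using Z by simp
    let ?P = "Z\<^sup>T * Z" and ?Q = "Z * Z\<^sup>T"
    have P: "?P \<in> carrier_mat n n" "?P\<^sup>T = ?P" using Z ZT transpose_mult[OF ZT Z] by auto
    have Q: "?Q \<in> carrier_mat n n" "?Q\<^sup>T = ?Q" using Z ZT transpose_mult[OF Z ZT] by auto
    \<comment> \<open>Powers of \<open>Z\<^sup>T * Z\<close> and of \<open>Z * Z\<^sup>T\<close>
      have equal traces, hence equal Frobenius norms; the Cauchy--Schwarz bound on the mixed trace
      therefore collapses to a single norm.\<close>
    have PQ: "frob_sq (?P ^\<^sub>m (2 ^ j)) = frob_sq (?Q ^\<^sub>m (2 ^ j))"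
      using mtrace_pow_even_sym[OF P, of "2^j"] mtrace_pow_even_sym[OF Q, of "2^j"]
        mtrace_pow_comm[OF Z ZT, of "2 * 2^j"] by simp
    have "Z ^\<^sub>m (2 * 2 ^ Suc j) = (Z * Z) ^\<^sub>m (2 * 2 ^ j)"
      using sq_pow_mult[OF Z, of 2 "2 * 2 ^ j"] Z by (simp add: sq_pow_2)
    then have "\<bar>mtrace (Z ^\<^sub>m (2 * 2 ^ Suc j))\<bar> \<le> mtrace ((Z * Z * (Z * Z)\<^sup>T) ^\<^sub>m (2 ^ j))"
      using Suc(1)[of "Z * Z"] Z by simp
    also have "(Z * Z)\<^sup>T = Z\<^sup>T * Z\<^sup>T" by (rule transpose_mult[OF Z Z])
    also have "Z * Z * (Z\<^sup>T * Z\<^sup>T) = Z * ((Z * Z\<^sup>T) * Z\<^sup>T)" using Z ZT by (simp add: sq_assoc)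
    also have "mtrace ((Z * ((Z * Z\<^sup>T) * Z\<^sup>T)) ^\<^sub>m (2 ^ j)) = mtrace (((Z * Z\<^sup>T) * Z\<^sup>T * Z) ^\<^sub>m (2 ^ j))"
      using Z ZT by (intro mtrace_pow_comm) auto
    also have "(Z * Z\<^sup>T) * Z\<^sup>T * Z = ?Q * ?P" using Z ZT by (simp add: sq_assoc)
    also have "mtrace ((?Q * ?P) ^\<^sub>m (2 ^ j)) \<le> \<bar>mtrace (?Q ^\<^sub>m (2 ^ j) * ?P ^\<^sub>m (2 ^ j))\<bar>"
      using Suc(2)[OF Q(1) P(1) Q(2) P(2)] by simp
    also have "\<dots> = \<bar>mtrace (?Q ^\<^sub>m (2 ^ j) * (?P ^\<^sub>m (2 ^ j))\<^sup>T)\<bar>" using P by (simp add: sq_transpose_pow)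
    also have "\<dots> \<le> frob_sq (?Q ^\<^sub>m (2 ^ j))"
    proof -
      have "(mtrace (?Q ^\<^sub>m (2 ^ j) * (?P ^\<^sub>m (2 ^ j))\<^sup>T))\<^sup>2 \<le> (frob_sq (?Q ^\<^sub>m (2 ^ j)))\<^sup>2"
        using mtrace_Cauchy_Schwarz[of "?Q ^\<^sub>m (2 ^ j)" n n "?P ^\<^sub>m (2 ^ j)"] P Q PQ
        by (simp add: power2_eq_square)
      then show ?thesis using frob_sq_nonneg by (simp add: abs_le_square_iff[symmetric])
    qed
    also have "\<dots> = mtrace ((Z * Z\<^sup>T) ^\<^sub>m (2 ^ Suc j))" using mtrace_pow_even_sym[OF Q, of "2^j"] by simp
    finally show ?case .
  next
    case (2 X Y)
    then show ?case using B by blast }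
qed

end

section \<open>Operator norm bounds and the Golden--Thompson inequality\<close>

abbreviation nsq :: "real vec \<Rightarrow> real" where
  "nsq x \<equiv> x \<bullet> x"

definition vnorm :: "real vec \<Rightarrow> real" where
  "vnorm x = sqrt (x \<bullet> x)"

lemma scalar_prod_self: "(x :: real vec) \<in> carrier_vec n \<Longrightarrow> x \<bullet> x = (\<Sum>i<n. (x $ i)\<^sup>2)"
  by (auto simp: scalar_prod_def lessThan_atLeast0 power2_eq_square)

lemma scalar_prod_self_nonneg [simp]: "0 \<le> (x :: real vec) \<bullet> x"
  by (auto simp: scalar_prod_def intro: sum_nonneg)

lemma vnorm_L2_set: "x \<in> carrier_vec n \<Longrightarrow> vnorm x = L2_set (\<lambda>i. x $ i) {..<n}"
  by (simp add: vnorm_def L2_set_def scalar_prod_self)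

lemma vnorm_nonneg [simp]: "0 \<le> vnorm x"
  by (simp add: vnorm_def)

lemma vnorm_sq: "(vnorm x)\<^sup>2 = x \<bullet> x"
  by (simp add: vnorm_def)

lemma vnorm_zero [simp]: "vnorm (0\<^sub>v n) = 0"
  by (simp add: vnorm_def)

lemma scalar_prod_self_eq_0:
  assumes "(x :: real vec) \<in> carrier_vec n" "x \<bullet> x = 0"
  shows "x = 0\<^sub>v n"
proof (rule eq_vecI)
  fix i assume "i < dim_vec (0\<^sub>v n :: real vec)"
  then show "x $ i = 0\<^sub>v n $ i"
    using assms sum_nonneg_eq_0_iff[of "{..<n}" "\<lambda>i. (x $ i)\<^sup>2"] by (simp add: scalar_prod_self)
qed (use assms in simp)

lemma vnorm_triangle:
  assumes "x \<in> carrier_vec n" "y \<in> carrier_vec n"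
  shows "vnorm (x + y) \<le> vnorm x + vnorm y"
proof -
  have "L2_set (\<lambda>i. (x + y) $ i) {..<n} = L2_set (\<lambda>i. x $ i + y $ i) {..<n}"
    using assms by (intro L2_set_cong) auto
  moreover have "x + y \<in> carrier_vec n" using assms by auto
  ultimately show ?thesis
    using assms L2_set_triangle_ineq[of "\<lambda>i. x $ i" "\<lambda>i. y $ i" "{..<n}"] by (simp add: vnorm_L2_set[of _ n])
qed

lemma vnorm_smult: "x \<in> carrier_vec n \<Longrightarrow> vnorm (c \<cdot>\<^sub>v x) = \<bar>c\<bar> * vnorm x"
  by (simp add: vnorm_def real_sqrt_mult mult.assoc[symmetric])

lemma scalar_prod_Cauchy_Schwarz:
  assumes "x \<in> carrier_vec n" "y \<in> carrier_vec n"
  shows "\<bar>x \<bullet> y\<bar> \<le> vnorm x * vnorm y"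
proof -
  have "\<bar>x \<bullet> y\<bar> \<le> (\<Sum>i<n. \<bar>x $ i\<bar> * \<bar>y $ i\<bar>)"
    using assms by (auto simp: scalar_prod_def lessThan_atLeast0 abs_mult[symmetric] intro!: sum_abs)
  also have "\<dots> \<le> vnorm x * vnorm y" using assms by (simp add: vnorm_L2_set L2_set_mult_ineq)
  finally show ?thesis .
qed

lemma scalar_prod_mult_mat_sym:
  assumes "(A :: real mat) \<in> carrier_mat n n" "A\<^sup>T = A" "x \<in> carrier_vec n" "y \<in> carrier_vec n"
  shows "x \<bullet> (A *\<^sub>v y) = (A *\<^sub>v x) \<bullet> y"
  using transpose_vec_mult_scalar[OF assms(1,4,3)] assms by simp

text \<open>An upper bound for the operator norm, kept as a relation instead of a supremum. The
  dimension and the sign of \<open>c\<close> are part of it, so that bounds compose through sums,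
  products and powers without side conditions.\<close>

definition op_le :: "nat \<Rightarrow> real mat \<Rightarrow> real \<Rightarrow> bool" where
  "op_le n X c \<longleftrightarrow> X \<in> carrier_mat n n \<and> 0 \<le> c \<and> (\<forall>x\<in>carrier_vec n. vnorm (X *\<^sub>v x) \<le> c * vnorm x)"

lemma op_leD:
  assumes "op_le n X c"
  shows "X \<in> carrier_mat n n" "0 \<le> c" "x \<in> carrier_vec n \<Longrightarrow> vnorm (X *\<^sub>v x) \<le> c * vnorm x"
  using assms by (auto simp: op_le_def)

lemma op_le_mono: "op_le n X c \<Longrightarrow> c \<le> d \<Longrightarrow> op_le n X d"
  unfolding op_le_def by (meson mult_right_mono order_trans vnorm_nonneg)

lemma op_le_one: "op_le n (1\<^sub>m n) 1"
  by (simp add: op_le_def)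

lemma op_le_zero: "op_le n (0\<^sub>m n n) 0"
proof -
  have "0\<^sub>m n n *\<^sub>v x = 0\<^sub>v n" if "x \<in> carrier_vec n" for x :: "real vec"
    using that by (intro eq_vecI) auto
  then show ?thesis by (simp add: op_le_def)
qed

lemma op_le_add:
  assumes "op_le n X c" "op_le n Y d"
  shows "op_le n (X + Y) (c + d)"
  unfolding op_le_def
proof (intro conjI ballI)
  fix x :: "real vec" assume x: "x \<in> carrier_vec n"
  have "vnorm ((X + Y) *\<^sub>v x) = vnorm (X *\<^sub>v x + Y *\<^sub>v x)"
    using assms x by (simp add: op_le_def add_mult_distrib_mat_vec[of _ n n])
  also have "\<dots> \<le> vnorm (X *\<^sub>v x) + vnorm (Y *\<^sub>v x)"
    using assms x by (intro vnorm_triangle[of _ n]) (auto simp: op_le_def)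
  also have "\<dots> \<le> c * vnorm x + d * vnorm x" using assms x by (intro add_mono) (auto simp: op_le_def)
  finally show "vnorm ((X + Y) *\<^sub>v x) \<le> (c + d) * vnorm x" by (simp add: algebra_simps)
qed (use assms in \<open>auto simp: op_le_def\<close>)

lemma op_le_mult:
  assumes "op_le n X c" "op_le n Y d"
  shows "op_le n (X * Y) (c * d)"
  unfolding op_le_def
proof (intro conjI ballI)
  fix x :: "real vec" assume x: "x \<in> carrier_vec n"
  have Y: "Y *\<^sub>v x \<in> carrier_vec n" using assms x by (auto simp: op_le_def)
  have "vnorm ((X * Y) *\<^sub>v x) = vnorm (X *\<^sub>v (Y *\<^sub>v x))"
    using assms x by (simp add: op_le_def assoc_mult_mat_vec[of _ n n _ n])
  also have "\<dots> \<le> c * vnorm (Y *\<^sub>v x)" using assms Y by (auto simp: op_le_def)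
  also have "\<dots> \<le> c * (d * vnorm x)" using assms x by (intro mult_left_mono) (auto simp: op_le_def)
  finally show "vnorm ((X * Y) *\<^sub>v x) \<le> (c * d) * vnorm x" by (simp add: algebra_simps)
qed (use assms in \<open>auto simp: op_le_def\<close>)

lemma op_le_smult:
  assumes "op_le n X c"
  shows "op_le n (a \<cdot>\<^sub>m X) (\<bar>a\<bar> * c)"
  unfolding op_le_def
proof (intro conjI ballI)
  fix x :: "real vec" assume x: "x \<in> carrier_vec n"
  have "(a \<cdot>\<^sub>m X) *\<^sub>v x = a \<cdot>\<^sub>v (X *\<^sub>v x)" using assms x by (intro eq_vecI) (auto simp: op_le_def)
  moreover have "X *\<^sub>v x \<in> carrier_vec n" using assms x by (auto simp: op_le_def)
  ultimately show "vnorm ((a \<cdot>\<^sub>m X) *\<^sub>v x) \<le> (\<bar>a\<bar> * c) * vnorm x"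
    using op_leD(3)[OF assms x] by (simp add: vnorm_smult[of _ n] mult.assoc mult_left_mono)
qed (use assms in \<open>auto simp: op_le_def\<close>)

lemma op_le_pow: "op_le n X c \<Longrightarrow> op_le n (X ^\<^sub>m k) (c ^ k)"
proof (induction k)
  case 0
  then have "dim_row X = n" by (auto simp: op_le_def)
  then show ?case by (simp add: op_le_one)
next
  case (Suc k)
  then show ?case using op_le_mult[of n "X ^\<^sub>m k" "c ^ k" X c] by (simp add: mult.commute)
qed

lemma mult_mat_vec_norm_le_frob:
  assumes X: "X \<in> carrier_mat a b" and x: "x \<in> carrier_vec b"
  shows "nsq (X *\<^sub>v x) \<le> frob_sq X * (x \<bullet> x)"
proof -
  have Xx: "X *\<^sub>v x \<in> carrier_vec a" using X x by auto
  have "nsq (X *\<^sub>v x) = (\<Sum>i<a. ((X *\<^sub>v x) $ i)\<^sup>2)" by (rule scalar_prod_self[OF Xx])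
  also have "\<dots> \<le> (\<Sum>i<a. (\<Sum>j<b. (X $$ (i,j))\<^sup>2) * (x \<bullet> x))"
  proof (rule sum_mono)
    fix i assume i: "i \<in> {..<a}"
    have "(X *\<^sub>v x) $ i = (\<Sum>j<b. X $$ (i,j) * x $ j)"
      using X x i by (auto simp: scalar_prod_def lessThan_atLeast0)
    then show "((X *\<^sub>v x) $ i)\<^sup>2 \<le> (\<Sum>j<b. (X $$ (i,j))\<^sup>2) * (x \<bullet> x)"
      using Cauchy_Schwarz_ineq_sum[of "\<lambda>j. X $$ (i,j)" "\<lambda>j. x $ j" "{..<b}"] x
      by (simp add: scalar_prod_self)
  qed
  also have "\<dots> = frob_sq X * (x \<bullet> x)" using X by (simp add: frob_sq_def sum_distrib_right)
  finally show ?thesis .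
qed

lemma op_le_frob:
  assumes "X \<in> carrier_mat n n"
  shows "op_le n X (sqrt (frob_sq X))"
  unfolding op_le_def
proof (intro conjI ballI)
  fix x :: "real vec" assume x: "x \<in> carrier_vec n"
  show "vnorm (X *\<^sub>v x) \<le> sqrt (frob_sq X) * vnorm x"
    using mult_mat_vec_norm_le_frob[OF assms x] by (simp add: vnorm_def real_sqrt_mult[symmetric])
qed (use assms frob_sq_nonneg in auto)

lemma quadratic_form_unit_vec:
  assumes "(X :: real mat) \<in> carrier_mat n n" "i < n"
  shows "unit_vec n i \<bullet> (X *\<^sub>v unit_vec n i) = X $$ (i,i)"
  using assms by (subst scalar_prod_left_unit) auto

lemma vnorm_unit_vec [simp]: "i < n \<Longrightarrow> vnorm (unit_vec n i) = 1"
  by (simp add: vnorm_def)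

text \<open>Every diagonal entry is a quadratic form at a unit vector, hence at most
  \<open>c\<close> in absolute value.\<close>

lemma abs_mtrace_le_op:
  assumes "op_le n X c"
  shows "\<bar>mtrace X\<bar> \<le> n * c"
proof -
  have X: "X \<in> carrier_mat n n" using assms by (auto simp: op_le_def)
  have "\<bar>X $$ (i,i)\<bar> \<le> c" if i: "i < n" for i
  proof -
    have u: "unit_vec n i \<in> carrier_vec n" by simp
    have "\<bar>X $$ (i,i)\<bar> \<le> vnorm (unit_vec n i) * vnorm (X *\<^sub>v unit_vec n i)"
      using scalar_prod_Cauchy_Schwarz[OF u, of "X *\<^sub>v unit_vec n i"] X i
      by (simp add: quadratic_form_unit_vec)
    then show ?thesis using op_leD(3)[OF assms u] i by simp
  qed
  then have "(\<Sum>i<n. \<bar>X $$ (i,i)\<bar>) \<le> (\<Sum>i<n. c)" by (intro sum_mono) auto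
  moreover have "\<bar>mtrace X\<bar> \<le> (\<Sum>i<n. \<bar>X $$ (i,i)\<bar>)" using X by (auto simp: mtrace_def)
  ultimately show ?thesis by simp
qed

text \<open>Telescoping: \<open>P^(k+1) - R^(k+1)\<close> equals
  \<open>P^k * (P - R) + (P^k - R^k) * R\<close>, and each of the \<open>k + 1\<close> resulting
  terms has norm at most \<open>c^k * d\<close>.\<close>

lemma op_le_pow_diff:
  assumes P: "op_le n P c" and R: "op_le n R c" and d: "op_le n (P - R) d"
  shows "op_le n (P ^\<^sub>m (Suc k) - R ^\<^sub>m (Suc k)) (real (Suc k) * c ^ k * d)"
proof (induction k)
  case 0
  have "dim_row P = n" "dim_row R = n" using P R by (auto simp: op_le_def)
  moreover have "P \<in> carrier_mat n n" "R \<in> carrier_mat n n" using P R by (auto simp: op_le_def)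
  ultimately show ?case using d by simp
next
  case (Suc k)
  have car: "P \<in> carrier_mat n n" "R \<in> carrier_mat n n" using P R by (auto simp: op_le_def)
  have car': "P ^\<^sub>m Suc k \<in> carrier_mat n n" "R ^\<^sub>m Suc k \<in> carrier_mat n n" using car pow_carrier_mat by blast+
  have "P ^\<^sub>m Suc (Suc k) - R ^\<^sub>m Suc (Suc k) = P ^\<^sub>m Suc k * (P - R) + (P ^\<^sub>m Suc k - R ^\<^sub>m Suc k) * R"
  proof -
    have "P ^\<^sub>m Suc (Suc k) = P ^\<^sub>m Suc k * P" "R ^\<^sub>m Suc (Suc k) = R ^\<^sub>m Suc k * R" by simp_all
    moreover have "P ^\<^sub>m Suc k * (P - R) = P ^\<^sub>m Suc k * P - P ^\<^sub>m Suc k * R"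
      by (rule mult_minus_distrib_mat[of _ n n]) (use car car' in auto)
    moreover have "(P ^\<^sub>m Suc k - R ^\<^sub>m Suc k) * R = P ^\<^sub>m Suc k * R - R ^\<^sub>m Suc k * R"
      by (rule minus_mult_distrib_mat[of _ n n]) (use car car' in auto)
    moreover have "A - C = (A - B) + (B - C)" if "A \<in> carrier_mat n n" "B \<in> carrier_mat n n" "C \<in> carrier_mat n n"
      for A B C :: "real mat" using that by (intro eq_matI) auto
    ultimately show ?thesis using car car' by (metis sq_mult_carrier)
  qed
  moreover have "op_le n (P ^\<^sub>m Suc k * (P - R) + (P ^\<^sub>m Suc k - R ^\<^sub>m Suc k) * R) (c ^ Suc k * d + (real (Suc k) * c ^ k * d) * c)"
    by (intro op_le_add op_le_mult op_le_pow P R d Suc)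
  ultimately show ?case by (simp add: algebra_simps)
qed

section \<open>Euler approximations of the matrix exponential and the Golden--Thompson step\<close>

abbreviation euler :: "nat \<Rightarrow> nat \<Rightarrow> real mat \<Rightarrow> real mat" where
  "euler n k X \<equiv> 1\<^sub>m n + (1 / 2 ^ k) \<cdot>\<^sub>m X"

text \<open>Stands in for the trace of the matrix exponential of \<open>X\<close>, its limit as \<open>k\<close> grows. The exponent is a power of
  2 because the trace inequality behind Golden--Thompson is only available for such powers.\<close>
definition exp_trace :: "nat \<Rightarrow> nat \<Rightarrow> real mat \<Rightarrow> real" where
  "exp_trace n k X = mtrace ((euler n k X) ^\<^sub>m (2 ^ k))"

text \<open>With \<open>t = 1 / 2^k\<close>, the product of the Euler factors of \<open>X\<close>
  and \<open>Y\<close> differs from the Euler factor of \<open>X + Y\<close> by \<open>t^2\<close>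
  times \<open>X * Y\<close>. Raising to the power \<open>1 / t\<close> costs a factor
  \<open>1 / t\<close>, so the traces differ by \<open>O(t)\<close>.\<close>

lemma trace_Lie_Trotter:
  assumes X: "X \<in> carrier_mat n n" and Y: "Y \<in> carrier_mat n n"
  shows "(\<lambda>k. exp_trace n k (X + Y) -
     mtrace ((euler n k X * euler n k Y) ^\<^sub>m (2 ^ k))) \<longlonglongrightarrow> 0"
    (is "(\<lambda>k. exp_trace n k (X + Y) - mtrace (?R k ^\<^sub>m (2 ^ k))) \<longlonglongrightarrow> 0")
proof -
  define a where "a = sqrt (frob_sq X)"
  define b where "b = sqrt (frob_sq Y)"
  have a: "op_le n X a" and b: "op_le n Y b" using X Y op_le_frob by (auto simp: a_def b_def)
  have a0: "0 \<le> a" and b0: "0 \<le> b" using a b by (auto simp: op_le_def)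
  \<comment> \<open>The summand \<open>a * b\<close> absorbs the product term
    \<open>t^2 * a * b\<close>, as \<open>t \<le> 1\<close>; so \<open>1 + t * \<kappa>\<close>
    bounds the norms of both Euler expressions.\<close>
  define \<kappa> where "\<kappa> = a + b + a * b"
  have \<kappa>0: "0 \<le> \<kappa>" using a0 b0 by (simp add: \<kappa>_def)
  have bound: "\<bar>exp_trace n k (X + Y) - mtrace (?R k ^\<^sub>m (2 ^ k))\<bar> \<le> (n * exp \<kappa> * (a * b)) * (1/2) ^ k" for k
  proof -
    define q :: nat where "q = 2 ^ k"
    define t :: real where "t = 1 / q"
    have q1: "1 \<le> q" by (simp add: q_def)
    have t: "0 < t" "t \<le> 1" and tq: "1 / 2 ^ k = t" and qt: "q * t = 1" using q1 by (auto simp: t_def q_def)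
    let ?P = "1\<^sub>m n + t \<cdot>\<^sub>m (X + Y)" and ?R = "(1\<^sub>m n + t \<cdot>\<^sub>m X) * (1\<^sub>m n + t \<cdot>\<^sub>m Y)"
    have R: "?R = ?P + t\<^sup>2 \<cdot>\<^sub>m (X * Y)"
    proof -
      have "?R = 1\<^sub>m n * (1\<^sub>m n + t \<cdot>\<^sub>m Y) + t \<cdot>\<^sub>m X * (1\<^sub>m n + t \<cdot>\<^sub>m Y)"
        using X Y by (intro add_mult_distrib_mat[of _ n n]) auto
      also have "\<dots> = 1\<^sub>m n + t \<cdot>\<^sub>m Y + (t \<cdot>\<^sub>m X * 1\<^sub>m n + t \<cdot>\<^sub>m X * (t \<cdot>\<^sub>m Y))"
        using X Y by (subst mult_add_distrib_mat[of _ n n]) auto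
      also have "t \<cdot>\<^sub>m X * (t \<cdot>\<^sub>m Y) = t\<^sup>2 \<cdot>\<^sub>m (X * Y)"
        using X Y by (simp add: mult_smult_distrib[of _ n n] mult_smult_assoc_mat[of _ n n] power2_eq_square)
          (intro eq_matI; simp)
      finally have "?R = 1\<^sub>m n + t \<cdot>\<^sub>m Y + (t \<cdot>\<^sub>m X + t\<^sup>2 \<cdot>\<^sub>m (X * Y))" using X by simp
      moreover have "X * Y \<in> carrier_mat n n" using X Y by simp
      ultimately show ?thesis using X Y by (intro eq_matI) (auto simp: algebra_simps)
    qed
    have Pn: "op_le n ?P (1 + t * \<kappa>)"
    proof (rule op_le_mono)
      show "op_le n ?P (1 + \<bar>t\<bar> * (a + b))" by (intro op_le_add op_le_one op_le_smult a b)
      show "1 + \<bar>t\<bar> * (a + b) \<le> 1 + t * \<kappa>" using t a0 b0 by (simp add: \<kappa>_def)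
    qed
    have Rn: "op_le n ?R (1 + t * \<kappa>)"
    proof (rule op_le_mono)
      show "op_le n ?R ((1 + \<bar>t\<bar> * a) * (1 + \<bar>t\<bar> * b))"
        by (intro op_le_mult op_le_add op_le_one op_le_smult a b)
      have "t * t * (a * b) \<le> t * (a * b)" using t a0 b0 by (intro mult_right_mono) (auto simp: mult_le_one)
      then show "(1 + \<bar>t\<bar> * a) * (1 + \<bar>t\<bar> * b) \<le> 1 + t * \<kappa>" using t by (simp add: \<kappa>_def algebra_simps)
    qed
    have "?P - ?R = (- (t\<^sup>2)) \<cdot>\<^sub>m (X * Y)"
    proof -
      have "X * Y \<in> carrier_mat n n" using X Y by simp
      then show ?thesis unfolding R using X Y by (intro eq_matI) (auto simp: algebra_simps)
    qed
    moreover have "op_le n ((- (t\<^sup>2)) \<cdot>\<^sub>m (X * Y)) (\<bar>- (t\<^sup>2)\<bar> * (a * b))"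
      by (intro op_le_smult op_le_mult a b)
    ultimately have D: "op_le n (?P - ?R) (t\<^sup>2 * (a * b))" by simp
    have qS: "Suc (q - 1) = q" using q1 by simp
    have "op_le n (?P ^\<^sub>m q - ?R ^\<^sub>m q) (q * (1 + t * \<kappa>) ^ (q - 1) * (t\<^sup>2 * (a * b)))"
      using op_le_pow_diff[OF Pn Rn D, of "q - 1"] unfolding qS .
    from abs_mtrace_le_op[OF this]
    have "\<bar>mtrace (?P ^\<^sub>m q - ?R ^\<^sub>m q)\<bar> \<le> n * (q * (1 + t * \<kappa>) ^ (q - 1) * (t\<^sup>2 * (a * b)))" .
    also have "mtrace (?P ^\<^sub>m q - ?R ^\<^sub>m q) = mtrace (?P ^\<^sub>m q) - mtrace (?R ^\<^sub>m q)"
      using X Y by (intro mtrace_minus[of _ n]) auto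
    also have "n * (q * (1 + t * \<kappa>) ^ (q - 1) * (t\<^sup>2 * (a * b))) = n * (1 + t * \<kappa>) ^ (q - 1) * (a * b) * t * (q * t)"
      by (simp add: power2_eq_square)
    \<comment> \<open>Since \<open>q * t = 1\<close>, the powers stay below
      \<open>exp \<kappa>\<close> uniformly in \<open>k\<close>, and one factor \<open>t\<close>
      survives.\<close>
    also have "\<dots> \<le> n * exp \<kappa> * (a * b) * t"
    proof -
      have "(1 + t * \<kappa>) ^ (q - 1) \<le> (1 + t * \<kappa>) ^ q" using t \<kappa>0 by (intro power_increasing) auto
      also have "\<dots> \<le> exp (t * \<kappa>) ^ q" using t \<kappa>0 exp_ge_add_one_self by (intro power_mono) auto
      also have "\<dots> = exp \<kappa>" using qt by (simp add: exp_of_nat_mult[symmetric] mult.assoc[symmetric])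
      finally show ?thesis using t a0 b0 qt by (simp add: mult_left_mono mult_right_mono)
    qed
    finally show ?thesis unfolding exp_trace_def tq q_def[symmetric] using tq by (simp add: power_one_over)
  qed
  show ?thesis
  proof (rule Lim_null_comparison)
    show "\<forall>\<^sub>F k in sequentially. norm (exp_trace n k (X + Y) - mtrace (?R k ^\<^sub>m (2 ^ k))) \<le> (n * exp \<kappa> * (a * b)) * (1/2) ^ k"
      using bound by simp
    show "(\<lambda>k. (n * exp \<kappa> * (a * b)) * (1/2) ^ k) \<longlonglongrightarrow> (0::real)"
      by (intro tendsto_mult_right_zero LIMSEQ_power_zero) simp
  qed
qed

lemma sym_lin:
  assumes "(X :: real mat) \<in> carrier_mat n n" "X\<^sup>T = X"
  shows "(1\<^sub>m n + t \<cdot>\<^sub>m X)\<^sup>T = 1\<^sub>m n + t \<cdot>\<^sub>m X"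
proof (rule eq_matI)
  fix i j assume "i < dim_row (1\<^sub>m n + t \<cdot>\<^sub>m X)" "j < dim_col (1\<^sub>m n + t \<cdot>\<^sub>m X)"
  then have "i < n" "j < n" using assms by auto
  moreover have "X $$ (j,i) = X $$ (i,j)"
    using assms \<open>i < n\<close> \<open>j < n\<close> by (metis carrier_matD index_transpose_mat(1))
  ultimately show "(1\<^sub>m n + t \<cdot>\<^sub>m X)\<^sup>T $$ (i,j) = (1\<^sub>m n + t \<cdot>\<^sub>m X) $$ (i,j)" using assms by auto
qed (use assms in auto)

lemma sym_pow: "(X :: real mat) \<in> carrier_mat n n \<Longrightarrow> X\<^sup>T = X \<Longrightarrow> (X ^\<^sub>m k)\<^sup>T = X ^\<^sub>m k"
  by (simp add: sq_transpose_pow)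

text \<open>Splitting the even power of a symmetric matrix evenly around \<open>K\<close> turns the
  trace into quadratic forms of \<open>K\<close>. Bounds on forms thereby transfer to traces without
  any diagonalization.\<close>

lemma mtrace_sym_pow_mult:
  assumes H: "H \<in> carrier_mat n n" "H\<^sup>T = H" and K: "K \<in> carrier_mat n n"
  shows "mtrace (H ^\<^sub>m (2 * h) * K) = (\<Sum>i<n. (H ^\<^sub>m h *\<^sub>v unit_vec n i) \<bullet> (K *\<^sub>v (H ^\<^sub>m h *\<^sub>v unit_vec n i)))"
proof -
  let ?R = "H ^\<^sub>m h"
  have R: "?R \<in> carrier_mat n n" "?R\<^sup>T = ?R" using H sym_pow by auto
  have "mtrace (H ^\<^sub>m (2 * h) * K) = mtrace (?R * (?R * K))"
    using H R K by (simp add: mult_2 sq_pow_add sq_assoc[of _ n])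
  also have "\<dots> = mtrace (?R * K * ?R)" using R K by (intro mtrace_comm) auto
  also have "\<dots> = (\<Sum>i<n. unit_vec n i \<bullet> (?R * K * ?R *\<^sub>v unit_vec n i))"
    using R K by (auto simp: mtrace_def quadratic_form_unit_vec[of _ n] intro!: sum.cong simp del: assoc_mult_mat_vec)
  also have "\<dots> = (\<Sum>i<n. (?R *\<^sub>v unit_vec n i) \<bullet> (K *\<^sub>v (?R *\<^sub>v unit_vec n i)))"
  proof (rule sum.cong)
    fix i assume "i \<in> {..<n}"
    have "?R * K * ?R *\<^sub>v unit_vec n i = ?R *\<^sub>v (K *\<^sub>v (?R *\<^sub>v unit_vec n i))"
      using R K by (simp add: assoc_mult_mat_vec[of _ n n _ n])
    then show "unit_vec n i \<bullet> (?R * K * ?R *\<^sub>v unit_vec n i) = (?R *\<^sub>v unit_vec n i) \<bullet> (K *\<^sub>v (?R *\<^sub>v unit_vec n i))"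
      using R K scalar_prod_mult_mat_sym[OF R, of "unit_vec n i" "K *\<^sub>v (?R *\<^sub>v unit_vec n i)"] by simp
  qed simp
  finally show ?thesis .
qed

text \<open>Lie--Trotter passes from \<open>X + Y\<close> to the power of a product, and the trace
  inequality for exponents \<open>2^k\<close> separates the two factors. Only the first move costs
  an error.\<close>

lemma Golden_Thompson_limit:
  assumes X: "X \<in> carrier_mat n n" "X\<^sup>T = X" and Y: "Y \<in> carrier_mat n n" "Y\<^sup>T = Y"
  obtains e where "e \<longlonglongrightarrow> 0" and "\<And>k. 1 \<le> k \<Longrightarrow> exp_trace n k (X + Y) \<le>
    mtrace ((euler n k X) ^\<^sub>m (2 ^ k) * (euler n k Y) ^\<^sub>m (2 ^ k)) + e k"
proof
  show "(\<lambda>k. exp_trace n k (X + Y) -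
     mtrace ((euler n k X * euler n k Y) ^\<^sub>m (2 ^ k))) \<longlonglongrightarrow> 0"
    using X Y by (intro trace_Lie_Trotter)
  fix k :: nat assume "1 \<le> k"
  then obtain j where k: "k = Suc j" by (cases k) auto
  let ?P = "euler n k X" and ?R = "euler n k Y"
  have P: "?P \<in> carrier_mat n n" "?P\<^sup>T = ?P" and R: "?R \<in> carrier_mat n n" "?R\<^sup>T = ?R"
    using X Y sym_lin by auto
  have "0 \<le> mtrace (?P ^\<^sub>m (2 * 2 ^ j) * ?R ^\<^sub>m (2 * 2 ^ j))"
  proof -
    have Rj: "?R ^\<^sub>m (2 ^ j) \<in> carrier_mat n n" "(?R ^\<^sub>m (2 ^ j))\<^sup>T = ?R ^\<^sub>m (2 ^ j)"
      using R sym_pow[OF R] by auto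
    have nonneg: "0 \<le> x \<bullet> (?R ^\<^sub>m (2 * 2 ^ j) *\<^sub>v x)" if x: "x \<in> carrier_vec n" for x
    proof -
      have "?R ^\<^sub>m (2 * 2 ^ j) *\<^sub>v x = ?R ^\<^sub>m (2 ^ j) *\<^sub>v (?R ^\<^sub>m (2 ^ j) *\<^sub>v x)"
        using R x Rj by (simp add: mult_2 sq_pow_add assoc_mult_mat_vec[of _ n n _ n])
      then show ?thesis using scalar_prod_mult_mat_sym[OF Rj x, of "?R ^\<^sub>m (2 ^ j) *\<^sub>v x"] Rj x by simp
    qed
    show ?thesis
      unfolding mtrace_sym_pow_mult[OF P pow_carrier_mat[OF R(1)]]
      by (intro sum_nonneg nonneg mult_mat_vec_carrier[of _ n n] pow_carrier_mat P(1)) simp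
  qed
  moreover have "mtrace ((?P * ?R) ^\<^sub>m (2 ^ k)) \<le> \<bar>mtrace (?P ^\<^sub>m (2 ^ k) * ?R ^\<^sub>m (2 ^ k))\<bar>"
    using mtrace_pow2_bounds(2)[OF P(1) R(1) P(2) R(2), of k] by simp
  ultimately show "exp_trace n k (X + Y) \<le> mtrace (?P ^\<^sub>m (2 ^ k) * ?R ^\<^sub>m (2 ^ k)) +
     (exp_trace n k (X + Y) - mtrace ((?P * ?R) ^\<^sub>m (2 ^ k)))"
    unfolding k by simp
qed

text \<open>A second-order Taylor expansion proved by repeated squaring. Keeping a factor
  \<open>Y\<close> on both sides of the remainder, instead of only bounding its norm, lets the next
  lemma bound it by the squared length of \<open>Y x\<close>, which is what a variance estimate
  consumes.\<close>

lemma dyadic_pow_expansion: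
  assumes Y: "op_le n Y (1/2)" and "0 \<le> t" "t * 2 ^ i \<le> 1"
  shows "\<exists>E. op_le n E 1 \<and>
    (1\<^sub>m n + t \<cdot>\<^sub>m Y) ^\<^sub>m (2 ^ i) = 1\<^sub>m n + (t * 2 ^ i) \<cdot>\<^sub>m Y + (t * 2 ^ i)\<^sup>2 \<cdot>\<^sub>m (Y * E * Y)"
  using assms(3)
proof (induction i)
  case 0
  have Yc: "Y \<in> carrier_mat n n" using Y by (simp add: op_le_def)
  have "1\<^sub>m n + t \<cdot>\<^sub>m Y = 1\<^sub>m n + t \<cdot>\<^sub>m Y + t\<^sup>2 \<cdot>\<^sub>m (Y * 0\<^sub>m n n * Y)"
    using Yc by (simp add: right_mult_zero_mat[of _ n n] left_mult_zero_mat[of _ n n])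
  moreover have "op_le n (0\<^sub>m n n) 1" using op_le_zero op_le_mono zero_le_one by blast
  ultimately show ?case using Yc by auto
next
  case (Suc i)
  define s where "s = t * 2 ^ i"
  have s: "0 \<le> s" "s \<le> 1/2" using assms(2) Suc.prems by (auto simp: s_def)
  from Suc obtain E where E: "op_le n E 1"
    and eq: "(1\<^sub>m n + t \<cdot>\<^sub>m Y) ^\<^sub>m (2 ^ i) = 1\<^sub>m n + s \<cdot>\<^sub>m Y + s\<^sup>2 \<cdot>\<^sub>m (Y * E * Y)"
    using s by (auto simp: s_def)
  have Yc: "Y \<in> carrier_mat n n" and Ec: "E \<in> carrier_mat n n" using Y E by (simp_all add: op_le_def)
  \<comment> \<open>Squaring \<open>1 + s Y + s^2 Y E Y\<close> and writing the terms of order at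
    least two as \<open>(2 s)^2 Y E' Y\<close> dictates this formula. For \<open>s \<le> 1/2\<close>
    its norm is at most \<open>(1 + 2 + 1/2 + 1/16) / 4 < 1\<close>.\<close>
  define E' where "E' = (1/4) \<cdot>\<^sub>m (1\<^sub>m n + 2 \<cdot>\<^sub>m E + s \<cdot>\<^sub>m (Y * E + E * Y) + s\<^sup>2 \<cdot>\<^sub>m (E * (Y * Y) * E))"
  have "op_le n E' (\<bar>1/4\<bar> * (1 + \<bar>2\<bar> * 1 + \<bar>s\<bar> * (1/2 * 1 + 1 * (1/2)) + \<bar>s\<^sup>2\<bar> * (1 * (1/2 * (1/2)) * 1)))"
    unfolding E'_def by (intro op_le_smult op_le_add op_le_mult op_le_one Y E)
  then have E'n: "op_le n E' 1"
  proof (rule op_le_mono)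
    have "s\<^sup>2 \<le> 1/4" using power_mono[OF s(2,1), of 2] by (simp add: power2_eq_square)
    then show "\<bar>1/4\<bar> * (1 + \<bar>2\<bar> * 1 + \<bar>s\<bar> * (1/2 * 1 + 1 * (1/2)) + \<bar>s\<^sup>2\<bar> * (1 * (1/2 * (1/2)) * 1)) \<le> 1"
      using s by simp
  qed
  have E'c: "E' \<in> carrier_mat n n" using E'n by (simp add: op_le_def)
  let ?W = "Y * E * Y"
  let ?K = "1\<^sub>m n + s \<cdot>\<^sub>m Y + s\<^sup>2 \<cdot>\<^sub>m ?W"
  have Wc: "?W \<in> carrier_mat n n" using Yc Ec by simp
  have Kc: "?K \<in> carrier_mat n n" using Yc Wc by simp
  have K2: "?K * ?K = 1\<^sub>m n + (2 * s) \<cdot>\<^sub>m Y + (2 * s)\<^sup>2 \<cdot>\<^sub>m (Y * E' * Y)"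
  proof -
    define A1 where "A1 = Y * Y"
    define A2 where "A2 = Y * ?W"
    define A3 where "A3 = ?W * Y"
    define A4 where "A4 = ?W * ?W"
    have Ac: "A1 \<in> carrier_mat n n" "A2 \<in> carrier_mat n n" "A3 \<in> carrier_mat n n" "A4 \<in> carrier_mat n n"
      using Yc Wc by (simp_all add: A1_def A2_def A3_def A4_def)
    have p1: "?K * ?K = ?K * 1\<^sub>m n + ?K * (s \<cdot>\<^sub>m Y) + ?K * (s\<^sup>2 \<cdot>\<^sub>m ?W)"
      using Kc Yc Wc by (simp add: mult_add_distrib_mat[of _ n n _ n])
    have p2: "?K * (s \<cdot>\<^sub>m Y) = s \<cdot>\<^sub>m (Y + s \<cdot>\<^sub>m A1 + s\<^sup>2 \<cdot>\<^sub>m A3)"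
      using Kc Yc Wc by (simp add: mult_smult_distrib[of _ n n _ n] add_mult_distrib_mat[of _ n n _ _ n]
          mult_smult_assoc_mat[of _ n n _ n] A1_def A3_def)
    have p3: "?K * (s\<^sup>2 \<cdot>\<^sub>m ?W) = s\<^sup>2 \<cdot>\<^sub>m (?W + s \<cdot>\<^sub>m A2 + s\<^sup>2 \<cdot>\<^sub>m A4)"
      using Kc Yc Wc by (simp add: mult_smult_distrib[of _ n n _ n] add_mult_distrib_mat[of _ n n _ _ n]
          mult_smult_assoc_mat[of _ n n _ n] A2_def A4_def)
    have l: "?K * ?K = ?K + s \<cdot>\<^sub>m (Y + s \<cdot>\<^sub>m A1 + s\<^sup>2 \<cdot>\<^sub>m A3) + s\<^sup>2 \<cdot>\<^sub>m (?W + s \<cdot>\<^sub>m A2 + s\<^sup>2 \<cdot>\<^sub>m A4)"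
      unfolding p1 p2 p3 right_mult_one_mat[OF Kc] ..
    have w2: "Y * (Y * E) * Y = A2" "Y * (E * Y) * Y = A3" "Y * (E * (Y * Y) * E) * Y = A4"
      using Yc Ec by (simp_all add: A2_def A3_def A4_def sq_assoc[of _ n])
    have "Y * E' * Y = (1/4) \<cdot>\<^sub>m (A1 + 2 \<cdot>\<^sub>m ?W + s \<cdot>\<^sub>m (A2 + A3) + s\<^sup>2 \<cdot>\<^sub>m A4)"
      unfolding E'_def w2[symmetric] A1_def using Yc Ec
      by (simp add: mult_smult_distrib[of _ n n _ n] add_mult_distrib_mat[of _ n n _ _ n]
          assoc_add_mat[of _ n n] mult_smult_assoc_mat[of _ n n _ n] mult_add_distrib_mat[of _ n n _ n])
    then show ?thesis unfolding l using Ac Yc Wc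
      by (intro eq_matI) (auto simp: power2_eq_square algebra_simps)
  qed
  have Hc: "1\<^sub>m n + t \<cdot>\<^sub>m Y \<in> carrier_mat n n" using Yc by simp
  have "(1\<^sub>m n + t \<cdot>\<^sub>m Y) ^\<^sub>m (2 ^ Suc i) = ?K * ?K"
    using sq_pow_add[OF Hc, of "2 ^ i" "2 ^ i"] eq by (simp add: mult_2)
  then show ?case using K2 E'n by (auto simp: s_def mult_ac)
qed

text \<open>The analogue of \<open>exp Y \<le> 1 + Y + Y^2\<close> for quadratic forms, uniform in
  \<open>k\<close>: the remainder is the form of a contraction at the vector
  \<open>Y x\<close>.\<close>

lemma quadratic_form_euler_exp_le:
  assumes Y: "op_le n Y (1/2)" "Y\<^sup>T = Y" and x: "x \<in> carrier_vec n"
  shows "x \<bullet> ((euler n k Y) ^\<^sub>m (2 ^ k) *\<^sub>v x) \<le> x \<bullet> x + x \<bullet> (Y *\<^sub>v x) + nsq (Y *\<^sub>v x)"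
proof -
  have Yc: "Y \<in> carrier_mat n n" using Y by (simp add: op_le_def)
  obtain E where E: "op_le n E 1" and eq: "(euler n k Y) ^\<^sub>m (2 ^ k) = 1\<^sub>m n + 1 \<cdot>\<^sub>m Y + 1 \<cdot>\<^sub>m (Y * E * Y)"
    using dyadic_pow_expansion[OF Y(1), of "1 / 2 ^ k" k] by auto
  have Ec: "E \<in> carrier_mat n n" using E by (simp add: op_le_def)
  define y where "y = Y *\<^sub>v x"
  have y: "y \<in> carrier_vec n" "E *\<^sub>v y \<in> carrier_vec n" "Y *\<^sub>v (E *\<^sub>v y) \<in> carrier_vec n"
    using Yc Ec x by (auto simp: y_def)
  have "(1\<^sub>m n + 1 \<cdot>\<^sub>m Y + 1 \<cdot>\<^sub>m (Y * E * Y)) = 1\<^sub>m n + Y + Y * E * Y"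
    using Yc Ec by (intro eq_matI) auto
  then have "(euler n k Y) ^\<^sub>m (2 ^ k) *\<^sub>v x = x + y + Y *\<^sub>v (E *\<^sub>v y)"
    unfolding eq using Yc Ec x by (simp add: y_def add_mult_distrib_mat_vec[of _ n n] assoc_mult_mat_vec[of _ n n _ n])
  then have "x \<bullet> ((euler n k Y) ^\<^sub>m (2 ^ k) *\<^sub>v x) = x \<bullet> x + x \<bullet> y + x \<bullet> (Y *\<^sub>v (E *\<^sub>v y))"
    using x y by (simp add: scalar_prod_add_distrib[of _ n])
  also have "x \<bullet> (Y *\<^sub>v (E *\<^sub>v y)) = y \<bullet> (E *\<^sub>v y)"
    using scalar_prod_mult_mat_sym[OF Yc Y(2) x y(2)] by (simp add: y_def)
  also have "\<dots> \<le> vnorm y * vnorm (E *\<^sub>v y)" using scalar_prod_Cauchy_Schwarz[OF y(1,2)] by simp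
  also have "\<dots> \<le> vnorm y * vnorm y" using op_leD(3)[OF E y(1)] by (intro mult_left_mono) auto
  also have "\<dots> = y \<bullet> y" by (simp add: vnorm_sq[symmetric] power2_eq_square)
  finally show ?thesis by (simp add: y_def)
qed

text \<open>One step of the exponential-moment recursion. Splitting the power of the Euler factor of
  \<open>X\<close> evaluates all summands at the same vectors \<open>u i\<close>, independent of
  \<open>w\<close>, so only the average of \<open>Y w + (Y w)^2\<close> counts; the squared lengths
  of the \<open>u i\<close> add up to the exponential trace of \<open>X\<close>.\<close>

lemma exp_trace_sum_step:
  fixes c :: real
  assumes fin: "finite S" and X: "X \<in> carrier_mat n n" "X\<^sup>T = X"
    and Y: "\<And>w. w \<in> S \<Longrightarrow> op_le n (Y w) (1/2)" "\<And>w. w \<in> S \<Longrightarrow> (Y w)\<^sup>T = Y w"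
    and avg: "\<And>x. x \<in> carrier_vec n \<Longrightarrow>
      (\<Sum>w\<in>S. x \<bullet> (Y w *\<^sub>v x) + nsq (Y w *\<^sub>v x)) \<le> real (card S) * c * (x \<bullet> x)"
  obtains e where "e \<longlonglongrightarrow> 0" and
    "\<And>k. 1 \<le> k \<Longrightarrow> (\<Sum>w\<in>S. exp_trace n k (X + Y w)) \<le> real (card S) * (1 + c) * exp_trace n k X + e k"
proof -
  have Yc: "\<And>w. w \<in> S \<Longrightarrow> Y w \<in> carrier_mat n n" using Y by (simp add: op_le_def)
  have "\<exists>e. e \<longlonglongrightarrow> 0 \<and> (\<forall>k\<ge>1. exp_trace n k (X + Y w) \<le>
    mtrace ((euler n k X) ^\<^sub>m (2 ^ k) * (euler n k (Y w)) ^\<^sub>m (2 ^ k)) + e k)" if "w \<in> S" for w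
    using Golden_Thompson_limit[OF X Yc[OF that] Y(2)[OF that]] by metis
  then obtain e where e: "\<And>w. w \<in> S \<Longrightarrow> e w \<longlonglongrightarrow> 0"
    and GT: "\<And>w k. w \<in> S \<Longrightarrow> 1 \<le> k \<Longrightarrow> exp_trace n k (X + Y w) \<le>
    mtrace ((euler n k X) ^\<^sub>m (2 ^ k) * (euler n k (Y w)) ^\<^sub>m (2 ^ k)) + e w k"
    by metis
  show ?thesis
  proof
    show "(\<lambda>k. \<Sum>w\<in>S. e w k) \<longlonglongrightarrow> 0" using e by (intro tendsto_null_sum)
    fix k :: nat assume k1: "1 \<le> k"
    then obtain j where k: "(2::nat) ^ k = 2 * 2 ^ j" by (cases k) auto
    let ?H = "euler n k X" and ?K = "\<lambda>w. (euler n k (Y w)) ^\<^sub>m (2 ^ k)"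
    have H: "?H \<in> carrier_mat n n" "?H\<^sup>T = ?H" using X sym_lin by auto
    have Kc: "?K w \<in> carrier_mat n n" if "w \<in> S" for w using Yc[OF that] by simp
    define u where "u i = ?H ^\<^sub>m (2 ^ j) *\<^sub>v unit_vec n i" for i
    have u: "u i \<in> carrier_vec n" for i
      unfolding u_def by (intro mult_mat_vec_carrier[of _ n n] pow_carrier_mat H) simp
    have tH: "exp_trace n k X = (\<Sum>i<n. u i \<bullet> u i)"
    proof -
      have "?H ^\<^sub>m (2 ^ k) = ?H ^\<^sub>m (2 * 2 ^ j) * 1\<^sub>m n" unfolding k using X by simp
      then show ?thesis using mtrace_sym_pow_mult[OF H, of "1\<^sub>m n" "2 ^ j"] u
        by (simp add: exp_trace_def u_def)
    qed
    have "(\<Sum>w\<in>S. exp_trace n k (X + Y w)) \<le> (\<Sum>w\<in>S. mtrace (?H ^\<^sub>m (2 ^ k) * ?K w) + e w k)"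
      using GT k1 by (intro sum_mono)
    also have "\<dots> = (\<Sum>w\<in>S. \<Sum>i<n. u i \<bullet> (?K w *\<^sub>v u i)) + (\<Sum>w\<in>S. e w k)"
      using mtrace_sym_pow_mult[OF H Kc, of _ "2 ^ j"] by (simp add: sum.distrib k u_def)
    also have "(\<Sum>w\<in>S. \<Sum>i<n. u i \<bullet> (?K w *\<^sub>v u i)) = (\<Sum>i<n. \<Sum>w\<in>S. u i \<bullet> (?K w *\<^sub>v u i))"
      by (rule sum.swap)
    also have "\<dots> \<le> (\<Sum>i<n. real (card S) * (1 + c) * (u i \<bullet> u i))"
    proof (rule sum_mono)
      fix i
      have "(\<Sum>w\<in>S. u i \<bullet> (?K w *\<^sub>v u i)) \<le>
        (\<Sum>w\<in>S. u i \<bullet> u i + (u i \<bullet> (Y w *\<^sub>v u i) + nsq (Y w *\<^sub>v u i)))"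
        using quadratic_form_euler_exp_le[OF Y u] by (intro sum_mono) (auto simp: add.assoc)
      also have "\<dots> \<le> real (card S) * (u i \<bullet> u i) + real (card S) * c * (u i \<bullet> u i)"
        using avg[OF u, of i] by (simp add: sum.distrib)
      finally show "(\<Sum>w\<in>S. u i \<bullet> (?K w *\<^sub>v u i)) \<le> real (card S) * (1 + c) * (u i \<bullet> u i)"
        by (simp add: algebra_simps)
    qed
    also have "(\<Sum>i<n. real (card S) * (1 + c) * (u i \<bullet> u i)) = real (card S) * (1 + c) * exp_trace n k X"
      by (simp add: tH sum_distrib_left)
    finally show "(\<Sum>w\<in>S. exp_trace n k (X + Y w)) \<le> real (card S) * (1 + c) * exp_trace n k X + (\<Sum>w\<in>S. e w k)"
      by simp
  qed
qed

text \<open>Repeated squaring: by Cauchy--Schwarz the square of the form of \<open>H\<close> at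
  \<open>x\<close> is at most \<open>x \<bullet> x\<close> times the form of \<open>H^2\<close>, so
  a lower bound \<open>h\<close> for \<open>H\<close> becomes \<open>h^2\<close> for
  \<open>H^2\<close>. This takes the place of Jensen's inequality over a spectral measure.\<close>

lemma quadratic_form_pow2_ge:
  fixes H :: "real mat"
  assumes "H \<in> carrier_mat n n" "H\<^sup>T = H" "x \<in> carrier_vec n" "0 \<le> h" "h * (x \<bullet> x) \<le> x \<bullet> (H *\<^sub>v x)"
  shows "h ^ (2 ^ k) * (x \<bullet> x) \<le> x \<bullet> (H ^\<^sub>m (2 ^ k) *\<^sub>v x)"
  using assms
proof (induction k arbitrary: H h)
  case 0
  then show ?case by simp
next
  case (Suc k)
  note H = Suc.prems(1,2) and x = Suc.prems(3)
  have HH: "H * H \<in> carrier_mat n n" "(H * H)\<^sup>T = H * H" using H transpose_mult[OF H(1) H(1)] by auto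
  have Hx: "H *\<^sub>v x \<in> carrier_vec n" using H x by simp
  have e: "x \<bullet> (H * H *\<^sub>v x) = nsq (H *\<^sub>v x)"
    using H x scalar_prod_mult_mat_sym[OF H x Hx] by (simp add: assoc_mult_mat_vec[of _ n n _ n])
  have "h\<^sup>2 * (x \<bullet> x) \<le> x \<bullet> (H * H *\<^sub>v x)"
  proof (cases "x \<bullet> x = 0")
    case True
    then show ?thesis using e by simp
  next
    case False
    then have p: "0 < x \<bullet> x" using scalar_prod_self_nonneg[of x] by linarith
    have "(h * (x \<bullet> x))\<^sup>2 \<le> (x \<bullet> (H *\<^sub>v x))\<^sup>2" using Suc.prems p by (intro power_mono) auto
    also have "\<dots> \<le> (vnorm x * vnorm (H *\<^sub>v x))\<^sup>2"
      using scalar_prod_Cauchy_Schwarz[OF x Hx] by (intro power2_le_iff_abs_le[THEN iffD2]) auto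
    also have "\<dots> = (x \<bullet> x) * (x \<bullet> (H * H *\<^sub>v x))" by (simp add: power_mult_distrib vnorm_sq e)
    finally have "(x \<bullet> x) * (h\<^sup>2 * (x \<bullet> x)) \<le> (x \<bullet> x) * (x \<bullet> (H * H *\<^sub>v x))"
      by (simp add: power2_eq_square algebra_simps)
    then show ?thesis using p by simp
  qed
  from Suc.IH[OF HH x _ this] show ?case
    using H sq_pow_mult[OF H(1), of 2 "2 ^ k"] by (simp add: sq_pow_2[of _ n] power_mult[symmetric])
qed

lemma exp_trace_nonneg:
  assumes X: "X \<in> carrier_mat n n" "X\<^sup>T = X" and "1 \<le> k"
  shows "0 \<le> exp_trace n k X"
proof -
  obtain j where k: "(2::nat) ^ k = 2 * 2 ^ j" using assms by (cases k) auto
  have H: "1\<^sub>m n + (1 / 2 ^ k) \<cdot>\<^sub>m X \<in> carrier_mat n n" using X by auto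
  show ?thesis unfolding exp_trace_def k mtrace_pow_even_sym[OF H sym_lin[OF X]] by (rule frob_sq_nonneg)
qed

text \<open>The Chernoff half of the argument: one direction with a large form makes the whole
  exponential trace large, because the trace of an even power is a squared Frobenius norm and
  dominates the form in every direction. As \<open>k\<close> grows the bound tends to
  \<open>exp s\<close>.\<close>

lemma exp_trace_ge:
  assumes X: "X \<in> carrier_mat n n" "X\<^sup>T = X" and x: "x \<in> carrier_vec n" "x \<bullet> x \<noteq> 0"
    and s: "0 \<le> s" "s * (x \<bullet> x) \<le> x \<bullet> (X *\<^sub>v x)" and "1 \<le> k"
  shows "(1 + s / 2 ^ k) ^ (2 ^ k) \<le> exp_trace n k X"
proof -
  obtain j where k: "(2::nat) ^ k = 2 * 2 ^ j" using assms by (cases k) auto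
  let ?H = "euler n k X"
  have H: "?H \<in> carrier_mat n n" "?H\<^sup>T = ?H" using X sym_lin by auto
  have p: "0 < x \<bullet> x" using scalar_prod_self_nonneg[of x] x(2) by linarith
  have "?H *\<^sub>v x = x + (1 / 2 ^ k) \<cdot>\<^sub>v (X *\<^sub>v x)"
    using X x by (intro eq_vecI) (auto simp: add_mult_distrib_mat_vec[of _ n n])
  moreover have "X *\<^sub>v x \<in> carrier_vec n" using X x by simp
  ultimately have "x \<bullet> (?H *\<^sub>v x) = x \<bullet> x + (1 / 2 ^ k) * (x \<bullet> (X *\<^sub>v x))"
    using X x by (simp add: scalar_prod_add_distrib[of _ n] del: assoc_mult_mat_vec)
  moreover have "s * (x \<bullet> x) / 2 ^ k \<le> (x \<bullet> (X *\<^sub>v x)) / 2 ^ k" using s by (intro divide_right_mono) auto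
  ultimately have "(1 + s / 2 ^ k) * (x \<bullet> x) \<le> x \<bullet> (?H *\<^sub>v x)" by (simp add: algebra_simps)
  from quadratic_form_pow2_ge[OF H x(1) _ this, of k]
  have "(1 + s / 2 ^ k) ^ (2 ^ k) * (x \<bullet> x) \<le> x \<bullet> (?H ^\<^sub>m (2 ^ k) *\<^sub>v x)" using s by simp
  also have "\<dots> = nsq (?H ^\<^sub>m (2 ^ j) *\<^sub>v x)"
  proof -
    have Hj: "?H ^\<^sub>m (2 ^ j) \<in> carrier_mat n n" "(?H ^\<^sub>m (2 ^ j))\<^sup>T = ?H ^\<^sub>m (2 ^ j)"
      using H sym_pow[OF H] by auto
    have "?H ^\<^sub>m (2 * 2 ^ j) *\<^sub>v x = ?H ^\<^sub>m (2 ^ j) *\<^sub>v (?H ^\<^sub>m (2 ^ j) *\<^sub>v x)"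
      using H x Hj by (simp add: mult_2 sq_pow_add assoc_mult_mat_vec[of _ n n _ n])
    then show ?thesis unfolding k
      using scalar_prod_mult_mat_sym[OF Hj x(1), of "?H ^\<^sub>m (2 ^ j) *\<^sub>v x"] Hj x by simp
  qed
  also have "\<dots> \<le> frob_sq (?H ^\<^sub>m (2 ^ j)) * (x \<bullet> x)"
    by (rule mult_mat_vec_norm_le_frob[of _ n n]) (use H x in auto)
  also have "frob_sq (?H ^\<^sub>m (2 ^ j)) = exp_trace n k X"
    unfolding exp_trace_def k mtrace_pow_even_sym[OF H] ..
  finally show ?thesis using p by simp
qed

section \<open>Sampling without replacement\<close>

text \<open>Double counting of the pairs of a set of size \<open>j + 1\<close> and one of its
  elements. It replaces ordered sampling: a uniform set of size \<open>j + 1\<close> is a uniform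
  set of size \<open>j\<close> with a uniform element from outside adjoined.\<close>

lemma sum_subsets_Suc:
  fixes f :: "'w set \<Rightarrow> real"
  assumes S: "finite S"
  shows "real (Suc j) * (\<Sum>W | W \<subseteq> S \<and> card W = Suc j. f W) =
    (\<Sum>W | W \<subseteq> S \<and> card W = j. \<Sum>w\<in>S - W. f (insert w W))"
proof -
  let ?P = "\<lambda>j. {W. W \<subseteq> S \<and> card W = j}"
  have fin: "finite (?P j)" for j using S by simp
  have "real (Suc j) * (\<Sum>W\<in>?P (Suc j). f W) = (\<Sum>W\<in>?P (Suc j). \<Sum>w\<in>W. f W)"
    by (simp add: sum_distrib_left)
  also have "\<dots> = (\<Sum>(W, w)\<in>Sigma (?P (Suc j)) (\<lambda>W. W). f W)"
    using fin S by (intro sum.Sigma) (auto intro: finite_subset)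
  also have "\<dots> = (\<Sum>(W, w)\<in>Sigma (?P j) (\<lambda>W. S - W). f (insert w W))"
    by (rule sum.reindex_bij_witness[where i = "\<lambda>(W, w). (insert w W, w)" and j = "\<lambda>(W, w). (W - {w}, w)"])
      (use S in \<open>auto simp: insert_absorb finite_subset card_insert_if\<close>)
  also have "\<dots> = (\<Sum>W\<in>?P j. \<Sum>w\<in>S - W. f (insert w W))"
    using fin S by (intro sum.Sigma[symmetric]) auto
  finally show ?thesis .
qed

text \<open>Up to a factor the summands are the variances of successive martingale steps. With
  \<open>y = N - i - 1\<close>, \<open>1 / (y^2 * (y + 1))\<close> is at most
  \<open>1 / y^2 - 1 / (y + 1)^2\<close>, which telescopes.\<close>

lemma sum_inverse_cubes_le:
  fixes N :: real and m :: nat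
  assumes "real m < N"
  shows "(\<Sum>i<m. 1 / ((N - real i - 1)\<^sup>2 * (N - real i))) \<le> 2 * real m / (N * (N - real m)\<^sup>2)"
proof -
  have "(\<Sum>i<m. 1 / ((N - real i - 1)\<^sup>2 * (N - real i))) \<le> 1 / (N - real m)\<^sup>2 - 1 / N\<^sup>2"
    using assms
  proof (induction m)
    case (Suc m)
    define y where "y = N - m - 1"
    have y: "0 < y" using Suc.prems by (simp add: y_def)
    have "1 / (y\<^sup>2 * (y + 1)) = (y + 1) / (y\<^sup>2 * (y + 1)\<^sup>2)"
      using y by (simp add: power2_eq_square)
    also have "\<dots> \<le> (2 * y + 1) / (y\<^sup>2 * (y + 1)\<^sup>2)" using y by (intro divide_right_mono) auto
    also have "\<dots> = ((y + 1)\<^sup>2 - y\<^sup>2) / (y\<^sup>2 * (y + 1)\<^sup>2)" by (simp add: power2_eq_square algebra_simps)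
    also have "\<dots> = 1 / y\<^sup>2 - 1 / (y + 1)\<^sup>2" using y by (simp add: diff_divide_distrib)
    finally have "1 / ((N - m - 1)\<^sup>2 * (N - m)) \<le> 1 / (N - Suc m)\<^sup>2 - 1 / (N - m)\<^sup>2"
      by (simp add: y_def algebra_simps)
    moreover have "(\<Sum>i<m. 1 / ((N - real i - 1)\<^sup>2 * (N - real i))) \<le> 1 / (N - m)\<^sup>2 - 1 / N\<^sup>2" using Suc by simp
    ultimately show ?case by simp
  qed simp
  also have "\<dots> = (N\<^sup>2 - (N - m)\<^sup>2) / (N\<^sup>2 * (N - m)\<^sup>2)" using assms by (simp add: diff_divide_distrib)
  also have "\<dots> \<le> (2 * real m * N) / (N\<^sup>2 * (N - m)\<^sup>2)"
  proof (rule divide_right_mono)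
    show "N\<^sup>2 - (N - m)\<^sup>2 \<le> 2 * real m * N" by (simp add: power2_eq_square algebra_simps)
  qed simp
  also have "\<dots> = 2 * real m / (N * (N - m)\<^sup>2)" using assms by (simp add: power2_eq_square)
  finally show ?thesis .
qed

definition frame_op :: "nat \<Rightarrow> ('w \<Rightarrow> real vec) \<Rightarrow> 'w set \<Rightarrow> real mat" where
  "frame_op n v W = Matrix.mat n n (\<lambda>(i,j). \<Sum>w\<in>W. v w $ i * v w $ j)"

lemma frame_op_carrier [simp]: "frame_op n v W \<in> carrier_mat n n"
  by (simp add: frame_op_def)

lemma frame_op_sym: "(frame_op n v W)\<^sup>T = frame_op n v W"
  by (rule eq_matI) (auto simp: frame_op_def mult.commute)

lemma frame_op_empty: "frame_op n v {} = 0\<^sub>m n n"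
  by (rule eq_matI) (auto simp: frame_op_def)

lemma frame_op_insert: "finite W \<Longrightarrow> w \<notin> W \<Longrightarrow> frame_op n v (insert w W) = frame_op n v {w} + frame_op n v W"
  by (rule eq_matI) (auto simp: frame_op_def)

lemma frame_op_bilinear:
  assumes "finite W" "\<And>w. w \<in> W \<Longrightarrow> v w \<in> carrier_vec n" "x \<in> carrier_vec n" "y \<in> carrier_vec n"
  shows "x \<bullet> (frame_op n v W *\<^sub>v y) = (\<Sum>w\<in>W. (v w \<bullet> x) * (v w \<bullet> y))"
proof -
  have "x \<bullet> (frame_op n v W *\<^sub>v y) = (\<Sum>i<n. x $ i * (\<Sum>j<n. (\<Sum>w\<in>W. v w $ i * v w $ j) * y $ j))"
    using assms by (auto simp: scalar_prod_def frame_op_def lessThan_atLeast0)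
  also have "\<dots> = (\<Sum>i<n. \<Sum>j<n. \<Sum>w\<in>W. (v w $ i * x $ i) * (v w $ j * y $ j))"
    by (simp add: sum_distrib_left sum_distrib_right mult_ac)
  also have "\<dots> = (\<Sum>i<n. \<Sum>w\<in>W. \<Sum>j<n. (v w $ i * x $ i) * (v w $ j * y $ j))"
    by (intro sum.cong sum.swap refl)
  also have "\<dots> = (\<Sum>w\<in>W. \<Sum>i<n. \<Sum>j<n. (v w $ i * x $ i) * (v w $ j * y $ j))" by (rule sum.swap)
  also have "\<dots> = (\<Sum>w\<in>W. (v w \<bullet> x) * (v w \<bullet> y))"
    using assms by (intro sum.cong) (auto simp: scalar_prod_def lessThan_atLeast0 sum_product)
  finally show ?thesis .
qed

lemma frame_op_singleton_mult:
  assumes "v w \<in> carrier_vec n" "x \<in> carrier_vec n"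
  shows "frame_op n v {w} *\<^sub>v x = (v w \<bullet> x) \<cdot>\<^sub>v v w"
  using assms by (intro eq_vecI) (auto simp: frame_op_def scalar_prod_def sum_distrib_left mult_ac)

lemma op_le_frame_op:
  fixes L :: real
  assumes "finite W" "\<And>w. w \<in> W \<Longrightarrow> v w \<in> carrier_vec n" "\<And>w. w \<in> W \<Longrightarrow> v w \<bullet> v w \<le> L"
  shows "op_le n (frame_op n v W) (real (card W) * L)"
  using assms
proof (induction W rule: finite_induct)
  case empty
  then show ?case by (simp add: frame_op_empty op_le_zero)
next
  case (insert w W)
  have w: "v w \<in> carrier_vec n" "v w \<bullet> v w \<le> L" using insert by auto
  have "op_le n (frame_op n v {w}) L"
    unfolding op_le_def
  proof (intro conjI ballI)
    show "0 \<le> L" using w scalar_prod_self_nonneg[of "v w"] by linarith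
    fix x :: "real vec" assume x: "x \<in> carrier_vec n"
    have "vnorm (frame_op n v {w} *\<^sub>v x) = \<bar>v w \<bullet> x\<bar> * vnorm (v w)"
      using w x by (simp add: frame_op_singleton_mult vnorm_smult[of _ n])
    also have "\<dots> \<le> (vnorm (v w) * vnorm x) * vnorm (v w)"
      using scalar_prod_Cauchy_Schwarz[OF w(1) x] by (intro mult_right_mono) auto
    also have "\<dots> = (v w \<bullet> v w) * vnorm x" by (simp add: vnorm_sq[symmetric] power2_eq_square)
    also have "\<dots> \<le> L * vnorm x" using w by (intro mult_right_mono) auto
    finally show "vnorm (frame_op n v {w} *\<^sub>v x) \<le> L * vnorm x" .
  qed simp
  then have "op_le n (frame_op n v (insert w W)) (L + card W * L)"
    using insert by (subst frame_op_insert) (auto intro: op_le_add)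
  then show ?case using insert by (simp add: algebra_simps)
qed

locale isotropic_frame =
  fixes n :: nat and S :: "'w set" and v :: "'w \<Rightarrow> real vec" and L :: real
  assumes finite_S: "finite S"
    and v_carrier: "\<And>w. w \<in> S \<Longrightarrow> v w \<in> carrier_vec n"
    and v_bound: "\<And>w. w \<in> S \<Longrightarrow> v w \<bullet> v w \<le> L"
    and L_pos: "0 < L"
    and isotropic: "frame_op n v S = 1\<^sub>m n"
begin

text \<open>At \<open>W = S\<close> the prefactor is \<open>1 / 0 = 0\<close>, so the martingale
  steps below always leave an element undrawn, and the full sample is treated separately.\<close>

definition centered :: "'w set \<Rightarrow> real mat" where
  "centered W = (1 / (real (card S) - card W)) \<cdot>\<^sub>m (frame_op n v W - (card W / card S) \<cdot>\<^sub>m 1\<^sub>m n)"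

lemma centered_carrier [simp]: "centered W \<in> carrier_mat n n"
  by (simp add: centered_def minus_carrier_mat)


lemma centered_sym: "(centered W)\<^sup>T = centered W"
  by (rule eq_matI) (auto simp: centered_def frame_op_def mult.commute)

lemma frame_op_compl:
  assumes "W \<subseteq> S"
  shows "frame_op n v (S - W) = 1\<^sub>m n - frame_op n v W"
proof (rule eq_matI)
  fix i j assume "i < dim_row (1\<^sub>m n - frame_op n v W)" "j < dim_col (1\<^sub>m n - frame_op n v W)"
  then have ij: "i < n" "j < n" by (auto simp: frame_op_def)
  have "frame_op n v S $$ (i,j) = 1\<^sub>m n $$ (i,j)" by (simp only: isotropic)
  then have "(\<Sum>w\<in>S. v w $ i * v w $ j) = 1\<^sub>m n $$ (i,j)" using ij by (simp add: frame_op_def)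
  then show "frame_op n v (S - W) $$ (i,j) = (1\<^sub>m n - frame_op n v W) $$ (i,j)"
    using ij sum_diff[OF finite_S assms, of "\<lambda>w. v w $ i * v w $ j"] by (simp add: frame_op_def)
qed (auto simp: frame_op_def)

text \<open>The rank-one term of the next draw minus its mean over the elements not yet drawn; hence
  its sum over \<open>S - W\<close> is 0.\<close>

definition increment :: "'w set \<Rightarrow> 'w \<Rightarrow> real mat" where
  "increment W w = frame_op n v {w} - (1 / (real (card S) - card W)) \<cdot>\<^sub>m frame_op n v (S - W)"

lemma increment_carrier [simp]: "increment W w \<in> carrier_mat n n"
  by (simp add: increment_def minus_carrier_mat)

lemma increment_sym: "(increment W w)\<^sup>T = increment W w"
  by (rule eq_matI) (auto simp: increment_def frame_op_def mult.commute)

text \<open>The process \<open>centered W\<close> is a martingale under sampling without replacement.\<close>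
lemma centered_insert:
  assumes W: "W \<subseteq> S" "w \<in> S - W" and N: "card W + 1 < card S"
  shows "centered (insert w W) = centered W + (1 / (real (card S) - card W - 1)) \<cdot>\<^sub>m increment W w"
proof -
  have finW: "finite W" using W finite_S finite_subset by blast
  have cI: "card (insert w W) = card W + 1" using W finW by simp
  define k N where "k = real (card W)" and "N = real (card S)"
  have kN: "0 \<le> k" "k + 1 < N" using N by (auto simp: k_def N_def)
  have nz: "N \<noteq> 0" "N - k \<noteq> 0" "N - k - 1 \<noteq> 0" "N - (k + 1) \<noteq> 0" using kN by auto
  show ?thesis
  proof (rule eq_matI)
    fix i j assume "i < dim_row (centered W + (1 / (real (card S) - card W - 1)) \<cdot>\<^sub>m increment W w)"
      "j < dim_col (centered W + (1 / (real (card S) - card W - 1)) \<cdot>\<^sub>m increment W w)"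
    then have ij: "i < n" "j < n" using increment_carrier[of W w] by (auto simp del: increment_carrier)
    define T where "T = frame_op n v W $$ (i,j)"
    define R where "R = frame_op n v {w} $$ (i,j)"
    define I :: real where "I = 1\<^sub>m n $$ (i,j)"
    have d: "dim_row (frame_op n v X) = n" "dim_col (frame_op n v X) = n" for X by (auto simp: frame_op_def)
    have l: "centered (insert w W) $$ (i,j) = (R + T - (k + 1) / N * I) / (N - (k + 1))"
      using ij W finW cI frame_op_insert[OF finW, of w n v]
      by (simp add: centered_def d T_def R_def I_def k_def N_def add.commute)
    have r: "(centered W + (1 / (real (card S) - card W - 1)) \<cdot>\<^sub>m increment W w) $$ (i,j) =
      (T - k / N * I) / (N - k) + (R - (I - T) / (N - k)) / (N - k - 1)"
      using ij W by (simp add: centered_def increment_def frame_op_compl d T_def R_def I_def k_def N_def)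
    have "(R + T - (k + 1) / N * I) / (N - (k + 1)) = (T - k / N * I) / (N - k) + (R - (I - T) / (N - k)) / (N - k - 1)"
    proof -
      define y where "y = N - k - 1"
      have y: "0 < y" "0 < N" and Ny: "N - (k + 1) = y" "N - k = y + 1"
        using kN by (auto simp: y_def)
      \<comment> \<open>Partial fractions in \<open>y\<close> and \<open>y + 1\<close>: the identity
        is compared coefficient by coefficient in \<open>R\<close>, \<open>T\<close> and
        \<open>I\<close>.\<close>
      have h1: "1 / y = 1 / (y + 1) + 1 / ((y + 1) * y)"
        using y diff_frac_eq[of y "y + 1" 1 1] by (simp add: mult.commute)
      have h2: "(k + 1) / N / y = k / N / (y + 1) + 1 / ((y + 1) * y)"
      proof -
        have "(N - y) / N / y = 1 / y - 1 / N" using y by (simp add: diff_divide_distrib)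
        moreover have "(N - (y + 1)) / N / (y + 1) = 1 / (y + 1) - 1 / N" using y by (simp add: diff_divide_distrib)
        moreover have "k + 1 = N - y" "k = N - (y + 1)" by (simp_all add: y_def)
        ultimately show ?thesis using h1 by simp
      qed
      have "(R + T - (k + 1) / N * I) / y = R * (1 / y) + T * (1 / y) - I * ((k + 1) / N / y)"
        by (simp add: add_divide_distrib[of "R + T"] add_divide_distrib[of R] diff_divide_distrib)
      also have "\<dots> = R / y + T * (1 / (y + 1) + 1 / ((y + 1) * y)) - I * (k / N / (y + 1) + 1 / ((y + 1) * y))"
        by (simp only: h1[symmetric] h2) simp
      also have "\<dots> = (T - k / N * I) / (y + 1) + (R - (I - T) / (y + 1)) / y"
        by (simp add: add_divide_distrib diff_divide_distrib distrib_left)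
      finally show ?thesis unfolding Ny by (simp add: y_def)
    qed
    then show "centered (insert w W) $$ (i,j) = (centered W + (1 / (real (card S) - card W - 1)) \<cdot>\<^sub>m increment W w) $$ (i,j)"
      using l r by simp
  qed (auto simp: centered_def increment_def frame_op_def)
qed

lemma quadratic_form_frame_le:
  assumes "W \<subseteq> S" "x \<in> carrier_vec n"
  shows "x \<bullet> (frame_op n v W *\<^sub>v x) \<le> x \<bullet> x"
proof -
  have "x \<bullet> (frame_op n v W *\<^sub>v x) = (\<Sum>w\<in>W. (v w \<bullet> x)\<^sup>2)"
    using assms finite_S v_carrier finite_subset
    by (subst frame_op_bilinear) (auto simp: power2_eq_square)
  also have "\<dots> \<le> (\<Sum>w\<in>S. (v w \<bullet> x)\<^sup>2)" using assms finite_S by (intro sum_mono2) auto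
  also have "\<dots> = x \<bullet> (frame_op n v S *\<^sub>v x)"
    using assms finite_S v_carrier by (subst frame_op_bilinear) (auto simp: power2_eq_square)
  finally show ?thesis using assms isotropic by simp
qed

text \<open>The rank-one term and the mean of such terms have norm at most \<open>L\<close> each, so
  the increment has norm at most \<open>2 * L\<close>. The target 1/2 is the range in which the
  second-order expansion is available.\<close>

lemma op_le_increment:
  assumes W: "W \<subseteq> S" "w \<in> S - W" and a: "\<bar>a\<bar> * L \<le> 1/4"
  shows "op_le n (a \<cdot>\<^sub>m increment W w) (1/2)"
proof -
  have finW: "finite W" using W finite_S finite_subset by blast
  have "W \<subset> S" using W by auto
  then have "card W < card S" using finite_S by (rule psubset_card_mono[rotated])
  then have cSW: "real (card (S - W)) = real (card S) - card W" "0 < real (card S) - card W"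
    using W finW by (simp_all add: card_Diff_subset of_nat_diff)
  let ?b = "1 / (real (card S) - card W)"
  have r: "op_le n (frame_op n v {w}) L"
    using op_le_frame_op[of "{w}" v n L] W v_carrier v_bound by auto
  have "op_le n (frame_op n v (S - W)) (real (card (S - W)) * L)"
    using finite_S v_carrier v_bound by (intro op_le_frame_op) auto
  then have e: "op_le n ((- ?b) \<cdot>\<^sub>m frame_op n v (S - W)) (\<bar>- ?b\<bar> * (real (card (S - W)) * L))"
    by (rule op_le_smult)
  have "\<bar>- ?b\<bar> * (real (card (S - W)) * L) = L" using cSW by simp
  moreover have "increment W w = frame_op n v {w} + (- ?b) \<cdot>\<^sub>m frame_op n v (S - W)"
    by (rule eq_matI) (auto simp: increment_def frame_op_def)
  ultimately have "op_le n (increment W w) (L + L)" using op_le_add[OF r e] by simp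
  then have "op_le n (a \<cdot>\<^sub>m increment W w) (\<bar>a\<bar> * (L + L))" by (rule op_le_smult)
  then show ?thesis by (rule op_le_mono) (use a in \<open>simp add: algebra_simps\<close>)
qed

text \<open>The linear terms cancel because the increments sum to 0, which leaves a variance. The
  factor \<open>card (S - W)\<close> is multiplied and divided out to match the hypothesis on
  averages in \<open>exp_trace_sum_step\<close>.\<close>

lemma increment_second_moment:
  assumes W: "W \<subseteq> S" "card W < card S" and x: "x \<in> carrier_vec n"
  shows "(\<Sum>w\<in>S - W. x \<bullet> (a \<cdot>\<^sub>m increment W w *\<^sub>v x) + nsq (a \<cdot>\<^sub>m increment W w *\<^sub>v x))
    \<le> card (S - W) * (a\<^sup>2 * L / card (S - W)) * (x \<bullet> x)"
proof -
  have finW: "finite W" using W finite_S finite_subset by blast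
  define K where "K = real (card S) - card W"
  have cSW: "real (card (S - W)) = K" "0 < K"
    using W finW by (simp_all add: card_Diff_subset of_nat_diff K_def)
  let ?T = "frame_op n v (S - W)"
  define z where "z = ?T *\<^sub>v x"
  define y where "y = (1 / K) \<cdot>\<^sub>v z"
  have z: "z \<in> carrier_vec n" and y: "y \<in> carrier_vec n"
    using x mult_mat_vec_carrier[OF frame_op_carrier x] by (auto simp: z_def y_def)
  have finSW: "finite (S - W)" and vSW: "\<And>w. w \<in> S - W \<Longrightarrow> v w \<in> carrier_vec n" using finite_S v_carrier by auto
  have Y: "a \<cdot>\<^sub>m increment W w *\<^sub>v x = a \<cdot>\<^sub>v ((v w \<bullet> x) \<cdot>\<^sub>v v w - y)" if "w \<in> S - W" for w
  proof -
    have "increment W w *\<^sub>v x = frame_op n v {w} *\<^sub>v x - ((1 / K) \<cdot>\<^sub>m ?T) *\<^sub>v x"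
      unfolding increment_def K_def by (rule minus_mult_distrib_mat_vec[of _ n n]) (use x in auto)
    also have "((1 / K) \<cdot>\<^sub>m ?T) *\<^sub>v x = y"
      unfolding y_def z_def by (rule eq_vecI) (use x in \<open>auto simp: frame_op_def\<close>)
    finally have "increment W w *\<^sub>v x = (v w \<bullet> x) \<cdot>\<^sub>v v w - y"
      using frame_op_singleton_mult[of v w n x] vSW[OF that] x by simp
    moreover have "a \<cdot>\<^sub>m increment W w *\<^sub>v x = a \<cdot>\<^sub>v (increment W w *\<^sub>v x)"
      by (rule eq_vecI) (use x in \<open>auto simp: increment_def frame_op_def\<close>)
    ultimately show ?thesis by simp
  qed
  have bil: "(\<Sum>w\<in>S - W. (v w \<bullet> x) * (v w \<bullet> u)) = z \<bullet> u" if "u \<in> carrier_vec n" for u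
  proof -
    have "(\<Sum>w\<in>S - W. (v w \<bullet> x) * (v w \<bullet> u)) = x \<bullet> (?T *\<^sub>v u)"
      using frame_op_bilinear[OF finSW vSW x that] by simp
    also have "\<dots> = z \<bullet> u"
      unfolding z_def by (rule scalar_prod_mult_mat_sym[of _ n]) (use x that frame_op_sym in auto)
    finally show ?thesis .
  qed
  have t: "x \<bullet> (a \<cdot>\<^sub>m increment W w *\<^sub>v x) + nsq (a \<cdot>\<^sub>m increment W w *\<^sub>v x)
     = a * ((v w \<bullet> x) * (v w \<bullet> x) - x \<bullet> y) + a\<^sup>2 * ((v w \<bullet> x)\<^sup>2 * (v w \<bullet> v w) - 2 * ((v w \<bullet> x) * (v w \<bullet> y)) + y \<bullet> y)"
    if w: "w \<in> S - W" for w
  proof -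
    note vw = vSW[OF w]
    define u where "u = (v w \<bullet> x) \<cdot>\<^sub>v v w - y"
    have u: "u \<in> carrier_vec n" using vw y by (auto simp: u_def)
    have xv: "x \<bullet> v w = v w \<bullet> x" and yv: "y \<bullet> v w = v w \<bullet> y" using x y vw comm_scalar_prod by auto
    have xu: "x \<bullet> u = (v w \<bullet> x) * (v w \<bullet> x) - x \<bullet> y"
      using x y vw xv by (simp add: u_def scalar_prod_minus_distrib[of _ n])
    have vu: "v w \<bullet> u = (v w \<bullet> x) * (v w \<bullet> v w) - v w \<bullet> y"
      using y vw by (simp add: u_def scalar_prod_minus_distrib[of _ n])
    have yu: "y \<bullet> u = (v w \<bullet> x) * (v w \<bullet> y) - y \<bullet> y"
      using y vw yv by (simp add: u_def scalar_prod_minus_distrib[of _ n])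
    have "u \<bullet> u = (v w \<bullet> x) * (v w \<bullet> u) - y \<bullet> u"
      using u y vw by (subst u_def, subst minus_scalar_prod_distrib[of _ n]) auto
    then have uu: "u \<bullet> u = (v w \<bullet> x)\<^sup>2 * (v w \<bullet> v w) - 2 * ((v w \<bullet> x) * (v w \<bullet> y)) + y \<bullet> y"
      unfolding vu yu by (simp add: power2_eq_square algebra_simps)
    show ?thesis unfolding Y[OF w] u_def[symmetric] using u x
      by (simp add: xu uu power2_eq_square)
  qed
  have zy: "z = K \<cdot>\<^sub>v y" using cSW z by (intro eq_vecI) (auto simp: y_def)
  have zz: "z \<bullet> x = K * (x \<bullet> y)" "z \<bullet> y = K * (y \<bullet> y)"
    using x y comm_scalar_prod[OF x y] unfolding zy by (auto simp: smult_scalar_prod_distrib[of _ n])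
  have "(\<Sum>w\<in>S - W. x \<bullet> (a \<cdot>\<^sub>m increment W w *\<^sub>v x) + nsq (a \<cdot>\<^sub>m increment W w *\<^sub>v x))
    = (\<Sum>w\<in>S - W. a * ((v w \<bullet> x) * (v w \<bullet> x) - x \<bullet> y) + a\<^sup>2 * ((v w \<bullet> x)\<^sup>2 * (v w \<bullet> v w) - 2 * ((v w \<bullet> x) * (v w \<bullet> y)) + y \<bullet> y))"
    using t by (intro sum.cong) auto
  also have "\<dots> = a * (z \<bullet> x - K * (x \<bullet> y)) +
     a\<^sup>2 * ((\<Sum>w\<in>S - W. (v w \<bullet> x)\<^sup>2 * (v w \<bullet> v w)) - 2 * (z \<bullet> y) + K * (y \<bullet> y))"
    using bil[OF x] bil[OF y] cSW
    by (simp add: sum.distrib sum_subtractf sum_distrib_left[symmetric])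
  also have "\<dots> = a\<^sup>2 * ((\<Sum>w\<in>S - W. (v w \<bullet> x)\<^sup>2 * (v w \<bullet> v w)) - K * (y \<bullet> y))"
    by (simp add: zz algebra_simps)
  \<comment> \<open>Centering only lowers the second moment, so \<open>K * (y \<bullet> y)\<close>
    is dropped; the weights \<open>v w \<bullet> v w\<close> are at most \<open>L\<close>, and the
    remaining sum is part of a Parseval sum.\<close>
  also have "\<dots> \<le> a\<^sup>2 * (L * (x \<bullet> x))"
  proof (rule mult_left_mono)
    have "(\<Sum>w\<in>S - W. (v w \<bullet> x)\<^sup>2 * (v w \<bullet> v w)) \<le> (\<Sum>w\<in>S - W. L * ((v w \<bullet> x) * (v w \<bullet> x)))"
      using v_bound by (intro sum_mono) (auto simp: power2_eq_square mult.commute intro: mult_right_mono)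
    also have "\<dots> = L * (x \<bullet> (?T *\<^sub>v x))"
      using frame_op_bilinear[OF finSW vSW x x] by (simp add: sum_distrib_left)
    also have "\<dots> \<le> L * (x \<bullet> x)" using quadratic_form_frame_le[of "S - W" x] x L_pos by simp
    moreover have "0 \<le> K * (y \<bullet> y)" using cSW by simp
    ultimately show "(\<Sum>w\<in>S - W. (v w \<bullet> x)\<^sup>2 * (v w \<bullet> v w)) - K * (y \<bullet> y) \<le> L * (x \<bullet> x)" by linarith
  qed simp
  also have "\<dots> = card (S - W) * (a\<^sup>2 * L / card (S - W)) * (x \<bullet> x)" using cSW by simp
  finally show ?thesis .
qed

end

lemma pow_one_mat: "(1\<^sub>m n :: real mat) ^\<^sub>m j = 1\<^sub>m n"
proof (induction j)
  case (Suc j)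
  then show ?case by (simp only: pow_mat.simps right_mult_one_mat[OF one_carrier_mat])
qed simp

lemma sym_smult:
  fixes A :: "real mat"
  assumes "A\<^sup>T = A"
  shows "(c \<cdot>\<^sub>m A)\<^sup>T = c \<cdot>\<^sub>m A"
proof -
  have "(c \<cdot>\<^sub>m A)\<^sup>T = c \<cdot>\<^sub>m A\<^sup>T" by (rule eq_matI) auto
  then show ?thesis using assms by simp
qed

lemma smult_add_smult:
  fixes A :: "real mat"
  assumes "A \<in> carrier_mat n n" "B \<in> carrier_mat n n"
  shows "a \<cdot>\<^sub>m (A + b \<cdot>\<^sub>m B) = a \<cdot>\<^sub>m A + (a * b) \<cdot>\<^sub>m B"
  using assms by (intro eq_matI) (auto simp: distrib_left)

section \<open>Exponential moments of the sampling martingale and the tail bound\<close>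

context isotropic_frame
begin

text \<open>Here \<open>\<mu>\<close> is the parameter of the exponential moment, not the
  incoherence. A draw moves \<open>\<mu> \<cdot>\<^sub>m centered W\<close> by
  \<open>\<mu> / p\<close> times an increment, where \<open>p\<close> elements remain after the
  draw; the hypothesis on \<open>\<mu>\<close> keeps this step within norm 1/2.\<close>

lemma exp_trace_sampling_step:
  assumes W: "W \<subseteq> S" "card W + 1 < card S"
    and a: "\<bar>\<mu>\<bar> * L \<le> (real (card S) - card W - 1) / 4"
  obtains e where "e \<longlonglongrightarrow> 0" and
    "\<And>k. 1 \<le> k \<Longrightarrow> (\<Sum>w\<in>S - W. exp_trace n k (\<mu> \<cdot>\<^sub>m centered (insert w W))) \<le>
      (real (card S) - card W) * (1 + \<mu>\<^sup>2 * L / ((real (card S) - card W - 1)\<^sup>2 * (real (card S) - card W)))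
        * exp_trace n k (\<mu> \<cdot>\<^sub>m centered W) + e k"
proof -
  have finW: "finite W" using W finite_S finite_subset by blast
  have cSW: "real (card (S - W)) = real (card S) - card W"
    using W finW by (simp add: card_Diff_subset of_nat_diff)
  define p where "p = real (card S) - card W - 1"
  have p: "0 < p" using W by (simp add: p_def)
  define b where "b = \<mu> / p"
  have b: "\<bar>b\<bar> * L \<le> 1/4"
  proof -
    have "\<bar>\<mu>\<bar> * L / p \<le> (p / 4) / p" using a p by (intro divide_right_mono) (auto simp: p_def)
    then show ?thesis using p by (simp add: b_def)
  qed
  have eq: "\<mu> \<cdot>\<^sub>m centered (insert w W) = \<mu> \<cdot>\<^sub>m centered W + b \<cdot>\<^sub>m increment W w" if "w \<in> S - W" for w
    unfolding centered_insert[OF W(1) that W(2)] p_def[symmetric] b_def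
    using smult_add_smult[OF centered_carrier increment_carrier, of \<mu> W "1 / p" W w] by simp
  have sym: "(\<mu> \<cdot>\<^sub>m centered W)\<^sup>T = \<mu> \<cdot>\<^sub>m centered W" "(b \<cdot>\<^sub>m increment W w)\<^sup>T = b \<cdot>\<^sub>m increment W w" for w
    by (intro sym_smult centered_sym increment_sym)+
  have avg: "(\<Sum>w\<in>S - W. x \<bullet> (b \<cdot>\<^sub>m increment W w *\<^sub>v x) + nsq (b \<cdot>\<^sub>m increment W w *\<^sub>v x))
    \<le> card (S - W) * (b\<^sup>2 * L / card (S - W)) * (x \<bullet> x)" if "x \<in> carrier_vec n" for x
    using increment_second_moment[OF W(1) _ that] W(2) by simp
  obtain e where e: "e \<longlonglongrightarrow> 0" and
    le: "\<And>k. 1 \<le> k \<Longrightarrow> (\<Sum>w\<in>S - W. exp_trace n k (\<mu> \<cdot>\<^sub>m centered W + b \<cdot>\<^sub>m increment W w)) \<le>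
      card (S - W) * (1 + b\<^sup>2 * L / card (S - W)) * exp_trace n k (\<mu> \<cdot>\<^sub>m centered W) + e k"
    by (rule exp_trace_sum_step[of "S - W" "\<mu> \<cdot>\<^sub>m centered W" n "\<lambda>w. b \<cdot>\<^sub>m increment W w" "b\<^sup>2 * L / card (S - W)",
      OF finite_Diff[OF finite_S] smult_carrier_mat[OF centered_carrier] sym(1)
        op_le_increment[OF W(1) _ b] sym(2) avg]) (assumption | rule that)+
  have c: "b\<^sup>2 * L / card (S - W) = \<mu>\<^sup>2 * L / (p\<^sup>2 * (real (card S) - card W))"
    unfolding cSW b_def by (simp add: power_divide)
  show ?thesis
  proof (rule that[OF e])
    fix k :: nat assume "1 \<le> k"
    have "(\<Sum>w\<in>S - W. exp_trace n k (\<mu> \<cdot>\<^sub>m centered (insert w W))) =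
      (\<Sum>w\<in>S - W. exp_trace n k (\<mu> \<cdot>\<^sub>m centered W + b \<cdot>\<^sub>m increment W w))"
      by (intro sum.cong refl) (simp only: eq)
    then show "(\<Sum>w\<in>S - W. exp_trace n k (\<mu> \<cdot>\<^sub>m centered (insert w W))) \<le>
      (real (card S) - card W) * (1 + \<mu>\<^sup>2 * L / ((real (card S) - card W - 1)\<^sup>2 * (real (card S) - card W)))
        * exp_trace n k (\<mu> \<cdot>\<^sub>m centered W) + e k"
      using le[OF \<open>1 \<le> k\<close>] unfolding c unfolding cSW p_def by (simp only:)
  qed
qed

text \<open>The expectation over uniform sets of size \<open>j\<close>, left unnormalized with the
  binomial coefficient as a factor. The recursion starts from the trace \<open>n\<close> of the
  identity and multiplies by one variance factor per draw.\<close>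

lemma sum_exp_trace_le:
  assumes \<mu>: "\<bar>\<mu>\<bar> * L \<le> (real (card S) - m) / 4" and m: "m < card S" and "j \<le> m"
  shows "\<exists>e. e \<longlonglongrightarrow> 0 \<and> (\<forall>k\<ge>1. (\<Sum>W | W \<subseteq> S \<and> card W = j. exp_trace n k (\<mu> \<cdot>\<^sub>m centered W)) \<le>
    real (card S choose j) * (\<Prod>i<j. 1 + \<mu>\<^sup>2 * L / ((real (card S) - real i - 1)\<^sup>2 * (real (card S) - real i))) * n + e k)"
  using \<open>j \<le> m\<close>
proof (induction j)
  case 0
  have "{W. W \<subseteq> S \<and> card W = 0} = {{}}" by (auto simp: finite_subset[OF _ finite_S])
  moreover have "exp_trace n k (\<mu> \<cdot>\<^sub>m centered {}) = n" for k
  proof -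
    have "1\<^sub>m n + (1 / 2 ^ k) \<cdot>\<^sub>m (\<mu> \<cdot>\<^sub>m centered {}) = 1\<^sub>m n"
      by (rule eq_matI) (auto simp: centered_def frame_op_def)
    then show ?thesis unfolding exp_trace_def by (simp only: pow_one_mat mtrace_one)
  qed
  ultimately show ?case by (intro exI[of _ "\<lambda>_. 0"]) simp
next
  case (Suc j)
  let ?N = "real (card S)"
  let ?P = "\<lambda>j. {W. W \<subseteq> S \<and> card W = j}"
  let ?f = "\<lambda>k W. exp_trace n k (\<mu> \<cdot>\<^sub>m centered W)"
  define c where "c i = \<mu>\<^sup>2 * L / ((?N - real i - 1)\<^sup>2 * (?N - real i))" for i
  obtain e where e: "e \<longlonglongrightarrow> 0" and IH: "\<And>k. 1 \<le> k \<Longrightarrow> (\<Sum>W\<in>?P j. ?f k W) \<le>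
      real (card S choose j) * (\<Prod>i<j. 1 + c i) * n + e k"
    using Suc unfolding c_def by auto
  have jN: "real j + 1 < ?N" "j + 1 < card S" using Suc.prems m by auto
  have cj: "0 \<le> c j" using jN L_pos by (simp add: c_def)
  have "\<exists>e. e \<longlonglongrightarrow> 0 \<and> (\<forall>k\<ge>1. (\<Sum>w\<in>S - W. ?f k (insert w W)) \<le> (?N - j) * (1 + c j) * ?f k W + e k)"
    if "W \<in> ?P j" for W
  proof -
    have W: "W \<subseteq> S" "card W = j" using that by auto
    \<comment> \<open>At most \<open>m\<close> elements are drawn in all, so after this draw at
      least \<open>card S - m\<close> remain, and the single hypothesis on \<open>\<mu>\<close>
      covers every step.\<close>
    have a: "\<bar>\<mu>\<bar> * L \<le> (?N - card W - 1) / 4" using \<mu> Suc.prems W by simp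
    have W2: "card W + 1 < card S" using W jN by simp
    obtain e where "e \<longlonglongrightarrow> 0" "\<And>k. 1 \<le> k \<Longrightarrow> (\<Sum>w\<in>S - W. ?f k (insert w W)) \<le> (?N - j) * (1 + c j) * ?f k W + e k"
      by (rule exp_trace_sampling_step[OF W(1) W2 a, unfolded W(2)]) (rule that, assumption, simp only: c_def)
    then show ?thesis by blast
  qed
  then have "\<forall>W\<in>?P j. \<exists>e. e \<longlonglongrightarrow> 0 \<and> (\<forall>k\<ge>1. (\<Sum>w\<in>S - W. ?f k (insert w W)) \<le> (?N - j) * (1 + c j) * ?f k W + e k)"
    by (rule ballI)
  from bchoice[OF this] obtain e' where e'': "\<forall>W\<in>?P j. e' W \<longlonglongrightarrow> 0 \<and>
      (\<forall>k\<ge>1. (\<Sum>w\<in>S - W. ?f k (insert w W)) \<le> (?N - j) * (1 + c j) * ?f k W + e' W k)" by (elim exE)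
  have e': "\<And>W. W \<in> ?P j \<Longrightarrow> e' W \<longlonglongrightarrow> 0" using bspec[OF e''] by blast
  have step: "\<And>W k. W \<in> ?P j \<Longrightarrow> 1 \<le> k \<Longrightarrow>
      (\<Sum>w\<in>S - W. ?f k (insert w W)) \<le> (?N - j) * (1 + c j) * ?f k W + e' W k"
    using bspec[OF e''] by blast
  \<comment> \<open>There are finitely many sets of size \<open>j\<close>, so their errors add up to
    a null sequence; the divisor \<open>Suc j\<close> comes from the double counting.\<close>
  define E where "E k = ((?N - j) * (1 + c j) * e k + (\<Sum>W\<in>?P j. e' W k)) / real (Suc j)" for k
  have "E \<longlonglongrightarrow> ((?N - j) * (1 + c j) * 0 + 0) / real (Suc j)"
    unfolding E_def by (intro tendsto_divide tendsto_add tendsto_mult tendsto_const e tendsto_null_sum e') (assumption | simp)+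
  then have "E \<longlonglongrightarrow> 0" by simp
  moreover have "(\<Sum>W\<in>?P (Suc j). ?f k W) \<le>
      real (card S choose Suc j) * (\<Prod>i<Suc j. 1 + c i) * n + E k" if k: "1 \<le> k" for k
  proof -
    \<comment> \<open>The factor \<open>Suc j\<close> of the double counting and the
      \<open>N - j\<close> possible next elements are exactly what carries one binomial coefficient
      to the next.\<close>
    have ch: "real (Suc j) * real (card S choose Suc j) = (?N - j) * real (card S choose j)"
    proof -
      have "Suc j * (card S choose Suc j) = (card S - j) * (card S choose j)"
        by (metis binomial_absorb_comp binomial_absorption mult.commute)
      then have "real (Suc j) * real (card S choose Suc j) = real (card S - j) * real (card S choose j)"
        by (metis of_nat_mult)
      then show ?thesis using jN by (simp add: of_nat_diff)
    qed
    have "real (Suc j) * (\<Sum>W\<in>?P (Suc j). ?f k W) = (\<Sum>W\<in>?P j. \<Sum>w\<in>S - W. ?f k (insert w W))"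
      by (rule sum_subsets_Suc[OF finite_S])
    also have "\<dots> \<le> (\<Sum>W\<in>?P j. (?N - j) * (1 + c j) * ?f k W + e' W k)"
      using step k by (intro sum_mono) auto
    also have "\<dots> = (?N - j) * (1 + c j) * (\<Sum>W\<in>?P j. ?f k W) + (\<Sum>W\<in>?P j. e' W k)"
      by (simp add: sum.distrib sum_distrib_left)
    also have "\<dots> \<le> (?N - j) * (1 + c j) * (real (card S choose j) * (\<Prod>i<j. 1 + c i) * n + e k) + (\<Sum>W\<in>?P j. e' W k)"
      using IH[OF k] jN cj by (intro add_right_mono mult_left_mono) auto
    also have "\<dots> = ((?N - j) * real (card S choose j)) * (\<Prod>i<Suc j. 1 + c i) * n + real (Suc j) * E k"
    proof -
      have "real (Suc j) * E k = (?N - j) * (1 + c j) * e k + (\<Sum>W\<in>?P j. e' W k)"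
        by (simp add: E_def del: of_nat_Suc)
      then show ?thesis by (simp add: algebra_simps del: of_nat_Suc)
    qed
    also have "\<dots> = real (Suc j) * (real (card S choose Suc j) * (\<Prod>i<Suc j. 1 + c i) * n + E k)"
      unfolding ch[symmetric] by (simp add: algebra_simps)
    finally show ?thesis by (simp only: mult_le_cancel_left_pos of_nat_0_less_iff zero_less_Suc)
  qed
  ultimately show ?case unfolding c_def by blast
qed

text \<open>The matrix Chernoff argument for one tail, chosen by the sign \<open>\<sigma>\<close>:
  Markov's inequality for the exponential trace, followed by the limit in \<open>k\<close>.\<close>

lemma card_deviating_le_aux:
  fixes \<sigma> :: real
  assumes \<delta>: "0 < \<delta>" "\<delta> \<le> 1" and \<sigma>: "\<bar>\<sigma>\<bar> = 1" and m: "m < card S"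
  defines "B \<equiv> {W. W \<subseteq> S \<and> card W = m \<and> (\<exists>x\<in>carrier_vec n. \<delta> * (m / card S) * (x \<bullet> x) <
      \<sigma> * (x \<bullet> (frame_op n v W *\<^sub>v x) - m / card S * (x \<bullet> x)))}"
  shows "card B \<le> real (card S choose m) * (n * exp (- (\<delta>\<^sup>2 * m / (8 * L * card S))))"
proof -
  define N where "N = real (card S)"
  \<comment> \<open>This choice minimizes \<open>2 * \<theta>^2 * L - \<theta> * \<delta>\<close>,
    the exponent per unit of \<open>m / N\<close>; the minimum is
    \<open>- \<delta>^2 / (8 * L)\<close>.\<close>
  define \<theta> where "\<theta> = \<delta> / (4 * L)"
  \<comment> \<open>The factor \<open>N - m\<close> undoes the normalization of
    \<open>centered\<close> on sets of size \<open>m\<close>, leaving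
    \<open>\<sigma> * \<theta>\<close> times the plain deviation. The assumption
    \<open>\<delta> \<le> 1\<close> keeps this parameter admissible for the moment bound.\<close>
  define \<mu> where "\<mu> = \<sigma> * \<theta> * (N - m)"
  have N: "0 < N" "m < N" using m by (auto simp: N_def)
  have th: "0 < \<theta>" "\<theta> * L = \<delta> / 4" using \<delta> L_pos by (auto simp: \<theta>_def)
  have amu: "\<bar>\<mu>\<bar> = \<theta> * (N - m)" using \<sigma> th N by (simp add: \<mu>_def abs_mult)
  have mu: "\<bar>\<mu>\<bar> * L \<le> (N - m) / 4"
  proof -
    have "\<bar>\<mu>\<bar> * L = (\<delta> / 4) * (N - m)" using th amu by (metis mult.commute mult.left_commute)
    also have "\<dots> \<le> (1 / 4) * (N - m)" using \<delta> N by (intro mult_right_mono) auto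
    finally show ?thesis by simp
  qed
  define s where "s = \<theta> * \<delta> * (m / N)"
  have s0: "0 \<le> s" using th \<delta> N by (simp add: s_def)
  let ?P = "{W. W \<subseteq> S \<and> card W = m}"
  let ?f = "\<lambda>k W. exp_trace n k (\<mu> \<cdot>\<^sub>m centered W)"
  have finP: "finite ?P" using finite_S by simp
  have symm: "(\<mu> \<cdot>\<^sub>m centered W)\<^sup>T = \<mu> \<cdot>\<^sub>m centered W" for W
    by (intro sym_smult centered_sym)
  have fB: "(1 + s / 2 ^ k) ^ (2 ^ k) \<le> ?f k W" if W: "W \<in> B" and k: "1 \<le> k" for W k
  proof -
    from W obtain x where W: "W \<subseteq> S" "card W = m" and x: "x \<in> carrier_vec n"
      and lt: "\<delta> * (m / N) * (x \<bullet> x) < \<sigma> * (x \<bullet> (frame_op n v W *\<^sub>v x) - m / N * (x \<bullet> x))"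
      unfolding B_def N_def by auto
    have nz: "x \<bullet> x \<noteq> 0"
    proof
      assume "x \<bullet> x = 0"
      then have "x = 0\<^sub>v n" using scalar_prod_self_eq_0 x by blast
      moreover have "frame_op n v W *\<^sub>v x \<in> carrier_vec n" using x mult_mat_vec_carrier frame_op_carrier by blast
      ultimately show False using lt by simp
    qed
    have Tx: "frame_op n v W *\<^sub>v x \<in> carrier_vec n" using x mult_mat_vec_carrier frame_op_carrier by blast
    have "\<mu> \<cdot>\<^sub>m centered W *\<^sub>v x = (\<sigma> * \<theta>) \<cdot>\<^sub>v (frame_op n v W *\<^sub>v x - (m / N) \<cdot>\<^sub>v x)"
    proof -
      have "\<mu> \<cdot>\<^sub>m centered W = (\<sigma> * \<theta>) \<cdot>\<^sub>m (frame_op n v W - (m / N) \<cdot>\<^sub>m 1\<^sub>m n)"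
        using W N by (intro eq_matI) (auto simp: centered_def \<mu>_def frame_op_def N_def)
      moreover have "((\<sigma> * \<theta>) \<cdot>\<^sub>m (frame_op n v W - (m / N) \<cdot>\<^sub>m 1\<^sub>m n)) *\<^sub>v x =
          (\<sigma> * \<theta>) \<cdot>\<^sub>v ((frame_op n v W - (m / N) \<cdot>\<^sub>m 1\<^sub>m n) *\<^sub>v x)"
        by (rule eq_vecI) (use x in \<open>auto simp: frame_op_def\<close>)
      moreover have "(frame_op n v W - (m / N) \<cdot>\<^sub>m 1\<^sub>m n) *\<^sub>v x = frame_op n v W *\<^sub>v x - ((m / N) \<cdot>\<^sub>m 1\<^sub>m n) *\<^sub>v x"
        by (rule minus_mult_distrib_mat_vec[of _ n n]) (use x in auto)
      moreover have "((m / N) \<cdot>\<^sub>m 1\<^sub>m n) *\<^sub>v x = (m / N) \<cdot>\<^sub>v x"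
        by (rule eq_vecI) (use x in auto)
      ultimately show ?thesis by simp
    qed
    then have "x \<bullet> (\<mu> \<cdot>\<^sub>m centered W *\<^sub>v x) = \<theta> * (\<sigma> * (x \<bullet> (frame_op n v W *\<^sub>v x) - m / N * (x \<bullet> x)))"
      using x Tx by (simp add: scalar_prod_minus_distrib[of _ n])
    moreover have "\<theta> * (\<delta> * (m / N) * (x \<bullet> x)) \<le> \<theta> * (\<sigma> * (x \<bullet> (frame_op n v W *\<^sub>v x) - m / N * (x \<bullet> x)))"
      using lt th by (intro mult_left_mono) auto
    ultimately have "s * (x \<bullet> x) \<le> x \<bullet> (\<mu> \<cdot>\<^sub>m centered W *\<^sub>v x)" by (simp add: s_def mult_ac)
    then show ?thesis using exp_trace_ge[OF _ symm x nz s0 _ k] by simp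
  qed
  define c where "c i = \<mu>\<^sup>2 * L / ((N - real i - 1)\<^sup>2 * (N - real i))" for i
  obtain e where e: "e \<longlonglongrightarrow> 0" and bd: "\<And>k. 1 \<le> k \<Longrightarrow> (\<Sum>W\<in>?P. ?f k W) \<le>
      real (card S choose m) * (\<Prod>i<m. 1 + c i) * n + e k"
    using sum_exp_trace_le[of \<mu> m m] mu m unfolding c_def N_def by auto
  have prod: "(\<Prod>i<m. 1 + c i) \<le> exp (2 * \<theta>\<^sup>2 * L * m / N)"
  proof -
    have c0: "0 \<le> c i" if "i < m" for i using that N L_pos by (simp add: c_def)
    have "(\<Prod>i<m. 1 + c i) \<le> (\<Prod>i<m. exp (c i))"
      using c0 exp_ge_add_one_self by (intro prod_mono) (auto intro: add_nonneg_nonneg)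
    also have "\<dots> = exp (\<Sum>i<m. c i)" by (simp add: exp_sum)
    also have "(\<Sum>i<m. c i) = \<mu>\<^sup>2 * L * (\<Sum>i<m. 1 / ((N - real i - 1)\<^sup>2 * (N - real i)))"
      by (simp add: c_def sum_distrib_left)
    also have "\<dots> \<le> \<mu>\<^sup>2 * L * (2 * real m / (N * (N - real m)\<^sup>2))"
      using sum_inverse_cubes_le[OF N(2)] L_pos by (intro mult_left_mono) auto
    also have "\<mu>\<^sup>2 = \<theta>\<^sup>2 * (N - m)\<^sup>2" using amu by (metis power2_abs power_mult_distrib)
    also have "\<theta>\<^sup>2 * (N - m)\<^sup>2 * L * (2 * real m / (N * (N - real m)\<^sup>2)) = 2 * \<theta>\<^sup>2 * L * m / N"
      using N by simp
    finally show ?thesis by simp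
  qed
  have Bsub: "B \<subseteq> ?P" by (auto simp: B_def)
  \<comment> \<open>Markov's inequality in counting form: the exponential trace is bounded below on
    \<open>B\<close> and nonnegative on the other sets.\<close>
  have ineq: "card B * (1 + s / 2 ^ k) ^ (2 ^ k) \<le> real (card S choose m) * (\<Prod>i<m. 1 + c i) * n + e k" if k: "1 \<le> k" for k
  proof -
    have "card B * (1 + s / 2 ^ k) ^ (2 ^ k) = (\<Sum>W\<in>B. (1 + s / 2 ^ k) ^ (2 ^ k))" by simp
    also have "\<dots> \<le> (\<Sum>W\<in>B. ?f k W)" using fB k by (intro sum_mono) auto
    also have "\<dots> \<le> (\<Sum>W\<in>?P. ?f k W)"
      using finP Bsub k symm by (intro sum_mono2 exp_trace_nonneg) auto
    finally show ?thesis using bd[OF k] by simp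
  qed
  \<comment> \<open>The limit in \<open>k\<close>: the left side becomes an exponential, and all
    accumulated Golden--Thompson errors disappear.\<close>
  have "(\<lambda>k. real (card B) * (1 + s / 2 ^ k) ^ (2 ^ k)) \<longlonglongrightarrow> real (card B) * exp s"
  proof (intro tendsto_mult tendsto_const)
    have "filterlim (\<lambda>k. (2::nat) ^ k) sequentially sequentially"
      by (rule filterlim_subseq) (auto simp: strict_mono_def)
    from filterlim_compose[OF tendsto_exp_limit_sequentially[of s] this]
    show "(\<lambda>k. (1 + s / 2 ^ k) ^ (2 ^ k)) \<longlonglongrightarrow> exp s" by simp
  qed
  moreover have "(\<lambda>k. real (card S choose m) * (\<Prod>i<m. 1 + c i) * n + e k) \<longlonglongrightarrow> real (card S choose m) * (\<Prod>i<m. 1 + c i) * n + 0"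
    by (intro tendsto_intros e)
  ultimately have "real (card B) * exp s \<le> real (card S choose m) * (\<Prod>i<m. 1 + c i) * n + 0"
    by (rule LIMSEQ_le) (use ineq in blast)
  also have "\<dots> \<le> real (card S choose m) * exp (2 * \<theta>\<^sup>2 * L * m / N) * n"
    using prod by (simp add: mult_left_mono mult_right_mono)
  finally have "real (card B) * exp s * exp (- s) \<le> real (card S choose m) * exp (2 * \<theta>\<^sup>2 * L * m / N) * n * exp (- s)"
    by (rule mult_right_mono) simp
  moreover have "real (card B) = real (card B) * exp s * exp (- s)" by (simp add: exp_minus)
  ultimately have "real (card B) \<le> real (card S choose m) * (n * (exp (2 * \<theta>\<^sup>2 * L * m / N) * exp (- s)))"
    by (simp only: mult_ac)
  also have "exp (2 * \<theta>\<^sup>2 * L * m / N) * exp (- s) = exp (- (\<delta>\<^sup>2 * m / (8 * L * card S)))"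
  proof -
    have "2 * \<theta>\<^sup>2 * L * m / N - s = - (\<delta>\<^sup>2 * m / (8 * L * N))"
      using L_pos N by (simp add: s_def \<theta>_def field_simps power2_eq_square)
    then show ?thesis by (simp add: exp_add[symmetric] N_def)
  qed
  finally show ?thesis .
qed

text \<open>Union bound over the two tails. For \<open>m = card S\<close> the rescaled process is
  undefined, but the only sample is \<open>S\<close> itself, whose frame operator is the
  identity.\<close>

lemma card_deviating_le:
  assumes \<delta>: "0 < \<delta>" "\<delta> \<le> 1" and m: "m \<le> card S"
  shows "card {W. W \<subseteq> S \<and> card W = m \<and> (\<exists>x\<in>carrier_vec n. \<delta> * (m / card S) * (x \<bullet> x) <
      \<bar>x \<bullet> (frame_op n v W *\<^sub>v x) - m / card S * (x \<bullet> x)\<bar>)}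
    \<le> real (card S choose m) * (2 * n * exp (- (\<delta>\<^sup>2 * m / (8 * L * card S))))" (is "real (card ?B) \<le> _")
proof (cases "m = card S")
  case True
  have "\<not> \<delta> * (m / card S) * (x \<bullet> x) < \<bar>x \<bullet> (frame_op n v W *\<^sub>v x) - m / card S * (x \<bullet> x)\<bar>"
    if W: "W \<subseteq> S" "card W = m" and x: "x \<in> carrier_vec n" for W and x :: "real vec"
  proof -
    have WS: "W = S" using W True finite_S by (simp add: card_subset_eq)
    have Tx: "frame_op n v W *\<^sub>v x = x" unfolding WS isotropic using x by simp
    show ?thesis
    proof (cases "card S = 0")
      \<comment> \<open>Here \<open>m / card S\<close> is \<open>0 / 0 = 0\<close>, so the deviation
        is \<open>x \<bullet> x\<close>; this vanishes because the identity is an empty sum.\<close>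
      case True
      then have "W = {}" using WS finite_S by simp
      then have "x \<bullet> x = 0" using frame_op_bilinear[of W v n x x] x Tx by simp
      then show ?thesis unfolding Tx by simp
    next
      case False
      have "m / card S = 1" using False True by simp
      moreover have "0 \<le> \<delta> * (x \<bullet> x)" using \<delta> by simp
      ultimately show ?thesis unfolding Tx by (simp add: not_less)
    qed
  qed
  then have "?B = {}" by blast
  then have "real (card ?B) = 0" by (simp only: card.empty of_nat_0)
  then show ?thesis by (simp only:) simp
next
  case False
  let ?A = "\<lambda>\<sigma>. {W. W \<subseteq> S \<and> card W = m \<and> (\<exists>x\<in>carrier_vec n. \<delta> * (m / card S) * (x \<bullet> x) <
      \<sigma> * (x \<bullet> (frame_op n v W *\<^sub>v x) - m / card S * (x \<bullet> x)))}"
  have "?B \<subseteq> ?A 1 \<union> ?A (-1)" by (fastforce simp: abs_if split: if_splits)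
  moreover have "finite (?A 1 \<union> ?A (-1))" using finite_S by simp
  ultimately have "card ?B \<le> card (?A 1) + card (?A (-1))"
    by (meson card_Un_le card_mono order_trans)
  then have "real (card ?B) \<le> real (card (?A 1)) + real (card (?A (-1)))" by linarith
  also have "\<dots> \<le> real (card S choose m) * (n * exp (- (\<delta>\<^sup>2 * m / (8 * L * card S)))) +
      real (card S choose m) * (n * exp (- (\<delta>\<^sup>2 * m / (8 * L * card S))))"
    using False m by (intro add_mono card_deviating_le_aux \<delta>) auto
  also have "\<dots> = real (card S choose m) * (2 * n * exp (- (\<delta>\<^sup>2 * m / (8 * L * card S))))"
    by (simp add: algebra_simps)
  finally show ?thesis .
qed

end

section \<open>Negative eigenvalues, projections and low-rank approximation\<close>

text \<open>This is \<open>S^2 \<le> b * S\<close> without diagonalization. The form is evaluated at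
  the gradient step \<open>z = x - S x / b\<close>, and its term of highest order is bounded by the
  operator norm.\<close>

lemma psd_norm_sq_le:
  assumes "\<And>x. x \<in> carrier_vec n \<Longrightarrow> 0 \<le> x \<bullet> (S *\<^sub>v x)" and S: "S \<in> carrier_mat n n" "S\<^sup>T = S"
    and b: "op_le n S b" "0 < b" and x: "x \<in> carrier_vec n"
  shows "nsq (S *\<^sub>v x) \<le> b * (x \<bullet> (S *\<^sub>v x))"
proof -
  define y where "y = S *\<^sub>v x"
  have y: "y \<in> carrier_vec n" and Sy: "S *\<^sub>v y \<in> carrier_vec n" using S x by (auto simp: y_def)
  define z where "z = x - (1 / b) \<cdot>\<^sub>v y"
  have z: "z \<in> carrier_vec n" using x y by (auto simp: z_def)
  have Sz: "S *\<^sub>v z = y - (1 / b) \<cdot>\<^sub>v (S *\<^sub>v y)"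
  proof -
    have c: "(1 / b) \<cdot>\<^sub>v y \<in> carrier_vec n" using y by simp
    show ?thesis unfolding z_def mult_minus_distrib_mat_vec[OF S(1) x c] mult_mat_vec[OF S(1) y] y_def[symmetric] ..
  qed
  have xSy: "x \<bullet> (S *\<^sub>v y) = y \<bullet> y" using scalar_prod_mult_mat_sym[OF S x y] by (simp add: y_def)
  have "z \<bullet> (S *\<^sub>v z) = x \<bullet> (S *\<^sub>v z) - (1 / b) * (y \<bullet> (S *\<^sub>v z))"
  proof -
    have c: "S *\<^sub>v z \<in> carrier_vec n" "(1 / b) \<cdot>\<^sub>v y \<in> carrier_vec n" using S z y by auto
    show ?thesis
      using minus_scalar_prod_distrib[OF x c(2) c(1)] smult_scalar_prod_distrib[OF y c(1), of "1 / b"]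
      unfolding z_def[symmetric] by simp
  qed
  also have "x \<bullet> (S *\<^sub>v z) = x \<bullet> y - (1 / b) * (y \<bullet> y)"
    unfolding Sz using x y Sy by (simp add: scalar_prod_minus_distrib[of _ n] xSy)
  also have "y \<bullet> (S *\<^sub>v z) = y \<bullet> y - (1 / b) * (y \<bullet> (S *\<^sub>v y))"
    unfolding Sz using x y Sy by (simp add: scalar_prod_minus_distrib[of _ n])
  finally have eq: "z \<bullet> (S *\<^sub>v z) = x \<bullet> y - 2 / b * (y \<bullet> y) + (1 / b)\<^sup>2 * (y \<bullet> (S *\<^sub>v y))"
    by (simp add: right_diff_distrib power2_eq_square)
  have "y \<bullet> (S *\<^sub>v y) \<le> vnorm y * (b * vnorm y)"
  proof -
    have "y \<bullet> (S *\<^sub>v y) \<le> vnorm y * vnorm (S *\<^sub>v y)" using scalar_prod_Cauchy_Schwarz[OF y Sy] by linarith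
    also have "\<dots> \<le> vnorm y * (b * vnorm y)" using op_leD(3)[OF b(1) y] by (intro mult_left_mono) auto
    finally show ?thesis .
  qed
  also have "\<dots> = b * (y \<bullet> y)" by (simp add: vnorm_sq[symmetric] power2_eq_square)
  finally have "(1 / b)\<^sup>2 * (y \<bullet> (S *\<^sub>v y)) \<le> (1 / b)\<^sup>2 * (b * (y \<bullet> y))" by (intro mult_left_mono) auto
  also have "\<dots> = (1 / b) * (y \<bullet> y)" using b by (simp add: power2_eq_square)
  finally have "0 \<le> x \<bullet> y - 2 / b * (y \<bullet> y) + (1 / b) * (y \<bullet> y)"
    using assms(1)[OF z] eq by linarith
  then have "b * ((1 / b) * (y \<bullet> y)) \<le> b * (x \<bullet> y)" using b(2) by (intro mult_left_mono) auto
  then show ?thesis using b(2) by (simp add: y_def)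
qed

lemma sq_inverse_exists:
  fixes A :: "real mat"
  assumes A: "A \<in> carrier_mat n n" and "det A \<noteq> 0"
  obtains K where "K \<in> carrier_mat n n" "K * A = 1\<^sub>m n" "A * K = 1\<^sub>m n"
proof -
  have "\<exists>K\<in>carrier_mat n n. K * A = 1\<^sub>m n \<and> A * K = 1\<^sub>m n"
    using det_non_zero_imp_unit[OF assms, of "()"] unfolding Units_def ring_mat_def by auto
  then show ?thesis using that by (elim bexE conjE)
qed

lemma smult_mult_mat_vec:
  fixes A :: "real mat"
  assumes "A \<in> carrier_mat a b" "x \<in> carrier_vec b"
  shows "(c \<cdot>\<^sub>m A) *\<^sub>v x = c \<cdot>\<^sub>v (A *\<^sub>v x)"
  using assms by (intro eq_vecI) auto

text \<open>Shift \<open>H\<close> by the least \<open>t\<close> making it positive semidefinite: a nonsingular shift would remain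
  positive semidefinite for a slightly smaller \<open>t\<close>, so \<open>- t\<close> is an eigenvalue.\<close>
lemma negative_eigenvalue_exists:
  fixes H :: "real mat"
  assumes H: "H \<in> carrier_mat n n" "H\<^sup>T = H" and x0: "x0 \<in> carrier_vec n" "x0 \<bullet> (H *\<^sub>v x0) < 0"
  shows "\<exists>e<0. eigenvalue H e"
proof -
  define psd where "psd t \<longleftrightarrow> (\<forall>x\<in>carrier_vec n. 0 \<le> x \<bullet> (H *\<^sub>v x) + t * (x \<bullet> x))" for t :: real
  define T where "T = {t. 0 \<le> t \<and> psd t}"
  define f where "f = sqrt (frob_sq H)"
  have f: "op_le n H f" "0 \<le> f" using H op_le_frob frob_sq_nonneg by (auto simp: f_def)
  have "psd f"
    unfolding psd_def
  proof
    fix x :: "real vec" assume x: "x \<in> carrier_vec n"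
    have Hx: "H *\<^sub>v x \<in> carrier_vec n" using H x by auto
    have "\<bar>x \<bullet> (H *\<^sub>v x)\<bar> \<le> vnorm x * vnorm (H *\<^sub>v x)" by (rule scalar_prod_Cauchy_Schwarz[OF x Hx])
    also have "\<dots> \<le> vnorm x * (f * vnorm x)" using op_leD(3)[OF f(1) x] by (intro mult_left_mono) auto
    also have "\<dots> = f * (x \<bullet> x)" by (simp add: vnorm_sq[symmetric] power2_eq_square)
    finally show "0 \<le> x \<bullet> (H *\<^sub>v x) + f * (x \<bullet> x)" by linarith
  qed
  then have Tne: "T \<noteq> {}" using f by (auto simp: T_def)
  have Tbd: "bdd_below T" by (rule bdd_belowI[of _ 0]) (simp add: T_def)
  define t where "t = Inf T"
  have t0: "0 \<le> t" using Tne unfolding t_def by (intro cInf_greatest) (auto simp: T_def)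
  have psdt: "psd t"
    unfolding psd_def
  proof
    fix x :: "real vec" assume x: "x \<in> carrier_vec n"
    show "0 \<le> x \<bullet> (H *\<^sub>v x) + t * (x \<bullet> x)"
    proof (cases "x \<bullet> x = 0")
      case True
      then have "x = 0\<^sub>v n" using scalar_prod_self_eq_0 x by blast
      moreover have "H *\<^sub>v x \<in> carrier_vec n" using H x by auto
      ultimately show ?thesis by simp
    next
      case False
      then have p: "0 < x \<bullet> x" using scalar_prod_self_nonneg[of x] by linarith
      have "- (x \<bullet> (H *\<^sub>v x)) / (x \<bullet> x) \<le> t" unfolding t_def
      proof (rule cInf_greatest[OF Tne])
        fix u assume "u \<in> T"
        then have "0 \<le> x \<bullet> (H *\<^sub>v x) + u * (x \<bullet> x)" using x by (auto simp: T_def psd_def)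
        then show "- (x \<bullet> (H *\<^sub>v x)) / (x \<bullet> x) \<le> u" using p by (simp add: field_simps)
      qed
      then show ?thesis using p by (simp add: field_simps)
    qed
  qed
  have "0 < t"
  proof (rule ccontr)
    assume "\<not> 0 < t"
    then have "t = 0" using t0 by simp
    then show False using psdt x0 by (auto simp: psd_def)
  qed
  define S where "S = H + t \<cdot>\<^sub>m 1\<^sub>m n"
  have S: "S \<in> carrier_mat n n" using H by (simp add: S_def)
  have Ssym: "S\<^sup>T = S"
  proof -
    have "S\<^sup>T = H\<^sup>T + t \<cdot>\<^sub>m 1\<^sub>m n" unfolding S_def using H(1) by (intro eq_matI) auto
    then show ?thesis using H by (simp add: S_def)
  qed
  have Sx: "S *\<^sub>v x = H *\<^sub>v x + t \<cdot>\<^sub>v x" if "x \<in> carrier_vec n" for x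
    using H that by (simp add: S_def add_mult_distrib_mat_vec[of _ n n] smult_mult_mat_vec[of _ n n])
  have xSx: "x \<bullet> (S *\<^sub>v x) = x \<bullet> (H *\<^sub>v x) + t * (x \<bullet> x)" if x: "x \<in> carrier_vec n" for x
  proof -
    have "H *\<^sub>v x \<in> carrier_vec n" using H x by auto
    then show ?thesis unfolding Sx[OF x] using x by (simp add: scalar_prod_add_distrib[of _ n])
  qed
  have "det S = 0"
  proof (rule ccontr)
    assume "det S \<noteq> 0"
    then obtain K where K: "K \<in> carrier_mat n n" "K * S = 1\<^sub>m n" using sq_inverse_exists[OF S] by blast
    define b where "b = sqrt (frob_sq S) + 1"
    have b: "op_le n S b" "0 < b"
      using op_le_mono[OF op_le_frob[OF S], of b] frob_sq_nonneg[of S] by (auto simp: b_def add_nonneg_pos)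
    define c where "c = sqrt (frob_sq K) + 1"
    have c: "op_le n K c" "0 < c"
      using op_le_mono[OF op_le_frob[OF K(1)], of c] frob_sq_nonneg[of K] by (auto simp: c_def add_nonneg_pos)
    \<comment> \<open>If \<open>S\<close> is invertible then
      \<open>|x|^2 \<le> c^2 * |S x|^2\<close>, and \<open>|S x|^2\<close> is at most
      \<open>b\<close> times the form at \<open>x\<close>; this constant is the resulting lower
      bound of the form relative to \<open>|x|^2\<close>.\<close>
    define \<epsilon> where "\<epsilon> = 1 / (c\<^sup>2 * b)"
    have e0: "0 < \<epsilon>" using b c by (simp add: \<epsilon>_def)
    have key: "\<epsilon> * (x \<bullet> x) \<le> x \<bullet> (S *\<^sub>v x)" if x: "x \<in> carrier_vec n" for x
    proof -
      have Sxc: "S *\<^sub>v x \<in> carrier_vec n" using S x by auto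
      have "K *\<^sub>v (S *\<^sub>v x) = x"
        unfolding assoc_mult_mat_vec[OF K(1) S x, symmetric] K(2) using x by (rule one_mult_mat_vec)
      then have "vnorm x \<le> c * vnorm (S *\<^sub>v x)" using op_leD(3)[OF c(1) Sxc] by (simp only:)
      then have "(vnorm x)\<^sup>2 \<le> (c * vnorm (S *\<^sub>v x))\<^sup>2" by (intro power_mono) auto
      then have "x \<bullet> x \<le> c\<^sup>2 * nsq (S *\<^sub>v x)" by (simp add: power_mult_distrib vnorm_sq)
      also have "\<dots> \<le> c\<^sup>2 * (b * (x \<bullet> (S *\<^sub>v x)))"
        using psdt xSx by (intro mult_left_mono psd_norm_sq_le[OF _ S Ssym b x]) (auto simp: psd_def)
      finally show ?thesis using b c by (simp add: \<epsilon>_def field_simps)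
    qed
    \<comment> \<open>Truncation at 0 keeps the smaller shift inside \<open>T\<close>; it still lies
      strictly below \<open>t\<close> because \<open>t\<close> is positive.\<close>
    define u where "u = max 0 (t - \<epsilon>)"
    have "psd u" unfolding psd_def
    proof
      fix x :: "real vec" assume x: "x \<in> carrier_vec n"
      have "\<epsilon> * (x \<bullet> x) \<le> x \<bullet> (H *\<^sub>v x) + t * (x \<bullet> x)" using key[OF x] xSx[OF x] by simp
      moreover have "(t - \<epsilon>) * (x \<bullet> x) \<le> u * (x \<bullet> x)" by (intro mult_right_mono) (auto simp: u_def)
      ultimately show "0 \<le> x \<bullet> (H *\<^sub>v x) + u * (x \<bullet> x)" by (simp add: algebra_simps)
    qed
    then have "u \<in> T" by (simp add: T_def u_def)
    then have "t \<le> u" unfolding t_def using Tbd by (rule cInf_lower)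
    then show False using e0 \<open>0 < t\<close> by (auto simp: u_def max_def split: if_splits)
  qed
  then obtain v where v: "v \<in> carrier_vec n" "v \<noteq> 0\<^sub>v n" "S *\<^sub>v v = 0\<^sub>v n"
    using det_0_iff_vec_prod_zero[OF S] by blast
  have "H *\<^sub>v v = (- t) \<cdot>\<^sub>v v"
  proof (rule eq_vecI)
    fix i assume "i < dim_vec ((- t) \<cdot>\<^sub>v v)"
    then have i: "i < n" using v by simp
    have "(H *\<^sub>v v + t \<cdot>\<^sub>v v) $ i = 0" unfolding Sx[OF v(1), symmetric] v(3) using i by simp
    then show "(H *\<^sub>v v) $ i = ((- t) \<cdot>\<^sub>v v) $ i" using i v H by simp
  qed (use H v in auto)
  then have "eigenvector H v (- t)" using v H by (simp add: eigenvector_def)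
  then show ?thesis using \<open>0 < t\<close> unfolding eigenvalue_def by (intro exI[of _ "- t"]) auto
qed

text \<open>The rank is recorded as the trace, because it enters only through the squared Frobenius
  norm of the projection, which equals that trace.\<close>

definition orth_projection :: "nat \<Rightarrow> nat \<Rightarrow> real mat \<Rightarrow> bool" where
  "orth_projection d k \<Phi> \<longleftrightarrow> \<Phi> \<in> carrier_mat d d \<and> \<Phi>\<^sup>T = \<Phi> \<and> \<Phi> * \<Phi> = \<Phi> \<and> mtrace \<Phi> = real k"

text \<open>The projection is \<open>F * (F\<^sup>T * F)^(-1) * F\<^sup>T\<close>: injectivity of
  \<open>F\<close> makes the Gram matrix nonsingular, and rotating the factors under the trace
  yields the identity of size \<open>r\<close>.\<close>

lemma orth_projection_onto_columns:
  fixes F :: "real mat"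
  assumes F: "F \<in> carrier_mat d r" and inj: "\<And>x. x \<in> carrier_vec r \<Longrightarrow> F *\<^sub>v x = 0\<^sub>v d \<Longrightarrow> x = 0\<^sub>v r"
  obtains \<Phi> K where "orth_projection d r \<Phi>" "\<Phi> * F = F" "K \<in> carrier_mat r d" "\<Phi> = F * K"
proof -
  have FT: "F\<^sup>T \<in> carrier_mat r d" using F by simp
  have G: "F\<^sup>T * F \<in> carrier_mat r r" using F by simp
  have detG: "det (F\<^sup>T * F) \<noteq> 0"
  proof
    assume "det (F\<^sup>T * F) = 0"
    then obtain v where v: "v \<in> carrier_vec r" "v \<noteq> 0\<^sub>v r" "F\<^sup>T * F *\<^sub>v v = 0\<^sub>v r"
      using det_0_iff_vec_prod_zero[OF G] by blast
    have Fv: "F *\<^sub>v v \<in> carrier_vec d" using F v by simp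
    have "nsq (F *\<^sub>v v) = (F\<^sup>T *\<^sub>v (F *\<^sub>v v)) \<bullet> v"
      using transpose_vec_mult_scalar[OF F v(1) Fv] by simp
    also have "F\<^sup>T *\<^sub>v (F *\<^sub>v v) = 0\<^sub>v r" using v(3) assoc_mult_mat_vec[OF FT F v(1)] by simp
    finally have "nsq (F *\<^sub>v v) = 0" using v by simp
    then show False using scalar_prod_self_eq_0[OF Fv] inj[OF v(1)] v(2) by blast
  qed
  obtain I where I: "I \<in> carrier_mat r r" "I * (F\<^sup>T * F) = 1\<^sub>m r" "(F\<^sup>T * F) * I = 1\<^sub>m r"
    by (rule sq_inverse_exists[OF G detG])
  have IT: "I\<^sup>T = I"
  proof -
    have GT: "(F\<^sup>T * F)\<^sup>T = F\<^sup>T * F" using transpose_mult[OF FT F] by simp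
    have ITc: "I\<^sup>T \<in> carrier_mat r r" using I(1) by simp
    have "I\<^sup>T * (F\<^sup>T * F) = ((F\<^sup>T * F) * I)\<^sup>T" unfolding transpose_mult[OF G I(1)] GT ..
    then have 1: "I\<^sup>T * (F\<^sup>T * F) = 1\<^sub>m r" unfolding I(3) by simp
    have "I\<^sup>T = I\<^sup>T * ((F\<^sup>T * F) * I)" unfolding I(3) using ITc by simp
    also have "\<dots> = I\<^sup>T * (F\<^sup>T * F) * I" by (rule assoc_mult_mat[OF ITc G I(1), symmetric])
    also have "\<dots> = I" unfolding 1 using I(1) by simp
    finally show ?thesis .
  qed
  define K where "K = I * F\<^sup>T"
  define \<Phi> where "\<Phi> = F * K"
  have K: "K \<in> carrier_mat r d" using I FT by (simp add: K_def)
  have P: "\<Phi> \<in> carrier_mat d d" using F K by (simp add: \<Phi>_def)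
  have KF: "K * F = 1\<^sub>m r" unfolding K_def assoc_mult_mat[OF I(1) FT F] by (rule I(2))
  have PF: "\<Phi> * F = F" unfolding \<Phi>_def assoc_mult_mat[OF F K F] KF using F by simp
  have PP: "\<Phi> * \<Phi> = \<Phi>"
    using assoc_mult_mat[OF P F K, symmetric] unfolding PF by (simp only: \<Phi>_def[symmetric])
  have PT: "\<Phi>\<^sup>T = \<Phi>"
  proof -
    have "\<Phi>\<^sup>T = K\<^sup>T * F\<^sup>T" unfolding \<Phi>_def by (rule transpose_mult[OF F K])
    also have "K\<^sup>T = F * I" unfolding K_def using transpose_mult[OF I(1) FT] IT by simp
    finally show ?thesis unfolding \<Phi>_def K_def assoc_mult_mat[OF F I(1) FT] .
  qed
  have "mtrace \<Phi> = mtrace (K * F)" unfolding \<Phi>_def by (rule mtrace_comm[OF F K])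
  then have "mtrace \<Phi> = r" by (simp add: KF mtrace_one)
  with P PT PP have "orth_projection d r \<Phi>" by (simp only: orth_projection_def)
  then show ?thesis using PF K \<Phi>_def by (rule that)
qed

text \<open>Vector-wise bounds on \<open>Y\<^sup>T\<close>, tested at the rows of \<open>P\<close>,
  thereby add up to bounds on the Frobenius norm of \<open>P * Y\<close>.\<close>

lemma frob_sq_mult_rows:
  assumes P: "P \<in> carrier_mat e d" and Y: "Y \<in> carrier_mat d k"
  shows "frob_sq (P * Y) = (\<Sum>i<e. nsq (Y\<^sup>T *\<^sub>v row P i))"
proof -
  have "frob_sq (P * Y) = (\<Sum>i<e. \<Sum>j<k. ((P * Y) $$ (i,j))\<^sup>2)" using P Y by (simp add: frob_sq_def)
  also have "\<dots> = (\<Sum>i<e. nsq (Y\<^sup>T *\<^sub>v row P i))"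
  proof (intro sum.cong refl)
    fix i assume i: "i \<in> {..<e}"
    have c: "Y\<^sup>T *\<^sub>v row P i \<in> carrier_vec k" using P Y i by (auto intro!: mult_mat_vec_carrier[of _ k d])
    have rP: "row P i \<in> carrier_vec d" using P by auto
    have "(P * Y) $$ (i,j) = (Y\<^sup>T *\<^sub>v row P i) $ j" if "j < k" for j
    proof -
      have "col Y j \<in> carrier_vec d" using Y by auto
      then show ?thesis using P Y i that comm_scalar_prod[OF rP] by simp
    qed
    then show "(\<Sum>j<k. ((P * Y) $$ (i,j))\<^sup>2) = nsq (Y\<^sup>T *\<^sub>v row P i)"
      unfolding scalar_prod_self[OF c] by (intro sum.cong) auto
  qed
  finally show ?thesis .
qed

lemma frob_sq_rows:
  assumes P: "P \<in> carrier_mat e d"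
  shows "frob_sq P = (\<Sum>i<e. row P i \<bullet> row P i)"
proof -
  have "1\<^sub>m d *\<^sub>v row P i = row P i" for i using P by (intro one_mult_mat_vec carrier_vecI) simp
  then show ?thesis using frob_sq_mult_rows[OF P one_carrier_mat] P by simp
qed

lemma frob_sq_add:
  assumes "P \<in> carrier_mat a b" "Q \<in> carrier_mat a b"
  shows "frob_sq (P + Q) = frob_sq P + 2 * mtrace (P * Q\<^sup>T) + frob_sq Q"
  using assms by (simp add: mtrace_mult_transpose frob_sq_def power2_sum sum.distrib sum_distrib_left mult_ac)

lemma frob_sq_eq_0:
  assumes "P \<in> carrier_mat a b" "frob_sq P = 0"
  shows "P = 0\<^sub>m a b"
proof (rule eq_matI)
  fix i j assume "i < dim_row (0\<^sub>m a b :: real mat)" "j < dim_col (0\<^sub>m a b :: real mat)"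
  then have ij: "i < a" "j < b" by auto
  have "(\<Sum>i<a. \<Sum>j<b. (P $$ (i,j))\<^sup>2) = 0" using assms by (simp add: frob_sq_def)
  then have "(\<Sum>j<b. (P $$ (i,j))\<^sup>2) = 0"
    using ij by (subst (asm) sum_nonneg_eq_0_iff) (auto intro: sum_nonneg)
  then have "(P $$ (i,j))\<^sup>2 = 0" using ij by (subst (asm) sum_nonneg_eq_0_iff) auto
  then show "P $$ (i,j) = 0\<^sub>m a b $$ (i,j)" using ij by simp
qed (use assms in auto)

context
  fixes d k :: nat and \<Psi> :: "real mat"
  assumes T: "orth_projection d k \<Psi>"
begin

lemma proj_carrier: "\<Psi> \<in> carrier_mat d d" "1\<^sub>m d - \<Psi> \<in> carrier_mat d d"
proof -
  show "\<Psi> \<in> carrier_mat d d" using T by (simp only: orth_projection_def)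
  then show "1\<^sub>m d - \<Psi> \<in> carrier_mat d d" by (rule minus_carrier_mat)
qed

lemma frob_sq_projection: "frob_sq \<Psi> = k"
proof -
  have "frob_sq \<Psi> = mtrace (\<Psi> * \<Psi>\<^sup>T)" by (rule frob_sq_trace[OF proj_carrier(1)])
  then show ?thesis using T by (simp only: orth_projection_def)
qed

lemma projection_mult_cancel:
  assumes Y: "Y \<in> carrier_mat d e"
  shows "\<Psi> * Y + (1\<^sub>m d - \<Psi>) * Y = Y"
proof -
  have "(1\<^sub>m d - \<Psi>) * Y = Y - \<Psi> * Y"
    using minus_mult_distrib_mat[OF one_carrier_mat proj_carrier(1) Y] unfolding left_mult_one_mat[OF Y] .
  moreover have "\<Psi> * Y \<in> carrier_mat d e" by (rule mult_carrier_mat[OF proj_carrier(1) Y])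
  moreover have "X + (Y - X) = Y" if "X \<in> carrier_mat d e" for X
    using that Y by (intro eq_matI) auto
  ultimately show ?thesis by (simp only:)
qed

text \<open>Rotating the factors under the trace brings the cross term to the form
  \<open>\<Psi> * (1 - \<Psi>) * Y * Y\<^sup>T\<close>, which is 0.\<close>

lemma frob_sq_Pythagoras:
  assumes Y: "Y \<in> carrier_mat d e"
  shows "frob_sq Y = frob_sq (\<Psi> * Y) + frob_sq ((1\<^sub>m d - \<Psi>) * Y)"
proof -
  let ?A = "\<Psi> * Y" and ?B = "(1\<^sub>m d - \<Psi>) * Y"
  have A: "?A \<in> carrier_mat d e" and B: "?B \<in> carrier_mat d e"
    by (rule mult_carrier_mat[OF _ Y], rule proj_carrier)+
  have P0: "\<Psi> * (1\<^sub>m d - \<Psi>) = 0\<^sub>m d d"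
  proof -
    have "\<Psi> * \<Psi> = \<Psi>" using T by (simp only: orth_projection_def)
    then show ?thesis
      unfolding mult_minus_distrib_mat[OF proj_carrier(1) one_carrier_mat proj_carrier(1)]
      using proj_carrier(1) by (intro eq_matI) auto
  qed
  have YY: "Y * Y\<^sup>T \<in> carrier_mat d d" and YT: "Y\<^sup>T \<in> carrier_mat e d" and BY: "?B * Y\<^sup>T \<in> carrier_mat d d"
    using Y B by (auto intro: mult_carrier_mat)
  have "mtrace (?A * ?B\<^sup>T) = mtrace (?B * ?A\<^sup>T)"
    using A B by (simp add: mtrace_mult_transpose[of _ d e] mult.commute)
  also have "?A\<^sup>T = Y\<^sup>T * \<Psi>"
    using transpose_mult[OF proj_carrier(1) Y] T by (simp only: orth_projection_def)
  also have "?B * (Y\<^sup>T * \<Psi>) = ?B * Y\<^sup>T * \<Psi>"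
    by (rule assoc_mult_mat[OF B YT proj_carrier(1), symmetric])
  also have "mtrace (?B * Y\<^sup>T * \<Psi>) = mtrace (\<Psi> * (?B * Y\<^sup>T))"
    by (rule mtrace_comm[OF BY proj_carrier(1)])
  also have "?B * Y\<^sup>T = (1\<^sub>m d - \<Psi>) * (Y * Y\<^sup>T)"
    by (rule assoc_mult_mat[OF proj_carrier(2) Y YT])
  also have "\<Psi> * ((1\<^sub>m d - \<Psi>) * (Y * Y\<^sup>T)) = \<Psi> * (1\<^sub>m d - \<Psi>) * (Y * Y\<^sup>T)"
    by (rule assoc_mult_mat[OF proj_carrier YY, symmetric])
  also have "\<dots> = 0\<^sub>m d d" unfolding P0 by (rule left_mult_zero_mat[OF YY])
  also have "mtrace (0\<^sub>m d d) = 0" by (simp add: mtrace_def)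
  finally have "mtrace (?A * ?B\<^sup>T) = 0" .
  then show ?thesis using frob_sq_add[OF A B] projection_mult_cancel[OF Y] by simp
qed

end

text \<open>A form of the Eckart--Young theorem: \<open>X\<close> is a best rank \<open>r\<close> approximation of \<open>X + N\<close>.\<close>
lemma low_rank_approximation:
  fixes X N Ms :: "real mat"
  assumes X: "X \<in> carrier_mat d e" and N: "N \<in> carrier_mat d e" and Ms: "Ms \<in> carrier_mat d e"
    and P: "orth_projection d r \<Phi>" and T: "orth_projection d r \<Psi>"
    and TMs: "\<Psi> * Ms = Ms" and PX: "\<Phi> * X = X" and PN: "\<Phi> * N = 0\<^sub>m d e" and XN: "X * N\<^sup>T = 0\<^sub>m d d"
    and X_ge: "\<And>x. x \<in> carrier_vec d \<Longrightarrow> s * nsq (\<Phi> *\<^sub>v x) \<le> nsq (X\<^sup>T *\<^sub>v x)"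
    and N_le: "\<And>x. x \<in> carrier_vec d \<Longrightarrow> nsq (N\<^sup>T *\<^sub>v x) \<le> s * (x \<bullet> x - nsq (\<Phi> *\<^sub>v x))"
  shows "0 \<le> frob_sq (X - Ms) + 2 * mtrace ((X - Ms) * N\<^sup>T)"
proof -
  let ?C = "1\<^sub>m d - \<Psi>"
  have Tc: "\<Psi> \<in> carrier_mat d d" "?C \<in> carrier_mat d d" using proj_carrier[OF T] .
  have Pc: "\<Phi> \<in> carrier_mat d d" "\<Phi>\<^sup>T = \<Phi>" using P by (auto simp: orth_projection_def)
  define Z where "Z = X + N"
  have Z: "Z \<in> carrier_mat d e" using X N by (simp add: Z_def)
  have NT: "N\<^sup>T \<in> carrier_mat e d" using N by simp
  have TX: "\<Psi> * X \<in> carrier_mat d e" "\<Psi> * N \<in> carrier_mat d e" "?C * Z \<in> carrier_mat d e"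
    by (rule mult_carrier_mat[OF Tc(1) X], rule mult_carrier_mat[OF Tc(1) N], rule mult_carrier_mat[OF Tc(2) Z])
  have zero: "mtrace (0\<^sub>m d d) = 0" by (simp add: mtrace_def)
  \<comment> \<open>What \<open>X\<close> loses outside the range of \<open>\<Psi>\<close>: the rows
    of \<open>1 - \<Psi>\<close> are inserted into \<open>X_ge\<close>, and
    \<open>r - frob_sq (\<Psi> * \<Phi>)\<close> measures how far the two ranges differ.\<close>
  have fTX: "s * (r - frob_sq (\<Psi> * \<Phi>)) \<le> frob_sq (?C * X)"
  proof -
    have "s * frob_sq (?C * \<Phi>) = (\<Sum>i<d. s * nsq (\<Phi> *\<^sub>v row ?C i))"
      unfolding frob_sq_mult_rows[OF Tc(2) Pc(1)] Pc(2) by (rule sum_distrib_left)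
    also have "\<dots> \<le> (\<Sum>i<d. nsq (X\<^sup>T *\<^sub>v row ?C i))"
      by (intro sum_mono X_ge row_carrier_vec[OF _ Tc(2)]) simp
    also have "\<dots> = frob_sq (?C * X)" by (rule frob_sq_mult_rows[OF Tc(2) X, symmetric])
    finally have "s * frob_sq (?C * \<Phi>) \<le> frob_sq (?C * X)" .
    moreover have "frob_sq (?C * \<Phi>) = r - frob_sq (\<Psi> * \<Phi>)"
      using frob_sq_Pythagoras[OF T Pc(1)] frob_sq_projection[OF P] by linarith
    ultimately show ?thesis by (simp only:)
  qed
  \<comment> \<open>What \<open>N\<close> can gain inside the range of \<open>\<Psi>\<close>. The
    same quantity appears because both projections have the same rank \<open>r\<close>.\<close>
  have fTN: "frob_sq (\<Psi> * N) \<le> s * (r - frob_sq (\<Psi> * \<Phi>))"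
  proof -
    have "frob_sq (\<Psi> * N) \<le> (\<Sum>i<d. s * (row \<Psi> i \<bullet> row \<Psi> i - nsq (\<Phi> *\<^sub>v row \<Psi> i)))"
      unfolding frob_sq_mult_rows[OF Tc(1) N] by (intro sum_mono N_le row_carrier_vec[OF _ Tc(1)]) simp
    also have "\<dots> = s * (frob_sq \<Psi> - frob_sq (\<Psi> * \<Phi>))"
      unfolding frob_sq_mult_rows[OF Tc(1) Pc(1)] frob_sq_rows[OF Tc(1)] Pc(2)
      by (simp add: sum_distrib_left[symmetric] sum_subtractf)
    finally show ?thesis unfolding frob_sq_projection[OF T] .
  qed
  have fZ: "frob_sq Z = frob_sq X + frob_sq N"
    using frob_sq_add[OF X N] unfolding XN zero Z_def by simp
  have fTZ: "frob_sq (\<Psi> * Z) = frob_sq (\<Psi> * X) + frob_sq (\<Psi> * N)"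
  proof -
    have "(\<Psi> * N)\<^sup>T = N\<^sup>T * \<Psi>"
      using transpose_mult[OF Tc(1) N] T by (simp only: orth_projection_def)
    then have "\<Psi> * X * (\<Psi> * N)\<^sup>T = \<Psi> * X * (N\<^sup>T * \<Psi>)" by (simp only:)
    also have "\<dots> = \<Psi> * (X * (N\<^sup>T * \<Psi>))"
      by (rule assoc_mult_mat[OF Tc(1) X mult_carrier_mat[OF NT Tc(1)]])
    also have "X * (N\<^sup>T * \<Psi>) = 0\<^sub>m d d"
      unfolding assoc_mult_mat[OF X NT Tc(1), symmetric] XN by (rule left_mult_zero_mat[OF Tc(1)])
    also have "\<Psi> * 0\<^sub>m d d = 0\<^sub>m d d" by (rule right_mult_zero_mat[OF Tc(1)])
    finally have eq0: "\<Psi> * X * (\<Psi> * N)\<^sup>T = 0\<^sub>m d d" .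
    have "\<Psi> * Z = \<Psi> * X + \<Psi> * N" unfolding Z_def by (rule mult_add_distrib_mat[OF Tc(1) X N])
    then show ?thesis using frob_sq_add[OF TX(1,2)] unfolding eq0 zero by simp
  qed
  \<comment> \<open>The loss of \<open>X\<close> outweighs the gain of \<open>N\<close>, so the part
    of \<open>Z\<close> outside the range of \<open>\<Psi>\<close> is at least as large as
    \<open>N\<close>. As \<open>Ms\<close> lies inside that range, subtracting it does not change
    this part.\<close>
  have "frob_sq N \<le> frob_sq (?C * Z)"
    using frob_sq_Pythagoras[OF T Z] frob_sq_Pythagoras[OF T X] fTX fTN fZ fTZ by linarith
  also have "?C * Z = ?C * (Z - Ms)"
  proof -
    have "?C * Ms = 0\<^sub>m d e"
      unfolding minus_mult_distrib_mat[OF one_carrier_mat Tc(1) Ms] TMs left_mult_one_mat[OF Ms]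
      using Ms by (intro eq_matI) auto
    moreover have "?C * (Z - Ms) = ?C * Z - ?C * Ms" by (rule mult_minus_distrib_mat[OF Tc(2) Z Ms])
    moreover have "Y - 0\<^sub>m d e = Y" if "Y \<in> carrier_mat d e" for Y :: "real mat"
      using that by (intro eq_matI) auto
    ultimately show ?thesis using TX(3) by (simp only:)
  qed
  also have "frob_sq (?C * (Z - Ms)) \<le> frob_sq (Z - Ms)"
    using frob_sq_Pythagoras[OF T minus_carrier_mat[OF Ms], of Z] frob_sq_nonneg[of "\<Psi> * (Z - Ms)"] by linarith
  also have "Z - Ms = (X - Ms) + N" using X N Ms by (intro eq_matI) (auto simp: Z_def)
  also have "frob_sq ((X - Ms) + N) = frob_sq (X - Ms) + 2 * mtrace ((X - Ms) * N\<^sup>T) + frob_sq N"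
    using X N Ms by (intro frob_sq_add) auto
  finally show ?thesis by simp
qed

section \<open>Critical points under the restricted isometry property\<close>

lemma linear_lower_bound_imp_0:
  fixes c K :: real
  assumes "\<And>t. 0 \<le> t * c + K"
  shows "c = 0"
proof (rule ccontr)
  assume "c \<noteq> 0"
  then show False using assms[of "- (K + 1) / c"] by simp
qed

text \<open>The binary form has determinant \<open>\<kappa>^2 * A * B - B^2\<close>, which must be
  nonnegative. The test point \<open>(- B, \<kappa> * A)\<close> exposes it; for
  \<open>A = 0\<close> that point is useless and \<open>(- \<kappa>, 1)\<close> serves
  instead.\<close>

lemma quadratic_discriminant_bound:
  fixes A B \<kappa> :: real
  assumes h: "\<And>s t. 0 \<le> 2 * s * t * B + \<kappa> * (s\<^sup>2 * A + t\<^sup>2 * B)" and \<kappa>: "0 < \<kappa>" and A: "0 \<le> A" and B: "0 \<le> B"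
  shows "B \<le> \<kappa>\<^sup>2 * A"
proof (cases "A = 0")
  case True
  have "0 \<le> - (\<kappa> * B)" using h[of "- \<kappa>" 1] True by (simp add: mult.commute)
  then have "B \<le> 0" using \<kappa> by (simp add: mult_le_0_iff)
  then show ?thesis using True by simp
next
  case False
  show ?thesis
  proof (rule ccontr)
    assume "\<not> B \<le> \<kappa>\<^sup>2 * A"
    then have lt: "\<kappa>\<^sup>2 * A - B < 0" by simp
    have B0: "0 < B" using lt A by (smt (verit) mult_nonneg_nonneg zero_le_power2)
    have "0 \<le> (\<kappa> * A * B) * (\<kappa>\<^sup>2 * A - B)"
      using h[of "- B" "\<kappa> * A"] by (simp add: power2_eq_square algebra_simps)
    moreover have "(\<kappa> * A * B) * (\<kappa>\<^sup>2 * A - B) < 0"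
      using lt B0 \<kappa> A False by (intro mult_pos_neg) auto
    ultimately show False by simp
  qed
qed

lemma minus_mat_eq_zero_iff:
  fixes P :: "real mat"
  assumes "P \<in> carrier_mat a b" "Q \<in> carrier_mat a b" "P - Q = 0\<^sub>m a b"
  shows "P = Q"
proof (rule eq_matI)
  fix i j assume "i < dim_row Q" "j < dim_col Q"
  moreover from this have "(P - Q) $$ (i,j) = 0" unfolding assms(3) using assms by auto
  ultimately show "P $$ (i,j) = Q $$ (i,j)" using index_minus_mat(1)[of i Q j P] by simp
qed (use assms in auto)

text \<open>\<open>hess\<close> is the second-order condition in the directions
  \<open>a * w\<^sup>T\<close> and \<open>b * z\<^sup>T\<close> with the quadratic part already
  replaced by its upper isometry bound: the bracket is the squared Frobenius norm of
  \<open>a * (V w)\<^sup>T + U z * b\<^sup>T\<close>. Sampling enters only through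
  \<open>\<kappa>\<close> and \<open>\<alpha>\<close>.\<close>

lemma no_spurious_critical_point:
  fixes U V G Ms :: "real mat"
  assumes U: "U \<in> carrier_mat d1 r" and V: "V \<in> carrier_mat d2 r" and Ms: "Ms \<in> carrier_mat d1 d2"
    and G: "G \<in> carrier_mat d1 d2" and r: "0 < r"
    and T: "orth_projection d1 r \<Psi>" "\<Psi> * Ms = Ms"
    and GV: "G * V = 0\<^sub>m d1 r" and GTU: "G\<^sup>T * U = 0\<^sub>m d2 r"
    and hess: "\<And>a b w z. a \<in> carrier_vec d1 \<Longrightarrow> b \<in> carrier_vec d2 \<Longrightarrow> w \<in> carrier_vec r \<Longrightarrow> z \<in> carrier_vec r \<Longrightarrow>
      0 \<le> 2 * (w \<bullet> z) * (a \<bullet> (G *\<^sub>v b)) + \<kappa> * ((a \<bullet> a) * nsq (V *\<^sub>v w)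
        + nsq (U *\<^sub>v z) * (b \<bullet> b) + 2 * (a \<bullet> (U *\<^sub>v z)) * ((V *\<^sub>v w) \<bullet> b))"
    and \<kappa>: "0 < \<kappa>" and \<alpha>: "\<kappa> < 2 * \<alpha>"
    and lower: "\<alpha> * frob_sq (U * V\<^sup>T - Ms) \<le> mtrace (G * (U * V\<^sup>T - Ms)\<^sup>T)"
  shows "U * V\<^sup>T = Ms"
proof -
  define X where "X = U * V\<^sup>T"
  have VT: "V\<^sup>T \<in> carrier_mat r d2" and UT: "U\<^sup>T \<in> carrier_mat r d1" and GT: "G\<^sup>T \<in> carrier_mat d2 d1"
    using U V G by simp_all
  have X: "X \<in> carrier_mat d1 d2" unfolding X_def by (rule mult_carrier_mat[OF U VT])
  have XT: "X\<^sup>T = V * U\<^sup>T" unfolding X_def transpose_mult[OF U VT] by simp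
  have XTc: "X\<^sup>T \<in> carrier_mat d2 d1" using X by simp
  have XTx: "X\<^sup>T *\<^sub>v x = V *\<^sub>v (U\<^sup>T *\<^sub>v x)" if "x \<in> carrier_vec d1" for x
    unfolding XT by (rule assoc_mult_mat_vec[OF V UT that])
  define E where "E = X - Ms"
  have E: "E \<in> carrier_mat d1 d2" unfolding E_def by (rule minus_carrier_mat[OF Ms])
  have \<alpha>0: "0 < \<alpha>" using \<kappa> \<alpha> by simp
  have "frob_sq E \<le> 0"
  proof (cases "\<exists>w\<in>carrier_vec r. w \<noteq> 0\<^sub>v r \<and> U *\<^sub>v w = 0\<^sub>v d1")
    case True
    then obtain w where w: "w \<in> carrier_vec r" "w \<noteq> 0\<^sub>v r" "U *\<^sub>v w = 0\<^sub>v d1" by blast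
    have ww: "w \<bullet> w \<noteq> 0" using scalar_prod_self_eq_0[OF w(1)] w(2) by blast
    have G0: "a \<bullet> (G *\<^sub>v b) = 0" if a: "a \<in> carrier_vec d1" and b: "b \<in> carrier_vec d2" for a b
    proof -
      have Gb: "G *\<^sub>v b \<in> carrier_vec d1" using G b by simp
      \<comment> \<open>Taking \<open>z = w\<close> in the kernel of \<open>U\<close> removes every
        term quadratic in \<open>b\<close>. What is left is affine in the scale \<open>t\<close> of
        \<open>b\<close>, and an affine function bounded below on the whole line has slope
        0.\<close>
      have "0 \<le> t * (2 * (w \<bullet> w) * (a \<bullet> (G *\<^sub>v b))) + \<kappa> * ((a \<bullet> a) * nsq (V *\<^sub>v w))" for t
      proof -
        have tb: "t \<cdot>\<^sub>v b \<in> carrier_vec d2" using b by simp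
        have "a \<bullet> (G *\<^sub>v (t \<cdot>\<^sub>v b)) = t * (a \<bullet> (G *\<^sub>v b))"
          unfolding mult_mat_vec[OF G b] by (rule scalar_prod_smult_distrib[OF a Gb])
        moreover have "(0\<^sub>v d1 :: real vec) \<bullet> 0\<^sub>v d1 = 0" "a \<bullet> 0\<^sub>v d1 = 0" using a by simp_all
        ultimately show ?thesis using hess[OF a tb w(1) w(1)] unfolding w(3) by (simp add: mult_ac)
      qed
      then have "2 * (w \<bullet> w) * (a \<bullet> (G *\<^sub>v b)) = 0" by (rule linear_lower_bound_imp_0)
      then show ?thesis using ww by simp
    qed
    have "mtrace (G * E\<^sup>T) = (\<Sum>i<d1. \<Sum>k<d2. G $$ (i,k) * E $$ (i,k))" by (rule mtrace_mult_transpose[OF G E])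
    also have "\<dots> = 0"
    proof (intro sum.neutral ballI)
      fix i k assume ik: "i \<in> {..<d1}" "k \<in> {..<d2}"
      have "unit_vec d1 i \<bullet> (G *\<^sub>v unit_vec d2 k) = G $$ (i,k)"
        using G ik by (subst scalar_prod_left_unit) auto
      then show "G $$ (i,k) * E $$ (i,k) = 0" using G0[of "unit_vec d1 i" "unit_vec d2 k"] by simp
    qed
    finally have "\<alpha> * frob_sq E \<le> 0" using lower by (simp add: E_def X_def)
    then show ?thesis using \<alpha>0 by (simp add: mult_le_0_iff)
  next
    case False
    then have inj: "\<And>x. x \<in> carrier_vec r \<Longrightarrow> U *\<^sub>v x = 0\<^sub>v d1 \<Longrightarrow> x = 0\<^sub>v r" by blast
    obtain \<Phi> K where P: "orth_projection d1 r \<Phi>" and PU: "\<Phi> * U = U" and K: "K \<in> carrier_mat r d1" and PK: "\<Phi> = U * K"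
      by (rule orth_projection_onto_columns[OF U inj])
    have Pc: "\<Phi> \<in> carrier_mat d1 d1" "\<Phi>\<^sup>T = \<Phi>" "\<Phi> * \<Phi> = \<Phi>" using P by (simp_all only: orth_projection_def)
    have UTP: "U\<^sup>T * \<Phi> = U\<^sup>T" using transpose_mult[OF Pc(1) U] unfolding PU Pc(2) by simp
    have PX: "\<Phi> * X = X" unfolding X_def assoc_mult_mat[OF Pc(1) U VT, symmetric] PU ..
    have Px: "\<Phi> *\<^sub>v x = U *\<^sub>v (K *\<^sub>v x)" "\<Phi> *\<^sub>v x \<in> carrier_vec d1" if "x \<in> carrier_vec d1" for x
      using assoc_mult_mat_vec[OF U K that] mult_mat_vec_carrier[OF Pc(1) that] by (simp_all only: PK)
    have XTP: "X\<^sup>T *\<^sub>v (\<Phi> *\<^sub>v x) = X\<^sup>T *\<^sub>v x" if "x \<in> carrier_vec d1" for x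
    proof -
      have "X\<^sup>T * \<Phi> = X\<^sup>T" using transpose_mult[OF Pc(1) X] unfolding PX Pc(2) by simp
      then show ?thesis using assoc_mult_mat_vec[OF XTc Pc(1) that] by (simp only:)
    qed
    \<comment> \<open>The squared lengths of \<open>X\<^sup>T u\<close> over unit vectors
      \<open>u\<close> in the range of \<open>U\<close>; their infimum is the square of the
      \<open>r\<close>-th singular value of \<open>X\<close>.\<close>
    define Q where "Q = {q. \<exists>z\<in>carrier_vec r. nsq (U *\<^sub>v z) = 1 \<and> q = nsq (X\<^sup>T *\<^sub>v (U *\<^sub>v z))}"
    define s where "s = Inf Q"
    have normalize: "nsq (X\<^sup>T *\<^sub>v (U *\<^sub>v y)) / nsq (U *\<^sub>v y) \<in> Q"
      if y: "y \<in> carrier_vec r" and nz: "nsq (U *\<^sub>v y) \<noteq> 0" for y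
    proof -
      define c where "c = nsq (U *\<^sub>v y)"
      have c: "0 < c" using nz scalar_prod_self_nonneg[of "U *\<^sub>v y"] unfolding c_def by linarith
      have Uy: "U *\<^sub>v y \<in> carrier_vec d1" and XUy: "X\<^sup>T *\<^sub>v (U *\<^sub>v y) \<in> carrier_vec d2" using U y XTc by simp_all
      define t where "t = 1 / sqrt c"
      have tt: "t * t = 1 / c" using c by (simp add: t_def)
      have 1: "U *\<^sub>v (t \<cdot>\<^sub>v y) = t \<cdot>\<^sub>v (U *\<^sub>v y)" by (rule mult_mat_vec[OF U y])
      have 2: "X\<^sup>T *\<^sub>v (t \<cdot>\<^sub>v (U *\<^sub>v y)) = t \<cdot>\<^sub>v (X\<^sup>T *\<^sub>v (U *\<^sub>v y))" by (rule mult_mat_vec[OF XTc Uy])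
      have sq: "nsq (t \<cdot>\<^sub>v u) = (u \<bullet> u) / c" for u :: "real vec"
        using tt by (simp add: mult.assoc[symmetric])
      have "nsq (U *\<^sub>v (t \<cdot>\<^sub>v y)) = 1" unfolding 1 sq using c by (simp add: c_def)
      moreover have "nsq (X\<^sup>T *\<^sub>v (U *\<^sub>v (t \<cdot>\<^sub>v y))) = nsq (X\<^sup>T *\<^sub>v (U *\<^sub>v y)) / c"
        unfolding 1 2 sq ..
      moreover have "t \<cdot>\<^sub>v y \<in> carrier_vec r" using y by simp
      ultimately show ?thesis unfolding Q_def c_def[symmetric] by (intro CollectI bexI[of _ "t \<cdot>\<^sub>v y"]) simp_all
    qed
    have Qne: "Q \<noteq> {}"
    proof -
      define y :: "real vec" where "y = unit_vec r 0"
      have y: "y \<in> carrier_vec r" "y \<noteq> 0\<^sub>v r" using r by (simp_all add: y_def)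
      have "U *\<^sub>v y \<in> carrier_vec d1" using U y by simp
      then have "nsq (U *\<^sub>v y) \<noteq> 0" using scalar_prod_self_eq_0 inj y by blast
      then show ?thesis using normalize[OF y(1)] by blast
    qed
    have Qbd: "bdd_below Q" by (rule bdd_belowI[of _ 0]) (auto simp: Q_def)
    have X_ge: "s * nsq (\<Phi> *\<^sub>v x) \<le> nsq (X\<^sup>T *\<^sub>v x)" if x: "x \<in> carrier_vec d1" for x
    proof (cases "nsq (\<Phi> *\<^sub>v x) = 0")
      case True
      then show ?thesis by simp
    next
      case False
      have Kx: "K *\<^sub>v x \<in> carrier_vec r" using K x by simp
      have "s \<le> nsq (X\<^sup>T *\<^sub>v (U *\<^sub>v (K *\<^sub>v x))) / nsq (U *\<^sub>v (K *\<^sub>v x))"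
        unfolding s_def using False unfolding Px(1)[OF x] by (intro cInf_lower normalize Kx Qbd)
      then have "s \<le> nsq (X\<^sup>T *\<^sub>v x) / nsq (\<Phi> *\<^sub>v x)"
        unfolding Px(1)[OF x, symmetric] XTP[OF x] .
      moreover have "0 < nsq (\<Phi> *\<^sub>v x)" using False scalar_prod_self_nonneg[of "\<Phi> *\<^sub>v x"] by linarith
      ultimately show ?thesis by (simp only: pos_le_divide_eq)
    qed
    have G_le: "nsq (G\<^sup>T *\<^sub>v x) \<le> \<kappa>\<^sup>2 * (s * (x \<bullet> x - nsq (\<Phi> *\<^sub>v x)))" if x: "x \<in> carrier_vec d1" for x
    proof -
      note Pxc = Px(2)[OF x]
      \<comment> \<open>\<open>G\<^sup>T\<close> vanishes on the range of \<open>U\<close>, so only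
        the orthogonal part of \<open>x\<close> counts. The same orthogonality removes the cross
        term of the Hessian condition.\<close>
      define a where "a = x - \<Phi> *\<^sub>v x"
      have a: "a \<in> carrier_vec d1" unfolding a_def by (rule minus_carrier_vec[OF x Pxc])
      have PPx: "\<Phi> *\<^sub>v (\<Phi> *\<^sub>v x) = \<Phi> *\<^sub>v x" using assoc_mult_mat_vec[OF Pc(1) Pc(1) x] unfolding Pc(3) ..
      have aa: "a \<bullet> a = x \<bullet> x - nsq (\<Phi> *\<^sub>v x)"
      proof -
        have 1: "x \<bullet> (\<Phi> *\<^sub>v x) = nsq (\<Phi> *\<^sub>v x)"
          using scalar_prod_mult_mat_sym[OF Pc(1,2) x Pxc] unfolding PPx .
        have "a \<bullet> a = x \<bullet> a - (\<Phi> *\<^sub>v x) \<bullet> a" using minus_scalar_prod_distrib[OF x Pxc a] unfolding a_def .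
        also have "x \<bullet> a = x \<bullet> x - x \<bullet> (\<Phi> *\<^sub>v x)" unfolding a_def by (rule scalar_prod_minus_distrib[OF x x Pxc])
        also have "(\<Phi> *\<^sub>v x) \<bullet> a = (\<Phi> *\<^sub>v x) \<bullet> x - nsq (\<Phi> *\<^sub>v x)" unfolding a_def by (rule scalar_prod_minus_distrib[OF Pxc x Pxc])
        also have "(\<Phi> *\<^sub>v x) \<bullet> x = x \<bullet> (\<Phi> *\<^sub>v x)" by (rule comm_scalar_prod[OF Pxc x])
        finally show ?thesis using 1 by linarith
      qed
      have UTa: "U\<^sup>T *\<^sub>v a = 0\<^sub>v r"
      proof -
        have "U\<^sup>T *\<^sub>v (\<Phi> *\<^sub>v x) = U\<^sup>T *\<^sub>v x" using assoc_mult_mat_vec[OF UT Pc(1) x] unfolding UTP ..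
        moreover have "U\<^sup>T *\<^sub>v x \<in> carrier_vec r" using UT x by simp
        ultimately show ?thesis unfolding a_def mult_minus_distrib_mat_vec[OF UT x Pxc] by (simp only: minus_cancel_vec)
      qed
      define b where "b = G\<^sup>T *\<^sub>v a"
      have b: "b \<in> carrier_vec d2" using GT a by (simp add: b_def)
      have GTx: "G\<^sup>T *\<^sub>v x = b"
      proof -
        have Kx: "K *\<^sub>v x \<in> carrier_vec r" using K x by simp
        have "G\<^sup>T *\<^sub>v (\<Phi> *\<^sub>v x) = (G\<^sup>T * U) *\<^sub>v (K *\<^sub>v x)"
          unfolding Px(1)[OF x] by (rule assoc_mult_mat_vec[OF GT U Kx, symmetric])
        also have "\<dots> = 0\<^sub>v d2" unfolding GTU using Kx by (intro eq_vecI) auto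
        finally have 0: "G\<^sup>T *\<^sub>v (\<Phi> *\<^sub>v x) = 0\<^sub>v d2" .
        have "G\<^sup>T *\<^sub>v x \<in> carrier_vec d2" using GT x by simp
        then show ?thesis unfolding b_def a_def mult_minus_distrib_mat_vec[OF GT x Pxc] 0 by (intro eq_vecI) auto
      qed
      have aGb: "a \<bullet> (G *\<^sub>v b) = b \<bullet> b" using transpose_vec_mult_scalar[OF G b a] by (simp add: b_def)
      have Bq: "b \<bullet> b \<le> \<kappa>\<^sup>2 * ((a \<bullet> a) * q)" if q: "q \<in> Q" for q
      proof -
        obtain z where z: "z \<in> carrier_vec r" and Uz1: "nsq (U *\<^sub>v z) = 1"
          and qz: "q = nsq (X\<^sup>T *\<^sub>v (U *\<^sub>v z))" using q unfolding Q_def by blast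
        have Uz: "U *\<^sub>v z \<in> carrier_vec d1" using U z by simp
        \<comment> \<open>This choice gives \<open>V w = X\<^sup>T (U z)\<close> and
          \<open>w \<bullet> z = 1\<close>. Scaling \<open>a\<close> and \<open>b\<close>
          independently then turns the Hessian condition into a nonnegative binary quadratic
          form.\<close>
        define w where "w = U\<^sup>T *\<^sub>v (U *\<^sub>v z)"
        have w: "w \<in> carrier_vec r" using UT Uz by (simp add: w_def)
        have wz: "w \<bullet> z = 1" using transpose_vec_mult_scalar[OF U z Uz] Uz1 by (simp add: w_def)
        have Vw: "V *\<^sub>v w = X\<^sup>T *\<^sub>v (U *\<^sub>v z)" unfolding w_def XTx[OF Uz] ..
        have aUz: "a \<bullet> (U *\<^sub>v z) = 0" using transpose_vec_mult_scalar[OF U z a] UTa z by simp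
        have Gb: "G *\<^sub>v b \<in> carrier_vec d1" using G b by simp
        show ?thesis
        proof (rule quadratic_discriminant_bound[OF _ \<kappa>])
          fix \<sigma> \<tau> :: real
          have sa: "\<sigma> \<cdot>\<^sub>v a \<in> carrier_vec d1" and tb: "\<tau> \<cdot>\<^sub>v b \<in> carrier_vec d2" using a b by simp_all
          have 1: "(\<sigma> \<cdot>\<^sub>v a) \<bullet> (G *\<^sub>v (\<tau> \<cdot>\<^sub>v b)) = \<sigma> * \<tau> * (b \<bullet> b)"
            unfolding mult_mat_vec[OF G b] using a Gb aGb by simp
          have 2: "(\<sigma> \<cdot>\<^sub>v a) \<bullet> (U *\<^sub>v z) = 0" using a Uz aUz by simp
          have 3: "nsq (\<sigma> \<cdot>\<^sub>v a) = \<sigma>\<^sup>2 * (a \<bullet> a)" "nsq (\<tau> \<cdot>\<^sub>v b) = \<tau>\<^sup>2 * (b \<bullet> b)"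
            by (simp_all add: power2_eq_square)
          show "0 \<le> 2 * \<sigma> * \<tau> * (b \<bullet> b) + \<kappa> * (\<sigma>\<^sup>2 * ((a \<bullet> a) * q) + \<tau>\<^sup>2 * (b \<bullet> b))"
            using hess[OF sa tb w z] unfolding 1 2 3 wz Vw Uz1 qz[symmetric] by (simp add: mult.assoc)
        qed (simp_all add: qz)
      qed
      have "b \<bullet> b \<le> \<kappa>\<^sup>2 * (s * (a \<bullet> a))"
      proof (cases "a \<bullet> a = 0")
        case True
        obtain q where "q \<in> Q" using Qne by blast
        then show ?thesis using Bq[of q] True by simp
      next
        case False
        then have ap: "0 < a \<bullet> a" using scalar_prod_self_nonneg[of a] by linarith
        then have kp: "0 < \<kappa>\<^sup>2 * (a \<bullet> a)" using \<kappa> by simp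
        have "(b \<bullet> b) / (\<kappa>\<^sup>2 * (a \<bullet> a)) \<le> s" unfolding s_def
        proof (rule cInf_greatest[OF Qne])
          fix q assume "q \<in> Q"
          from Bq[OF this] show "(b \<bullet> b) / (\<kappa>\<^sup>2 * (a \<bullet> a)) \<le> q"
            unfolding pos_divide_le_eq[OF kp] by (simp add: mult_ac)
        qed
        then show ?thesis unfolding pos_divide_le_eq[OF kp] by (simp add: mult_ac)
      qed
      then show ?thesis unfolding GTx aa .
    qed
    \<comment> \<open>A gradient step of length \<open>1 / \<kappa>\<close>: after this scaling the
      bound on \<open>G\<close> says that \<open>N\<close> acts only off the range of
      \<open>\<Phi>\<close> and is no larger there than the least singular value of
      \<open>X\<close>.\<close>
    define N where "N = (- (1 / \<kappa>)) \<cdot>\<^sub>m G"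
    have N: "N \<in> carrier_mat d1 d2" using G by (simp add: N_def)
    have NT: "N\<^sup>T = (- (1 / \<kappa>)) \<cdot>\<^sub>m G\<^sup>T" unfolding N_def by (rule eq_matI) auto
    have N_le: "nsq (N\<^sup>T *\<^sub>v x) \<le> s * (x \<bullet> x - nsq (\<Phi> *\<^sub>v x))" if x: "x \<in> carrier_vec d1" for x
    proof -
      have "nsq (N\<^sup>T *\<^sub>v x) = (1 / \<kappa>\<^sup>2) * nsq (G\<^sup>T *\<^sub>v x)"
        unfolding NT smult_mult_mat_vec[OF GT x] by (simp add: power2_eq_square)
      also have "\<dots> \<le> (1 / \<kappa>\<^sup>2) * (\<kappa>\<^sup>2 * (s * (x \<bullet> x - nsq (\<Phi> *\<^sub>v x))))"
        by (intro mult_left_mono G_le x) simp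
      finally show ?thesis using \<kappa> by simp
    qed
    have PN: "\<Phi> * N = 0\<^sub>m d1 d2"
    proof -
      have "G\<^sup>T * \<Phi> = (G\<^sup>T * U) * K" unfolding PK by (rule assoc_mult_mat[OF GT U K, symmetric])
      also have "\<dots> = 0\<^sub>m d2 d1" unfolding GTU by (rule left_mult_zero_mat[OF K])
      finally have "(\<Phi> * G)\<^sup>T = 0\<^sub>m d2 d1" using transpose_mult[OF Pc(1) G] unfolding Pc(2) by simp
      then have "((\<Phi> * G)\<^sup>T)\<^sup>T = (0\<^sub>m d2 d1)\<^sup>T" by (rule arg_cong)
      then have "\<Phi> * G = 0\<^sub>m d1 d2" by simp
      then show ?thesis unfolding N_def mult_smult_distrib[OF Pc(1) G] by simp
    qed
    have XN: "X * N\<^sup>T = 0\<^sub>m d1 d1"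
    proof -
      have "X * G\<^sup>T = U * (V\<^sup>T * G\<^sup>T)" unfolding X_def by (rule assoc_mult_mat[OF U VT GT])
      also have "V\<^sup>T * G\<^sup>T = 0\<^sub>m r d1" using transpose_mult[OF G V] unfolding GV by simp
      also have "U * 0\<^sub>m r d1 = 0\<^sub>m d1 d1" by (rule right_mult_zero_mat[OF U])
      finally show ?thesis unfolding NT mult_smult_distrib[OF X GT] by simp
    qed
    have "0 \<le> frob_sq (X - Ms) + 2 * mtrace ((X - Ms) * N\<^sup>T)"
      by (rule low_rank_approximation[OF X N Ms P T PX PN XN X_ge N_le])
    also have "mtrace ((X - Ms) * N\<^sup>T) = - (1 / \<kappa>) * mtrace (G * E\<^sup>T)"
      unfolding mtrace_mult_transpose[OF G E] E_def[symmetric] mtrace_mult_transpose[OF E N]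
      unfolding sum_distrib_left using G by (intro sum.cong refl) (simp add: N_def)
    \<comment> \<open>Optimality of \<open>X\<close> gives
      \<open>2 <G, E> \<le> \<kappa> |E|^2\<close>, the lower isometry bound gives
      \<open>\<alpha> |E|^2 \<le> <G, E>\<close>, and \<open>\<kappa> < 2 \<alpha>\<close> leaves
      only \<open>E = 0\<close>.\<close>
    finally have "2 * mtrace (G * E\<^sup>T) \<le> \<kappa> * frob_sq E" using \<kappa> by (simp add: E_def field_simps)
    then have "(2 * \<alpha> - \<kappa>) * frob_sq E \<le> 0" using lower by (simp add: E_def X_def algebra_simps)
    then show ?thesis using \<alpha> by (simp add: mult_le_0_iff)
  qed
  then have "frob_sq E = 0" using frob_sq_nonneg[of E] by simp
  then have "X - Ms = 0\<^sub>m d1 d2" using frob_sq_eq_0[OF E] by (simp add: E_def)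
  then show ?thesis using minus_mat_eq_zero_iff[OF X Ms] by (simp add: X_def)
qed

text \<open>\<open>F\<close> is a maximal independent set of columns of \<open>X\<close>,
  \<open>H\<close> holds the coordinates of all columns, and \<open>Y\<close> is the 0-1 matrix
  selecting the chosen ones. The form \<open>F = X * Y\<close> later places the columns of
  \<open>F\<close> in the span of \<open>A\<close>.\<close>

lemma rank_factorization:
  fixes X :: "real mat"
  assumes X: "X \<in> carrier_mat n nc" and rk: "vec_space.rank n X = r"
  obtains F Y H where "F \<in> carrier_mat n r" "Y \<in> carrier_mat nc r" "H \<in> carrier_mat r nc" "X = F * H" "F = X * Y"
    "\<And>x. x \<in> carrier_vec r \<Longrightarrow> F *\<^sub>v x = 0\<^sub>v n \<Longrightarrow> x = 0\<^sub>v r"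
proof -
  interpret vec_space "TYPE(real)" n .
  let ?P = "\<lambda>T. T \<subseteq> set (cols X) \<and> lin_indpt T"
  have "lin_indpt {}" by (simp add: lin_dep_def)
  then obtain S where fin: "finite S" and mx: "maximal S ?P"
    using maximal_exists_superset[of "set (cols X)" ?P "{}"] by auto
  have S: "S \<subseteq> set (cols X)" "lin_indpt S" using mx by (auto simp: maximal_def)
  have cS: "card S = r" using rank_card_indpt[OF X mx] rk by simp
  obtain xs where xs: "set xs = S" "distinct xs" using finite_distinct_list[OF fin] by blast
  have lxs: "length xs = r" using distinct_card[OF xs(2)] xs(1) cS by simp
  have colsX: "set (cols X) \<subseteq> carrier_vec n" using cols_dim X by blast
  define F where "F = mat_of_cols n xs"
  have F: "F \<in> carrier_mat n r" using mat_of_cols_carrier(1)[of n xs] by (simp only: F_def lxs)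
  have xsc: "set xs \<subseteq> carrier_vec n" using xs S colsX by simp
  have colsF: "cols F = xs" unfolding F_def using xsc by (simp add: cols_mat_of_cols)
  have inj: "x = 0\<^sub>v r" if "x \<in> carrier_vec r" "F *\<^sub>v x = 0\<^sub>v n" for x
    using lin_depI[OF F that(1) _ that(2)] colsF xs S by auto
  have span: "\<exists>h\<in>carrier_vec r. F *\<^sub>v h = x" if x: "x \<in> set (cols X)" for x
  proof (cases "x \<in> S")
    case True
    then obtain k where k: "k < r" "xs ! k = x" using xs lxs by (metis in_set_conv_nth)
    have "F *\<^sub>v unit_vec r k = col F k" using F k(1) by (intro eq_vecI) auto
    also have "col F k = x" using k colsF F by (metis carrier_matD(2) cols_nth)
    finally show ?thesis using k by (intro bexI[of _ "unit_vec r k"]) auto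
  next
    case False
    \<comment> \<open>With \<open>x\<close> adjoined as column 0 the columns are dependent by
      maximality. The coefficient of \<open>x\<close> cannot vanish, since \<open>F\<close> is
      injective, so the relation can be solved for \<open>x\<close>.\<close>
    define F' where "F' = mat_of_cols n (x # xs)"
    have xc: "x \<in> carrier_vec n" using x colsX by blast
    have F': "F' \<in> carrier_mat n (Suc r)" using mat_of_cols_carrier[of n "x # xs"] by (simp add: F'_def lxs)
    have colsF': "cols F' = x # xs" unfolding F'_def using xsc xc by (subst cols_mat_of_cols) auto
    have "lin_dep (insert x S)"
    proof (rule ccontr)
      assume "\<not> lin_dep (insert x S)"
      then have "insert x S = S" using mx x S unfolding maximal_def by blast
      then show False using False by blast
    qed
    then have "lin_dep (set (cols F'))" using colsF' xs by simp
    moreover have "distinct (cols F')" using colsF' xs False by simp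
    ultimately obtain v where v: "v \<in> carrier_vec (Suc r)" "v \<noteq> 0\<^sub>v (Suc r)" "F' *\<^sub>v v = 0\<^sub>v n"
      using lin_depE[OF F'] by blast
    define v' where "v' = Matrix.vec r (\<lambda>i. v $ Suc i)"
    have v': "v' \<in> carrier_vec r" by (simp add: v'_def)
    have dec: "v $ 0 * x $ i + (F *\<^sub>v v') $ i = 0" if i: "i < n" for i
    proof -
      have "(F' *\<^sub>v v) $ i = (\<Sum>k<Suc r. F' $$ (i,k) * v $ k)"
        using F' v(1) i by (auto simp: scalar_prod_def lessThan_atLeast0)
      also have "\<dots> = x $ i * v $ 0 + (\<Sum>k<r. F' $$ (i, Suc k) * v $ Suc k)"
        using i by (simp add: sum.lessThan_Suc_shift F'_def mat_of_cols_def del: sum.lessThan_Suc)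
      also have "(\<Sum>k<r. F' $$ (i, Suc k) * v $ Suc k) = (F *\<^sub>v v') $ i"
        using F v' i lxs by (auto simp: scalar_prod_def lessThan_atLeast0 F'_def F_def v'_def mat_of_cols_def intro!: sum.cong)
      finally show ?thesis using v(3) i by (simp add: mult.commute)
    qed
    have Fv': "F *\<^sub>v v' \<in> carrier_vec n" using F v' by simp
    have v0: "v $ 0 \<noteq> 0"
    proof
      assume v0: "v $ 0 = 0"
      have "F *\<^sub>v v' = 0\<^sub>v n" using dec v0 F by (intro eq_vecI) auto
      then have "v' = 0\<^sub>v r" by (rule inj[OF v'])
      then have "v $ Suc i = 0" if "i < r" for i using that by (metis v'_def index_vec index_zero_vec(1))
      then have "v = 0\<^sub>v (Suc r)" using v(1) v0 by (intro eq_vecI) (auto simp: less_Suc_eq_0_disj)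
      then show False using v(2) by blast
    qed
    have "F *\<^sub>v ((- 1 / v $ 0) \<cdot>\<^sub>v v') = (- 1 / v $ 0) \<cdot>\<^sub>v (F *\<^sub>v v')" by (rule mult_mat_vec[OF F v'])
    also have "\<dots> = x"
    proof (rule eq_vecI)
      fix i assume i: "i < dim_vec x"
      then have "(F *\<^sub>v v') $ i = - (v $ 0 * x $ i)" using dec[of i] xc by simp
      then show "((- 1 / v $ 0) \<cdot>\<^sub>v (F *\<^sub>v v')) $ i = x $ i" using i xc F v0 by (simp del: index_mult_mat_vec)
    qed (use xc F in simp)
    finally show ?thesis using v' by (intro bexI[of _ "(- 1 / v $ 0) \<cdot>\<^sub>v v'"]) auto
  qed
  have colX: "col X j \<in> set (cols X)" if "j < nc" for j using that X by (simp add: cols_def)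
  have "\<forall>j\<in>{..<nc}. \<exists>h. h \<in> carrier_vec r \<and> F *\<^sub>v h = col X j" using span colX by blast
  from bchoice[OF this] obtain h where h: "\<And>j. j < nc \<Longrightarrow> h j \<in> carrier_vec r" "\<And>j. j < nc \<Longrightarrow> F *\<^sub>v h j = col X j"
    by auto
  define H where "H = Matrix.mat r nc (\<lambda>(i,j). h j $ i)"
  have H: "H \<in> carrier_mat r nc" by (simp add: H_def)
  have XFH: "X = F * H"
  proof (rule eq_matI)
    fix i j assume "i < dim_row (F * H)" "j < dim_col (F * H)"
    then have ij: "i < n" "j < nc" using F H by auto
    have "col H j = h j" using h(1)[OF ij(2)] ij by (intro eq_vecI) (auto simp: H_def)
    then have "(F * H) $$ (i,j) = (F *\<^sub>v h j) $ i" using F H ij by simp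
    then show "X $$ (i,j) = (F * H) $$ (i,j)" using h(2)[OF ij(2)] X ij by simp
  qed (use X F H in auto)
  have "\<forall>k\<in>{..<r}. \<exists>j. j < nc \<and> xs ! k = col X j"
  proof
    fix k assume "k \<in> {..<r}"
    then have "xs ! k \<in> set (cols X)" using S xs lxs nth_mem by (metis lessThan_iff subsetD)
    then show "\<exists>j. j < nc \<and> xs ! k = col X j" using X by (auto simp: cols_def)
  qed
  from bchoice[OF this] obtain c where c: "\<And>k. k < r \<Longrightarrow> c k < nc" "\<And>k. k < r \<Longrightarrow> xs ! k = col X (c k)" by auto
  define Y :: "real mat" where "Y = Matrix.mat nc r (\<lambda>(j,k). if j = c k then 1 else 0)"
  have Y: "Y \<in> carrier_mat nc r" by (simp add: Y_def)
  have FXY: "F = X * Y"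
  proof (rule eq_matI)
    fix i k assume "i < dim_row (X * Y)" "k < dim_col (X * Y)"
    then have ik: "i < n" "k < r" using X Y by auto
    have "col Y k = unit_vec nc (c k)" using ik c(1)[OF ik(2)] by (intro eq_vecI) (auto simp: Y_def)
    then have "(X * Y) $$ (i,k) = X $$ (i, c k)" using X Y ik c(1)[OF ik(2)] by simp
    then show "F $$ (i,k) = (X * Y) $$ (i,k)" using ik c X lxs by (simp add: F_def mat_of_cols_def)
  qed (use X Y F in auto)
  show ?thesis by (rule that[OF F Y H XFH FXY inj])
qed

section \<open>Derivatives of a factored least-squares objective\<close>

text \<open>The Frobenius inner product of \<open>C\<close> with \<open>P * Q\<^sup>T\<close>,
  spelled out as a polynomial in the entries so that linearity in each factor, and hence
  differentiation, is immediate.\<close>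

definition bilin :: "nat \<Rightarrow> real mat \<Rightarrow> real mat \<Rightarrow> real mat \<Rightarrow> real" where
  "bilin r C P Q = (\<Sum>k<dim_row C. \<Sum>l<dim_col C. \<Sum>q<r. C $$ (k,l) * P $$ (k,q) * Q $$ (l,q))"

lemma bilin_add_left:
  assumes "C \<in> carrier_mat d1 d2" "P \<in> carrier_mat d1 r" "P' \<in> carrier_mat d1 r"
  shows "bilin r C (P + t \<cdot>\<^sub>m P') Q = bilin r C P Q + t * bilin r C P' Q"
proof -
  have "bilin r C (P + t \<cdot>\<^sub>m P') Q = (\<Sum>k<d1. \<Sum>l<d2. \<Sum>q<r.
      C $$ (k,l) * P $$ (k,q) * Q $$ (l,q) + t * (C $$ (k,l) * P' $$ (k,q) * Q $$ (l,q)))"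
    unfolding bilin_def using assms by (intro sum.cong) (auto simp: distrib_left distrib_right)
  then show ?thesis using assms by (simp add: bilin_def sum.distrib sum_distrib_left)
qed

lemma bilin_add_right:
  assumes "C \<in> carrier_mat d1 d2" "Q \<in> carrier_mat d2 r" "Q' \<in> carrier_mat d2 r"
  shows "bilin r C P (Q + t \<cdot>\<^sub>m Q') = bilin r C P Q + t * bilin r C P Q'"
proof -
  have "bilin r C P (Q + t \<cdot>\<^sub>m Q') = (\<Sum>k<d1. \<Sum>l<d2. \<Sum>q<r.
      C $$ (k,l) * P $$ (k,q) * Q $$ (l,q) + t * (C $$ (k,l) * P $$ (k,q) * Q' $$ (l,q)))"
    unfolding bilin_def using assms by (intro sum.cong) (auto simp: distrib_left)
  then show ?thesis using assms by (simp add: bilin_def sum.distrib sum_distrib_left)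
qed

lemma bilin_sum_left:
  assumes C: "C \<in> carrier_mat d1 d2"
    and P: "\<And>k q. k < d1 \<Longrightarrow> q < r \<Longrightarrow> P $$ (k,q) = (\<Sum>p<m. x p * D p $$ (k,q))"
  shows "bilin r C P Q = (\<Sum>p<m. x p * bilin r C (D p) Q)"
proof -
  have "bilin r C P Q = (\<Sum>k<d1. \<Sum>l<d2. \<Sum>q<r. \<Sum>p<m. x p * (C $$ (k,l) * D p $$ (k,q) * Q $$ (l,q)))"
    using C P by (simp add: bilin_def sum_distrib_left sum_distrib_right mult_ac)
  also have "\<dots> = (\<Sum>k<d1. \<Sum>l<d2. \<Sum>p<m. \<Sum>q<r. x p * (C $$ (k,l) * D p $$ (k,q) * Q $$ (l,q)))"
    by (intro sum.cong refl sum.swap)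
  also have "\<dots> = (\<Sum>k<d1. \<Sum>p<m. \<Sum>l<d2. \<Sum>q<r. x p * (C $$ (k,l) * D p $$ (k,q) * Q $$ (l,q)))"
    by (intro sum.cong refl sum.swap)
  also have "\<dots> = (\<Sum>p<m. \<Sum>k<d1. \<Sum>l<d2. \<Sum>q<r. x p * (C $$ (k,l) * D p $$ (k,q) * Q $$ (l,q)))"
    by (rule sum.swap)
  also have "\<dots> = (\<Sum>p<m. x p * bilin r C (D p) Q)" using C by (simp add: bilin_def sum_distrib_left)
  finally show ?thesis .
qed

lemma bilin_transpose: "C \<in> carrier_mat d1 d2 \<Longrightarrow> bilin r C P Q = bilin r C\<^sup>T Q P"
  unfolding bilin_def by (subst sum.swap) (auto intro!: sum.cong)

lemma bilin_sum_right:
  assumes C: "C \<in> carrier_mat d1 d2"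
    and Q: "\<And>l q. l < d2 \<Longrightarrow> q < r \<Longrightarrow> Q $$ (l,q) = (\<Sum>p<m. x p * D p $$ (l,q))"
  shows "bilin r C P Q = (\<Sum>p<m. x p * bilin r C P (D p))"
proof -
  have CT: "C\<^sup>T \<in> carrier_mat d2 d1" using C by simp
  show ?thesis unfolding bilin_transpose[OF C] by (rule bilin_sum_left[OF CT Q])
qed

section \<open>Coordinates of the parameter space and the derivatives along them\<close>

lemma dirU_carrier [simp]: "dirU d1 r p \<in> carrier_mat d1 r"
  by (simp add: dirU_def)

lemma dirV_carrier [simp]: "dirV d1 d2 r p \<in> carrier_mat d2 r"
  by (simp add: dirV_def)

text \<open>The coordinates of the pair \<open>(P, Q)\<close> in the numbering used by
  \<open>dirU\<close> and \<open>dirV\<close>.\<close>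

definition param_coeff :: "nat \<Rightarrow> nat \<Rightarrow> real mat \<Rightarrow> real mat \<Rightarrow> nat \<Rightarrow> real" where
  "param_coeff d1 r P Q p = (if p < d1 * r then P $$ (p div r, p mod r)
     else Q $$ ((p - d1 * r) div r, (p - d1 * r) mod r))"

lemma mult_add_less: "k < d \<Longrightarrow> q < r \<Longrightarrow> k * r + q < d * (r::nat)"
proof -
  assume "k < d" "q < r"
  then have "k * r + q < k * r + r" by simp
  also have "\<dots> = Suc k * r" by simp
  also have "\<dots> \<le> d * r" using \<open>k < d\<close> by (intro mult_le_mono1) simp
  finally show ?thesis .
qed

lemma param_coeff_dirU:
  assumes "k < d1" "q < r"
  shows "P $$ (k,q) = (\<Sum>p<d1 * r + d2 * r. param_coeff d1 r P Q p * dirU d1 r p $$ (k,q))"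
proof -
  have lt: "k * r + q < d1 * r" using assms by (rule mult_add_less)
  have "dirU d1 r p $$ (k,q) = (if p = k * r + q then 1 else 0)" for p
  proof -
    have "(p < d1 * r \<and> k = p div r \<and> q = p mod r) \<longleftrightarrow> p = k * r + q"
    proof
      assume h: "p < d1 * r \<and> k = p div r \<and> q = p mod r"
      then show "p = k * r + q" using div_mult_mod_eq[of p r] by simp
    qed (use assms lt in simp)
    then show ?thesis using assms by (simp add: dirU_def)
  qed
  then have "(\<Sum>p<d1 * r + d2 * r. param_coeff d1 r P Q p * dirU d1 r p $$ (k,q)) =
    (\<Sum>p<d1 * r + d2 * r. if p = k * r + q then param_coeff d1 r P Q p else 0)"
    by (intro sum.cong) auto
  also have "\<dots> = param_coeff d1 r P Q (k * r + q)" using lt by (simp add: sum.delta)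
  also have "\<dots> = P $$ (k,q)" using lt assms by (simp add: param_coeff_def)
  finally show ?thesis by simp
qed

lemma param_coeff_dirV:
  assumes "l < d2" "q < r"
  shows "Q $$ (l,q) = (\<Sum>p<d1 * r + d2 * r. param_coeff d1 r P Q p * dirV d1 d2 r p $$ (l,q))"
proof -
  have lt: "l * r + q < d2 * r" using assms by (rule mult_add_less)
  have "dirV d1 d2 r p $$ (l,q) = (if p = d1 * r + (l * r + q) then 1 else 0)" for p
  proof -
    have "(d1 * r \<le> p \<and> l = (p - d1 * r) div r \<and> q = (p - d1 * r) mod r) \<longleftrightarrow> p = d1 * r + (l * r + q)"
    proof
      assume h: "d1 * r \<le> p \<and> l = (p - d1 * r) div r \<and> q = (p - d1 * r) mod r"
      then have "p - d1 * r = l * r + q" using div_mult_mod_eq[of "p - d1 * r" r] by simp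
      then show "p = d1 * r + (l * r + q)" using h by linarith
    qed (use assms in simp)
    then show ?thesis using assms by (simp add: dirV_def)
  qed
  then have "(\<Sum>p<d1 * r + d2 * r. param_coeff d1 r P Q p * dirV d1 d2 r p $$ (l,q)) =
    (\<Sum>p<d1 * r + d2 * r. if p = d1 * r + (l * r + q) then param_coeff d1 r P Q p else 0)"
    by (intro sum.cong) auto
  also have "\<dots> = param_coeff d1 r P Q (d1 * r + (l * r + q))" using lt by (simp add: sum.delta)
  also have "\<dots> = Q $$ (l,q)" using assms by (simp add: param_coeff_def)
  finally show ?thesis by simp
qed

text \<open>The measurements stay abstract: the derivative computations use only a finite sum of
  squared affine measurements of \<open>U * V\<^sup>T\<close>. The value of \<open>f\<close> is
  prescribed only for arguments of the right dimensions.\<close>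

locale factored_least_squares =
  fixes d1 d2 r :: nat and \<Omega> :: "'w set" and C :: "'w \<Rightarrow> real mat" and y :: "'w \<Rightarrow> real"
    and f :: "real mat \<Rightarrow> real mat \<Rightarrow> real"
  assumes finite_Omega: "finite \<Omega>"
    and C_carrier: "\<And>w. w \<in> \<Omega> \<Longrightarrow> C w \<in> carrier_mat d1 d2"
    and f_eq: "\<And>U V. U \<in> carrier_mat d1 r \<Longrightarrow> V \<in> carrier_mat d2 r \<Longrightarrow>
      f U V = (\<Sum>w\<in>\<Omega>. (bilin r (C w) U V - y w)\<^sup>2)"
begin

definition res :: "real mat \<Rightarrow> real mat \<Rightarrow> 'w \<Rightarrow> real" where
  "res U V w = bilin r (C w) U V - y w"

text \<open>The derivative of a measurement at \<open>(U, V)\<close> in the direction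
  \<open>(P, Q)\<close>.\<close>

definition lin :: "real mat \<Rightarrow> real mat \<Rightarrow> real mat \<Rightarrow> real mat \<Rightarrow> 'w \<Rightarrow> real" where
  "lin U V P Q w = bilin r (C w) P V + bilin r (C w) U Q"

lemma bilin_line:
  assumes "w \<in> \<Omega>" "U \<in> carrier_mat d1 r" "V \<in> carrier_mat d2 r" "P \<in> carrier_mat d1 r" "Q \<in> carrier_mat d2 r"
  shows "bilin r (C w) (U + t \<cdot>\<^sub>m P) (V + t \<cdot>\<^sub>m Q) = bilin r (C w) U V + t * lin U V P Q w + t\<^sup>2 * bilin r (C w) P Q"
  using assms bilin_add_left[OF C_carrier[OF assms(1)] assms(2,4)] bilin_add_right[OF C_carrier[OF assms(1)] assms(3,5)]
  by (simp add: lin_def power2_eq_square algebra_simps)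

lemma pderiv_eq:
  assumes U: "U \<in> carrier_mat d1 r" and V: "V \<in> carrier_mat d2 r"
  shows "pderiv_UV f d1 d2 r p U V = 2 * (\<Sum>w\<in>\<Omega>. res U V w * lin U V (dirU d1 r p) (dirV d1 d2 r p) w)"
proof -
  let ?P = "dirU d1 r p" and ?Q = "dirV d1 d2 r p"
  have eq: "f (U + t \<cdot>\<^sub>m ?P) (V + t \<cdot>\<^sub>m ?Q) = (\<Sum>w\<in>\<Omega>. (res U V w + t * lin U V ?P ?Q w + t\<^sup>2 * bilin r (C w) ?P ?Q)\<^sup>2)" for t
  proof -
    have "U + t \<cdot>\<^sub>m ?P \<in> carrier_mat d1 r" "V + t \<cdot>\<^sub>m ?Q \<in> carrier_mat d2 r" using U V by simp_all
    then have "f (U + t \<cdot>\<^sub>m ?P) (V + t \<cdot>\<^sub>m ?Q) = (\<Sum>w\<in>\<Omega>. (bilin r (C w) (U + t \<cdot>\<^sub>m ?P) (V + t \<cdot>\<^sub>m ?Q) - y w)\<^sup>2)"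
      by (rule f_eq)
    also have "\<dots> = (\<Sum>w\<in>\<Omega>. (res U V w + t * lin U V ?P ?Q w + t\<^sup>2 * bilin r (C w) ?P ?Q)\<^sup>2)"
      by (intro sum.cong refl) (simp add: bilin_line U V res_def algebra_simps)
    finally show ?thesis .
  qed
  have "((\<lambda>t. \<Sum>w\<in>\<Omega>. (res U V w + t * lin U V ?P ?Q w + t\<^sup>2 * bilin r (C w) ?P ?Q)\<^sup>2) has_real_derivative
      (\<Sum>w\<in>\<Omega>. 2 * (res U V w * lin U V ?P ?Q w))) (at 0)"
    by (rule DERIV_sum) (auto intro!: derivative_eq_intros)
  then show ?thesis unfolding pderiv_UV_def eq by (simp add: DERIV_imp_deriv sum_distrib_left)
qed

lemma hessian_entry:
  assumes U: "U \<in> carrier_mat d1 r" and V: "V \<in> carrier_mat d2 r"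
    and pq: "p < d1 * r + d2 * r" "q < d1 * r + d2 * r"
  shows "hessian_UV f d1 d2 r U V $$ (p,q) = 2 * (\<Sum>w\<in>\<Omega>.
    lin U V (dirU d1 r p) (dirV d1 d2 r p) w * lin U V (dirU d1 r q) (dirV d1 d2 r q) w
    + res U V w * (bilin r (C w) (dirU d1 r q) (dirV d1 d2 r p) + bilin r (C w) (dirU d1 r p) (dirV d1 d2 r q)))"
proof -
  let ?P = "dirU d1 r p" and ?Q = "dirV d1 d2 r p"
  let ?P' = "dirU d1 r q" and ?Q' = "dirV d1 d2 r q"
  let ?m = "\<lambda>w. bilin r (C w) ?P' ?Q + bilin r (C w) ?P ?Q'"
  \<comment> \<open>The gradient formula holds at every point of the right dimensions, so it may be
    substituted along the whole shifted line before the second derivative is taken.\<close>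
  have eq: "pderiv_UV f d1 d2 r q (U + s \<cdot>\<^sub>m ?P) (V + s \<cdot>\<^sub>m ?Q) = 2 * (\<Sum>w\<in>\<Omega>.
      (res U V w + s * lin U V ?P ?Q w + s\<^sup>2 * bilin r (C w) ?P ?Q) * (lin U V ?P' ?Q' w + s * ?m w))" for s
  proof -
    have "U + s \<cdot>\<^sub>m ?P \<in> carrier_mat d1 r" "V + s \<cdot>\<^sub>m ?Q \<in> carrier_mat d2 r" using U V by simp_all
    then have "pderiv_UV f d1 d2 r q (U + s \<cdot>\<^sub>m ?P) (V + s \<cdot>\<^sub>m ?Q) =
      2 * (\<Sum>w\<in>\<Omega>. res (U + s \<cdot>\<^sub>m ?P) (V + s \<cdot>\<^sub>m ?Q) w * lin (U + s \<cdot>\<^sub>m ?P) (V + s \<cdot>\<^sub>m ?Q) ?P' ?Q' w)"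
      by (rule pderiv_eq)
    moreover have "res (U + s \<cdot>\<^sub>m ?P) (V + s \<cdot>\<^sub>m ?Q) w = res U V w + s * lin U V ?P ?Q w + s\<^sup>2 * bilin r (C w) ?P ?Q"
      if "w \<in> \<Omega>" for w using bilin_line[OF that U V dirU_carrier dirV_carrier] by (simp add: res_def)
    moreover have "lin (U + s \<cdot>\<^sub>m ?P) (V + s \<cdot>\<^sub>m ?Q) ?P' ?Q' w = lin U V ?P' ?Q' w + s * ?m w" if "w \<in> \<Omega>" for w
      unfolding lin_def bilin_add_left[OF C_carrier[OF that] U dirU_carrier]
        bilin_add_right[OF C_carrier[OF that] V dirV_carrier] by (simp add: algebra_simps)
    ultimately show ?thesis by (simp cong: sum.cong)
  qed
  have "((\<lambda>s. 2 * (\<Sum>w\<in>\<Omega>. (res U V w + s * lin U V ?P ?Q w + s\<^sup>2 * bilin r (C w) ?P ?Q) * (lin U V ?P' ?Q' w + s * ?m w)))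
    has_real_derivative 2 * (\<Sum>w\<in>\<Omega>. lin U V ?P ?Q w * lin U V ?P' ?Q' w + res U V w * ?m w)) (at 0)"
    by (intro DERIV_cmult DERIV_sum) (auto intro!: derivative_eq_intros)
  then have "deriv (\<lambda>s. pderiv_UV f d1 d2 r q (U + s \<cdot>\<^sub>m ?P) (V + s \<cdot>\<^sub>m ?Q)) 0 =
     2 * (\<Sum>w\<in>\<Omega>. lin U V ?P ?Q w * lin U V ?P' ?Q' w + res U V w * ?m w)"
    unfolding eq by (rule DERIV_imp_deriv)
  then show ?thesis unfolding hessian_UV_def using pq by simp
qed

lemma lin_expand:
  assumes w: "w \<in> \<Omega>"
  shows "(\<Sum>p<d1 * r + d2 * r. param_coeff d1 r P Q p * lin U V (dirU d1 r p) (dirV d1 d2 r p) w) = lin U V P Q w"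
proof -
  let ?x = "param_coeff d1 r P Q" and ?D = "d1 * r + d2 * r"
  have "bilin r (C w) P V = (\<Sum>p<?D. ?x p * bilin r (C w) (dirU d1 r p) V)"
    by (rule bilin_sum_left[OF C_carrier[OF w] param_coeff_dirU])
  moreover have "bilin r (C w) U Q = (\<Sum>p<?D. ?x p * bilin r (C w) U (dirV d1 d2 r p))"
    by (rule bilin_sum_right[OF C_carrier[OF w] param_coeff_dirV])
  ultimately show ?thesis by (simp add: lin_def distrib_left sum.distrib)
qed

text \<open>Criticality is stated for unit directions only; linearity of \<open>lin\<close> in
  \<open>(P, Q)\<close> extends it to all directions.\<close>

lemma critical_point_gradient:
  assumes U: "U \<in> carrier_mat d1 r" and V: "V \<in> carrier_mat d2 r" and crit: "critical_point_UV f d1 d2 r U V"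
  shows "(\<Sum>w\<in>\<Omega>. res U V w * lin U V P Q w) = 0"
proof -
  let ?x = "param_coeff d1 r P Q" and ?D = "d1 * r + d2 * r"
  have "(\<Sum>w\<in>\<Omega>. res U V w * lin U V P Q w) =
    (\<Sum>w\<in>\<Omega>. res U V w * (\<Sum>p<?D. ?x p * lin U V (dirU d1 r p) (dirV d1 d2 r p) w))"
    by (intro sum.cong refl) (simp only: lin_expand)
  also have "\<dots> = (\<Sum>w\<in>\<Omega>. \<Sum>p<?D. ?x p * (res U V w * lin U V (dirU d1 r p) (dirV d1 d2 r p) w))"
    unfolding sum_distrib_left by (intro sum.cong refl) (simp only: mult_ac)
  also have "\<dots> = (\<Sum>p<?D. ?x p * (\<Sum>w\<in>\<Omega>. res U V w * lin U V (dirU d1 r p) (dirV d1 d2 r p) w))"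
    by (subst sum.swap) (simp only: sum_distrib_left)
  also have "\<dots> = (\<Sum>p<?D. ?x p * (pderiv_UV f d1 d2 r p U V / 2))" by (simp add: pderiv_eq[OF U V])
  also have "\<dots> = 0" using crit by (simp add: critical_point_UV_def)
  finally show ?thesis .
qed

text \<open>The second derivative along \<open>(P, Q)\<close>: the squared first-order change of
  each residual, plus the residual times twice the mixed term, which occurs once for each order of
  differentiating in \<open>U\<close> and \<open>V\<close>.\<close>

lemma hessian_quadratic_form:
  fixes P Q :: "real mat"
  assumes U: "U \<in> carrier_mat d1 r" and V: "V \<in> carrier_mat d2 r"
  defines "x \<equiv> Matrix.vec (d1 * r + d2 * r) (param_coeff d1 r P Q)"
  shows "x \<bullet> (hessian_UV f d1 d2 r U V *\<^sub>v x) =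
    2 * (\<Sum>w\<in>\<Omega>. (lin U V P Q w)\<^sup>2 + 2 * (res U V w * bilin r (C w) P Q))"
proof -
  let ?x = "param_coeff d1 r P Q" and ?D = "d1 * r + d2 * r"
  let ?l = "\<lambda>p w. lin U V (dirU d1 r p) (dirV d1 d2 r p) w"
  let ?b = "\<lambda>p q w. bilin r (C w) (dirU d1 r p) (dirV d1 d2 r q)"
  let ?t = "\<lambda>p q w. (?x p * ?l p w) * (?x q * ?l q w) + res U V w * (?x p * ?x q * ?b q p w + ?x p * ?x q * ?b p q w)"
  have b: "(\<Sum>p<?D. \<Sum>q<?D. ?x p * ?x q * ?b p q w) = bilin r (C w) P Q" if w: "w \<in> \<Omega>" for w
  proof -
    have "bilin r (C w) P Q = (\<Sum>p<?D. ?x p * bilin r (C w) (dirU d1 r p) Q)"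
      by (rule bilin_sum_left[OF C_carrier[OF w] param_coeff_dirU])
    also have "\<dots> = (\<Sum>p<?D. ?x p * (\<Sum>q<?D. ?x q * ?b p q w))"
      by (intro sum.cong refl arg_cong2[of _ _ _ _ "(*)"] bilin_sum_right[OF C_carrier[OF w] param_coeff_dirV])
    finally show ?thesis by (simp add: sum_distrib_left mult.assoc)
  qed
  have b': "(\<Sum>p<?D. \<Sum>q<?D. ?x p * ?x q * ?b q p w) = bilin r (C w) P Q" if w: "w \<in> \<Omega>" for w
    unfolding b[OF w, symmetric] by (subst sum.swap) (simp add: mult.commute)
  have "x \<bullet> (hessian_UV f d1 d2 r U V *\<^sub>v x) = (\<Sum>p<?D. ?x p * (\<Sum>q<?D. hessian_UV f d1 d2 r U V $$ (p,q) * ?x q))"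
    by (auto simp: x_def scalar_prod_def hessian_UV_def lessThan_atLeast0)
  also have "\<dots> = (\<Sum>p<?D. \<Sum>q<?D. 2 * (\<Sum>w\<in>\<Omega>. ?t p q w))"
  proof (intro sum.cong refl)
    fix p assume p: "p \<in> {..<?D}"
    have e: "?x p * (hessian_UV f d1 d2 r U V $$ (p,q) * ?x q) = 2 * (\<Sum>w\<in>\<Omega>. ?t p q w)" if q: "q < ?D" for q
    proof -
      have pd: "p < ?D" using p by simp
      have "?x p * (hessian_UV f d1 d2 r U V $$ (p,q) * ?x q) = 2 * (?x p * ?x q * (\<Sum>w\<in>\<Omega>.
        ?l p w * ?l q w + res U V w * (?b q p w + ?b p q w)))"
        unfolding hessian_entry[OF U V pd q] by (simp only: mult_ac)
      also have "?x p * ?x q * (\<Sum>w\<in>\<Omega>. ?l p w * ?l q w + res U V w * (?b q p w + ?b p q w)) =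
        (\<Sum>w\<in>\<Omega>. ?t p q w)"
        unfolding sum_distrib_left by (intro sum.cong refl) (simp only: distrib_left mult_ac)
      finally show ?thesis .
    qed
    show "?x p * (\<Sum>q<?D. hessian_UV f d1 d2 r U V $$ (p,q) * ?x q) = (\<Sum>q<?D. 2 * (\<Sum>w\<in>\<Omega>. ?t p q w))"
      unfolding sum_distrib_left[of "?x p"] using e by (intro sum.cong refl) simp
  qed
  also have "\<dots> = 2 * (\<Sum>p<?D. \<Sum>q<?D. \<Sum>w\<in>\<Omega>. ?t p q w)"
    by (simp only: sum_distrib_left)
  also have "(\<Sum>p<?D. \<Sum>q<?D. \<Sum>w\<in>\<Omega>. ?t p q w) =
    (\<Sum>p<?D. \<Sum>w\<in>\<Omega>. \<Sum>q<?D. ?t p q w)"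
    by (intro sum.cong refl sum.swap)
  also have "\<dots> = (\<Sum>w\<in>\<Omega>. \<Sum>p<?D. \<Sum>q<?D. ?t p q w)"
    by (rule sum.swap)
  also have "\<dots> = (\<Sum>w\<in>\<Omega>. (lin U V P Q w)\<^sup>2 + 2 * (res U V w * bilin r (C w) P Q))"
  proof (intro sum.cong refl)
    fix w assume w: "w \<in> \<Omega>"
    have "(\<Sum>p<?D. \<Sum>q<?D. ?t p q w) =
      (\<Sum>p<?D. ?x p * ?l p w) * (\<Sum>q<?D. ?x q * ?l q w) +
      res U V w * ((\<Sum>p<?D. \<Sum>q<?D. ?x p * ?x q * ?b q p w) + (\<Sum>p<?D. \<Sum>q<?D. ?x p * ?x q * ?b p q w))"
      unfolding sum_product by (simp add: sum.distrib sum_distrib_left distrib_left)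
    also have "\<dots> = (lin U V P Q w)\<^sup>2 + 2 * (res U V w * bilin r (C w) P Q)"
      unfolding lin_expand[OF w] b[OF w] b'[OF w] by (simp add: power2_eq_square)
    finally show "(\<Sum>p<?D. \<Sum>q<?D. ?t p q w) =
      (lin U V P Q w)\<^sup>2 + 2 * (res U V w * bilin r (C w) P Q)" .
  qed
  finally show ?thesis .
qed

text \<open>The Hessian is symmetric, so a direction of negative curvature would produce a negative
  eigenvalue, that is, a strict saddle.\<close>

lemma non_strict_saddle_hessian:
  assumes U: "U \<in> carrier_mat d1 r" and V: "V \<in> carrier_mat d2 r" and ns: "\<not> strict_saddle_UV f d1 d2 r U V"
  shows "0 \<le> (\<Sum>w\<in>\<Omega>. (lin U V P Q w)\<^sup>2 + 2 * (res U V w * bilin r (C w) P Q))"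
proof (rule ccontr)
  assume neg: "\<not> ?thesis"
  let ?D = "d1 * r + d2 * r" and ?H = "hessian_UV f d1 d2 r U V"
  have H: "?H \<in> carrier_mat ?D ?D" by (simp add: hessian_UV_def)
  have sym: "?H\<^sup>T = ?H"
  proof (rule eq_matI)
    fix p q assume "p < dim_row ?H" "q < dim_col ?H"
    then have pq: "p < ?D" "q < ?D" using H by auto
    then have "?H\<^sup>T $$ (p,q) = ?H $$ (q,p)" using H by simp
    also have "\<dots> = ?H $$ (p,q)"
      unfolding hessian_entry[OF U V pq] hessian_entry[OF U V pq(2,1)]
      by (simp add: mult.commute add.commute)
    finally show "?H\<^sup>T $$ (p,q) = ?H $$ (p,q)" .
  qed (use H in auto)
  let ?x = "Matrix.vec ?D (param_coeff d1 r P Q)"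
  have "?x \<bullet> (?H *\<^sub>v ?x) < 0" unfolding hessian_quadratic_form[OF U V] using neg by simp
  from negative_eigenvalue_exists[OF H sym _ this] show False
    using ns by (simp add: strict_saddle_UV_def)
qed

end

section \<open>Measurements of the completion problem\<close>

lemma sum_div_mod_eq:
  fixes f :: "nat \<Rightarrow> nat \<Rightarrow> real"
  shows "(\<Sum>t<d1 * d2. f (t div d2) (t mod d2)) = (\<Sum>k<d1. \<Sum>l<d2. f k l)"
proof -
  have "(\<Sum>t<d1 * d2. f (t div d2) (t mod d2)) = (\<Sum>(k,l)\<in>{..<d1} \<times> {..<d2}. f k l)"
  proof (rule sum.reindex_bij_witness[where i = "\<lambda>(k,l). k * d2 + l" and j = "\<lambda>t. (t div d2, t mod d2)"])
    fix t assume t: "t \<in> {..<d1 * d2}"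
    then have "0 < d2" by (cases d2) auto
    then show "(t div d2, t mod d2) \<in> {..<d1} \<times> {..<d2}"
      using t by (auto simp: less_mult_imp_div_less)
  qed (auto intro: mult_add_less)
  then show ?thesis by (simp add: sum.cartesian_product)
qed

text \<open>Row-major vectorization. Frobenius inner products become scalar products, so the frame
  results apply in dimension \<open>d1 * d2\<close>.\<close>

definition flat :: "real mat \<Rightarrow> real vec" where
  "flat M = Matrix.vec (dim_row M * dim_col M) (\<lambda>t. M $$ (t div dim_col M, t mod dim_col M))"

lemma flat_carrier: "M \<in> carrier_mat d1 d2 \<Longrightarrow> flat M \<in> carrier_vec (d1 * d2)"
  by (simp add: flat_def)

lemma flat_scalar_prod:
  assumes "M \<in> carrier_mat d1 d2" "N \<in> carrier_mat d1 d2"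
  shows "flat M \<bullet> flat N = mtrace (M * N\<^sup>T)"
proof -
  have "flat M \<bullet> flat N = (\<Sum>t<d1 * d2. M $$ (t div d2, t mod d2) * N $$ (t div d2, t mod d2))"
    using assms by (simp add: flat_def scalar_prod_def lessThan_atLeast0)
  also have "\<dots> = mtrace (M * N\<^sup>T)"
    using sum_div_mod_eq[of "\<lambda>k l. M $$ (k,l) * N $$ (k,l)" d2 d1] assms by (simp add: mtrace_mult_transpose)
  finally show ?thesis .
qed

definition coef :: "real mat \<Rightarrow> real mat \<Rightarrow> nat \<times> nat \<Rightarrow> real mat" where
  "coef A B w = Matrix.mat (dim_col A) (dim_col B) (\<lambda>(k,l). A $$ (fst w, k) * B $$ (snd w, l))"

lemma coef_carrier: "A \<in> carrier_mat n1 d1 \<Longrightarrow> B \<in> carrier_mat n2 d2 \<Longrightarrow> coef A B w \<in> carrier_mat d1 d2"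
  by (simp add: coef_def)

lemma measurement_eq:
  assumes A: "A \<in> carrier_mat n1 d1" and B: "B \<in> carrier_mat n2 d2" and M: "M \<in> carrier_mat d1 d2"
    and w: "fst w < n1" "snd w < n2"
  shows "(A * M * B\<^sup>T) $$ w = mtrace (coef A B w * M\<^sup>T)"
proof -
  have AM: "A * M \<in> carrier_mat n1 d2" by (rule mult_carrier_mat[OF A M])
  have BT: "B\<^sup>T \<in> carrier_mat d2 n2" using B by simp
  have "(A * M * B\<^sup>T) $$ (fst w, snd w) = (\<Sum>l<d2. (A * M) $$ (fst w, l) * B\<^sup>T $$ (l, snd w))"
    by (rule index_mult_mat_sum[OF AM BT w])
  also have "\<dots> = (\<Sum>l<d2. (\<Sum>k<d1. A $$ (fst w, k) * M $$ (k, l)) * B $$ (snd w, l))"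
    using index_mult_mat_sum[OF A M w(1)] B w by (intro sum.cong refl) simp
  also have "\<dots> = (\<Sum>k<d1. \<Sum>l<d2. A $$ (fst w, k) * B $$ (snd w, l) * M $$ (k, l))"
    by (subst sum.swap) (simp add: sum_distrib_left sum_distrib_right mult_ac)
  also have "\<dots> = mtrace (coef A B w * M\<^sup>T)"
    unfolding mtrace_mult_transpose[OF coef_carrier[OF A B] M] using A B by (simp add: coef_def)
  finally show ?thesis by simp
qed

lemma bilin_eq_mtrace:
  assumes C: "C \<in> carrier_mat d1 d2" and P: "P \<in> carrier_mat d1 r" and Q: "Q \<in> carrier_mat d2 r"
  shows "bilin r C P Q = mtrace (C * (P * Q\<^sup>T)\<^sup>T)"
proof -
  have QT: "Q\<^sup>T \<in> carrier_mat r d2" using Q by simp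
  have PQ: "P * Q\<^sup>T \<in> carrier_mat d1 d2" by (rule mult_carrier_mat[OF P QT])
  show ?thesis unfolding mtrace_mult_transpose[OF C PQ] bilin_def
    using C Q by (auto simp: index_mult_mat_sum[OF P QT] sum_distrib_left mult_ac simp del: index_mult_mat intro!: sum.cong)
qed

lemma bilin_eq_mtrace':
  assumes C: "C \<in> carrier_mat d1 d2" and P: "P \<in> carrier_mat d1 r" and Q: "Q \<in> carrier_mat d2 r"
  shows "bilin r C P Q = mtrace (C * Q * P\<^sup>T)"
proof -
  have QT: "Q\<^sup>T \<in> carrier_mat r d2" and PT: "P\<^sup>T \<in> carrier_mat r d1" using P Q by simp_all
  have "(P * Q\<^sup>T)\<^sup>T = Q * P\<^sup>T" using transpose_mult[OF P QT] by simp
  then show ?thesis unfolding bilin_eq_mtrace[OF C P Q] assoc_mult_mat[OF C Q PT] by simp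
qed

lemma isometry_columns:
  assumes "isometry A" "A \<in> carrier_mat n d" "k < d" "k' < d"
  shows "(\<Sum>i<n. A $$ (i,k) * A $$ (i,k')) = (if k = k' then 1 else 0)"
proof -
  have AT: "A\<^sup>T \<in> carrier_mat d n" using assms by simp
  have "(A\<^sup>T * A) $$ (k,k') = (\<Sum>i<n. A\<^sup>T $$ (k,i) * A $$ (i,k'))"
    by (rule index_mult_mat_sum[OF AT assms(2-4)])
  also have "A\<^sup>T * A = 1\<^sub>m d" using assms by (simp add: isometry_def)
  finally show ?thesis using assms by simp
qed

lemma frob_sq_isometry:
  assumes "isometry A" "A \<in> carrier_mat n d"
  shows "frob_sq A = d"
proof -
  have "frob_sq A = (\<Sum>k<d. \<Sum>i<n. A $$ (i,k) * A $$ (i,k))"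
    using assms by (simp add: frob_sq_def power2_eq_square) (rule sum.swap)
  also have "\<dots> = d" using isometry_columns[OF assms] by simp
  finally show ?thesis .
qed

lemma incoherent_row_bound:
  assumes "incoherent_isometry \<mu> A" "A \<in> carrier_mat n d" "i < n"
  shows "(\<Sum>k<d. (A $$ (i,k))\<^sup>2) \<le> \<mu> * d / n"
proof -
  have "sqrt (\<Sum>k<d. (A $$ (i,k))\<^sup>2) \<le> norm_2inf A"
    unfolding norm_2inf_def using assms by (intro Max_ge) auto
  also have "\<dots> \<le> sqrt (\<mu> * d / n)" using assms by (simp add: incoherent_isometry_def)
  finally show ?thesis by simp
qed

text \<open>The squared row norms of an isometry sum to \<open>d\<close>, so their average is
  \<open>d / n\<close> and the largest is no smaller. In the final proof this makes the frame bound
  \<open>L\<close> positive.\<close>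

lemma incoherence_ge_1:
  assumes "incoherent_isometry \<mu> A" "A \<in> carrier_mat n d" "0 < d" "0 < n"
  shows "1 \<le> \<mu>"
proof -
  have "real d = (\<Sum>i<n. \<Sum>k<d. (A $$ (i,k))\<^sup>2)"
    using frob_sq_isometry[of A n d] assms by (simp add: incoherent_isometry_def frob_sq_def)
  also have "\<dots> \<le> (\<Sum>i<n. \<mu> * d / n)" using incoherent_row_bound[OF assms(1,2)] by (intro sum_mono) auto
  also have "\<dots> = \<mu> * d" using assms by simp
  finally show ?thesis using assms by simp
qed

text \<open>Over the product index set each entry factors into an inner product of columns of
  \<open>A\<close> and one of columns of \<open>B\<close>, and both families are
  orthonormal.\<close>

lemma coef_frame_isotropic:
  assumes A: "A \<in> carrier_mat n1 d1" "isometry A" and B: "B \<in> carrier_mat n2 d2" "isometry B"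
  shows "frame_op (d1 * d2) (\<lambda>w. flat (coef A B w)) ({..<n1} \<times> {..<n2}) = 1\<^sub>m (d1 * d2)"
proof (rule eq_matI)
  fix t t' assume "t < dim_row (1\<^sub>m (d1 * d2) :: real mat)" "t' < dim_col (1\<^sub>m (d1 * d2) :: real mat)"
  then have t: "t < d1 * d2" "t' < d1 * d2" by auto
  then have d2: "0 < d2" by (cases d2) auto
  define k l k' l' where "k = t div d2" and "l = t mod d2" and "k' = t' div d2" and "l' = t' mod d2"
  have kl: "k < d1" "l < d2" "k' < d1" "l' < d2"
    using t d2 by (auto simp: k_def l_def k'_def l'_def less_mult_imp_div_less)
  have c: "flat (coef A B w) $ s = A $$ (fst w, s div d2) * B $$ (snd w, s mod d2)" if "s < d1 * d2" for w s
    using that A B d2 by (simp add: flat_def coef_def less_mult_imp_div_less)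
  have "frame_op (d1 * d2) (\<lambda>w. flat (coef A B w)) ({..<n1} \<times> {..<n2}) $$ (t,t') =
      (\<Sum>w\<in>{..<n1} \<times> {..<n2}. (A $$ (fst w, k) * A $$ (fst w, k')) * (B $$ (snd w, l) * B $$ (snd w, l')))"
    using t by (simp add: frame_op_def c k_def l_def k'_def l'_def mult_ac)
  also have "\<dots> = (\<Sum>i<n1. A $$ (i, k) * A $$ (i, k')) * (\<Sum>j<n2. B $$ (j, l) * B $$ (j, l'))"
    by (simp add: sum_product sum.cartesian_product case_prod_unfold)
  also have "\<dots> = (if k = k' then 1 else 0) * (if l = l' then 1 else 0)"
    using isometry_columns[OF A(2,1) kl(1,3)] isometry_columns[OF B(2,1) kl(2,4)] by simp
  also have "\<dots> = (if t = t' then 1 else 0)"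
  proof -
    have "t = t' \<longleftrightarrow> k = k' \<and> l = l'" unfolding k_def l_def k'_def l'_def by (metis div_mult_mod_eq)
    then show ?thesis by simp
  qed
  finally show "frame_op (d1 * d2) (\<lambda>w. flat (coef A B w)) ({..<n1} \<times> {..<n2}) $$ (t,t') = 1\<^sub>m (d1 * d2) $$ (t,t')"
    using t by simp
qed (auto simp: frame_op_def)

lemma coef_norm_bound:
  assumes A: "A \<in> carrier_mat n1 d1" "incoherent_isometry \<mu> A" and B: "B \<in> carrier_mat n2 d2" "incoherent_isometry \<mu> B"
    and w: "w \<in> {..<n1} \<times> {..<n2}" and \<mu>: "0 \<le> \<mu>"
  shows "flat (coef A B w) \<bullet> flat (coef A B w) \<le> \<mu>\<^sup>2 * (real d1 * real d2) / (real n1 * real n2)"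
proof -
  have "flat (coef A B w) \<bullet> flat (coef A B w) = (\<Sum>k<d1. (A $$ (fst w, k))\<^sup>2) * (\<Sum>l<d2. (B $$ (snd w, l))\<^sup>2)"
    unfolding flat_scalar_prod[OF coef_carrier[OF A(1) B(1)] coef_carrier[OF A(1) B(1)]]
      mtrace_mult_transpose[OF coef_carrier[OF A(1) B(1)] coef_carrier[OF A(1) B(1)]] sum_product
    using A B by (intro sum.cong refl) (simp add: coef_def power2_eq_square)
  also have "\<dots> \<le> (\<mu> * d1 / n1) * (\<mu> * d2 / n2)"
    using incoherent_row_bound[OF A(2,1)] incoherent_row_bound[OF B(2,1)] w \<mu>
    by (intro mult_mono) (auto intro: sum_nonneg)
  also have "\<dots> = \<mu>\<^sup>2 * (real d1 * real d2) / (real n1 * real n2)" by (simp add: power2_eq_square)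
  finally show ?thesis .
qed

section \<open>Rank-one directions and the landscape of a well-sampled objective\<close>

definition outer :: "real vec \<Rightarrow> real vec \<Rightarrow> real mat" where
  "outer a b = Matrix.mat (dim_vec a) (dim_vec b) (\<lambda>(i,j). a $ i * b $ j)"

lemma outer_carrier: "a \<in> carrier_vec m \<Longrightarrow> b \<in> carrier_vec n \<Longrightarrow> outer a b \<in> carrier_mat m n"
  by (auto simp: outer_def)

lemma outer_mult_transpose:
  assumes a: "a \<in> carrier_vec d1" and w: "w \<in> carrier_vec r" and V: "V \<in> carrier_mat d2 r"
  shows "outer a w * V\<^sup>T = outer a (V *\<^sub>v w)"
  using assms by (intro eq_matI)
    (auto simp: outer_def scalar_prod_def sum_distrib_left mult_ac intro!: sum.cong)

lemma mult_outer_transpose: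
  assumes b: "b \<in> carrier_vec d2" and z: "z \<in> carrier_vec r" and U: "U \<in> carrier_mat d1 r"
  shows "U * (outer b z)\<^sup>T = outer (U *\<^sub>v z) b"
  using assms by (intro eq_matI)
    (auto simp: outer_def scalar_prod_def sum_distrib_left sum_distrib_right mult_ac intro!: sum.cong)

lemma mtrace_outer_outer:
  assumes "a \<in> carrier_vec m" "b \<in> carrier_vec n" "a' \<in> carrier_vec m" "b' \<in> carrier_vec n"
  shows "mtrace (outer a b * (outer a' b')\<^sup>T) = (a \<bullet> a') * (b \<bullet> b')"
  unfolding mtrace_mult_transpose[OF outer_carrier[OF assms(1,2)] outer_carrier[OF assms(3,4)]]
  using assms by (auto simp: scalar_prod_def lessThan_atLeast0 sum_product outer_def intro!: sum.cong)

lemma mtrace_mult_outer: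
  assumes G: "G \<in> carrier_mat m n" and a: "a \<in> carrier_vec m" and b: "b \<in> carrier_vec n"
  shows "mtrace (G * (outer a b)\<^sup>T) = a \<bullet> (G *\<^sub>v b)"
  unfolding mtrace_mult_transpose[OF G outer_carrier[OF a b]]
  using assms by (auto simp: scalar_prod_def lessThan_atLeast0 sum_distrib_left outer_def mult_ac intro!: sum.cong)

text \<open>Isometry with tolerance 1/4 supplies the constants \<open>5/4 * p\<close> and
  \<open>3/4 * p\<close> of the deterministic argument, and \<open>5/4 < 2 * 3/4\<close>.\<close>

lemma benign_landscape:
  fixes A B Xs :: "real mat"
  assumes A: "A \<in> carrier_mat n1 d1" "isometry A" and B: "B \<in> carrier_mat n2 d2" "isometry B"
    and Xs: "Xs \<in> carrier_mat n1 n2" "vec_space.rank n1 Xs = r" and r: "0 < r"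
    and W1: "W1 \<in> carrier_mat d1 n2" "Xs = A * W1" and W2: "W2 \<in> carrier_mat n1 d2" "Xs = W2 * B\<^sup>T"
    and \<Omega>: "\<Omega> \<subseteq> {..<n1} \<times> {..<n2}" and p: "0 < p"
    and RIP: "\<And>M. M \<in> carrier_mat d1 d2 \<Longrightarrow>
      \<bar>(\<Sum>w\<in>\<Omega>. (mtrace (coef A B w * M\<^sup>T))\<^sup>2) - p * frob_sq M\<bar> \<le> p / 4 * frob_sq M"
    and U: "U \<in> carrier_mat d1 r" and V: "V \<in> carrier_mat d2 r"
    and crit: "critical_point_UV (g_obj A B \<Omega> (P_Omega \<Omega> Xs)) d1 d2 r U V"
    and ns: "\<not> strict_saddle_UV (g_obj A B \<Omega> (P_Omega \<Omega> Xs)) d1 d2 r U V"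
  shows "global_min_UV (g_obj A B \<Omega> (P_Omega \<Omega> Xs)) d1 d2 r U V \<and> U * V\<^sup>T = A\<^sup>T * Xs * B"
proof -
  let ?f = "g_obj A B \<Omega> (P_Omega \<Omega> Xs)"
  let ?C = "coef A B"
  have fin: "finite \<Omega>" using \<Omega> finite_subset by blast
  have AT: "A\<^sup>T \<in> carrier_mat d1 n1" and BT: "B\<^sup>T \<in> carrier_mat d2 n2" using A B by simp_all
  have AA: "A\<^sup>T * A = 1\<^sub>m d1" and BB: "B\<^sup>T * B = 1\<^sub>m d2" using A B by (simp_all add: isometry_def)
  define Ms where "Ms = A\<^sup>T * Xs * B"
  have ATX: "A\<^sup>T * Xs \<in> carrier_mat d1 n2" by (rule mult_carrier_mat[OF AT Xs(1)])
  have Ms: "Ms \<in> carrier_mat d1 d2" unfolding Ms_def by (rule mult_carrier_mat[OF ATX B(1)])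
  \<comment> \<open>The factor \<open>W1\<close> expresses that the columns lie in the span of
    \<open>A\<close>, on which \<open>A * A\<^sup>T\<close> acts as the identity.\<close>
  have AATX: "A * (A\<^sup>T * Xs) = Xs"
  proof -
    have "A\<^sup>T * Xs = W1" unfolding W1(2) assoc_mult_mat[OF AT A(1) W1(1), symmetric] AA by (rule left_mult_one_mat[OF W1(1)])
    then show ?thesis using W1(2) by simp
  qed
  have XBBT: "Xs * B * B\<^sup>T = Xs"
  proof -
    have "Xs * B = W2" unfolding W2(2) assoc_mult_mat[OF W2(1) BT B(1)] BB by (rule right_mult_one_mat[OF W2(1)])
    then show ?thesis using W2(2) by simp
  qed
  have XsMs: "A * Ms * B\<^sup>T = Xs"
  proof -
    have "A * Ms = A * (A\<^sup>T * Xs) * B" unfolding Ms_def by (rule assoc_mult_mat[OF A(1) ATX B(1), symmetric])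
    then show ?thesis using XBBT by (simp only: AATX)
  qed
  have meas: "(A * M * B\<^sup>T) $$ w = mtrace (?C w * M\<^sup>T)" if "M \<in> carrier_mat d1 d2" "w \<in> \<Omega>" for M w
    using that(2) \<Omega> by (intro measurement_eq[OF A(1) B(1) that(1)]) auto
  have Cc: "?C w \<in> carrier_mat d1 d2" for w by (rule coef_carrier[OF A(1) B(1)])
  have f_eq: "?f P Q = (\<Sum>w\<in>\<Omega>. (bilin r (?C w) P Q - Xs $$ w)\<^sup>2)"
    if P: "P \<in> carrier_mat d1 r" and Q: "Q \<in> carrier_mat d2 r" for P Q
  proof -
    have QT: "Q\<^sup>T \<in> carrier_mat r d2" using Q by simp
    have PQ: "P * Q\<^sup>T \<in> carrier_mat d1 d2" by (rule mult_carrier_mat[OF P QT])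
    have as: "A * P * Q\<^sup>T * B\<^sup>T = A * (P * Q\<^sup>T) * B\<^sup>T" unfolding assoc_mult_mat[OF A(1) P QT] ..
    have APQ: "A * (P * Q\<^sup>T) * B\<^sup>T \<in> carrier_mat n1 n2"
      by (rule mult_carrier_mat[OF mult_carrier_mat[OF A(1) PQ] BT])
    define Z where "Z = A * (P * Q\<^sup>T) * B\<^sup>T"
    have Z: "Z \<in> carrier_mat n1 n2" using APQ by (simp add: Z_def)
    have "?f P Q = (\<Sum>i<n1. \<Sum>j<n2. (if (i,j) \<in> \<Omega> then (Z $$ (i,j) - Xs $$ (i,j))\<^sup>2 else 0))"
      unfolding g_obj_def as Z_def[symmetric] frob_sq_def P_Omega_def using Z Xs(1)
      by (auto intro!: sum.cong)
    also have "\<dots> = (\<Sum>w\<in>{..<n1} \<times> {..<n2}. (if w \<in> \<Omega> then (Z $$ w - Xs $$ w)\<^sup>2 else 0))"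
      unfolding sum.cartesian_product by (intro sum.cong refl) auto
    also have "\<dots> = (\<Sum>w\<in>\<Omega>. (Z $$ w - Xs $$ w)\<^sup>2)"
      using \<Omega> by (subst sum.inter_restrict[symmetric]) (simp_all add: Int_absorb1)
    also have "\<dots> = (\<Sum>w\<in>\<Omega>. (bilin r (?C w) P Q - Xs $$ w)\<^sup>2)"
      using meas[OF PQ] bilin_eq_mtrace[OF Cc P Q] by (intro sum.cong refl) (simp add: Z_def)
    finally show ?thesis .
  qed
  interpret L: factored_least_squares d1 d2 r \<Omega> ?C "\<lambda>w. Xs $$ w" ?f
    by unfold_locales (use fin Cc f_eq in auto)
  have VT: "V\<^sup>T \<in> carrier_mat r d2" using V by simp
  have UVT: "U * V\<^sup>T \<in> carrier_mat d1 d2" by (rule mult_carrier_mat[OF U VT])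
  define E where "E = U * V\<^sup>T - Ms"
  have E: "E \<in> carrier_mat d1 d2" unfolding E_def by (rule minus_carrier_mat[OF Ms])
  have res: "L.res U V w = mtrace (?C w * E\<^sup>T)" if w: "w \<in> \<Omega>" for w
  proof -
    have "Xs $$ w = mtrace (?C w * Ms\<^sup>T)" using meas[OF Ms w] unfolding XsMs .
    then have "L.res U V w = mtrace (?C w * (U * V\<^sup>T)\<^sup>T) - mtrace (?C w * Ms\<^sup>T)"
      by (simp add: L.res_def bilin_eq_mtrace[OF Cc U V])
    also have "\<dots> = mtrace (?C w * E\<^sup>T)"
      unfolding mtrace_mult_transpose[OF Cc UVT] mtrace_mult_transpose[OF Cc Ms] mtrace_mult_transpose[OF Cc E]
        sum_subtractf[symmetric]
      using UVT Ms by (intro sum.cong refl) (simp add: E_def right_diff_distrib del: index_mult_mat)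
    finally show ?thesis .
  qed
  \<comment> \<open>Half the gradient with respect to \<open>U * V\<^sup>T\<close>.\<close>
  define G where "G = Matrix.mat d1 d2 (\<lambda>(k,l). \<Sum>w\<in>\<Omega>. L.res U V w * ?C w $$ (k,l))"
  have G: "G \<in> carrier_mat d1 d2" by (simp add: G_def)
  have GT: "G\<^sup>T \<in> carrier_mat d2 d1" using G by simp
  have G_mtrace: "mtrace (G * M\<^sup>T) = (\<Sum>w\<in>\<Omega>. L.res U V w * mtrace (?C w * M\<^sup>T))" if M: "M \<in> carrier_mat d1 d2" for M
  proof -
    have "mtrace (G * M\<^sup>T) = (\<Sum>k<d1. \<Sum>l<d2. \<Sum>w\<in>\<Omega>. L.res U V w * (?C w $$ (k,l) * M $$ (k,l)))"
      unfolding mtrace_mult_transpose[OF G M] by (simp add: G_def sum_distrib_right mult.assoc)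
    also have "\<dots> = (\<Sum>k<d1. \<Sum>w\<in>\<Omega>. \<Sum>l<d2. L.res U V w * (?C w $$ (k,l) * M $$ (k,l)))"
      by (intro sum.cong refl sum.swap)
    also have "\<dots> = (\<Sum>w\<in>\<Omega>. \<Sum>k<d1. \<Sum>l<d2. L.res U V w * (?C w $$ (k,l) * M $$ (k,l)))"
      by (rule sum.swap)
    also have "\<dots> = (\<Sum>w\<in>\<Omega>. L.res U V w * mtrace (?C w * M\<^sup>T))"
      unfolding mtrace_mult_transpose[OF Cc M] sum_distrib_left ..
    finally show ?thesis .
  qed
  have G_bilin: "bilin r G P Q = (\<Sum>w\<in>\<Omega>. L.res U V w * bilin r (?C w) P Q)"
    if P: "P \<in> carrier_mat d1 r" and Q: "Q \<in> carrier_mat d2 r" for P Q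
  proof -
    have QT: "Q\<^sup>T \<in> carrier_mat r d2" using Q by simp
    show ?thesis unfolding bilin_eq_mtrace[OF G P Q] bilin_eq_mtrace[OF Cc P Q]
      by (rule G_mtrace[OF mult_carrier_mat[OF P QT]])
  qed
  have grad: "bilin r G P V + bilin r G U Q = 0" if P: "P \<in> carrier_mat d1 r" and Q: "Q \<in> carrier_mat d2 r" for P Q
    using L.critical_point_gradient[OF U V crit, of P Q]
    unfolding G_bilin[OF P V] G_bilin[OF U Q] L.lin_def distrib_left sum.distrib .
  have bilin_0: "bilin r G P (0\<^sub>m d2 r) = 0" "bilin r G (0\<^sub>m d1 r) Q = 0" for P Q
    using G by (simp_all add: bilin_def)
  have GV: "G * V = 0\<^sub>m d1 r"
  proof (rule frob_sq_eq_0)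
    show c: "G * V \<in> carrier_mat d1 r" by (rule mult_carrier_mat[OF G V])
    \<comment> \<open>Testing criticality with \<open>P = G * V\<close> and \<open>Q = 0\<close>
      returns the squared Frobenius norm of \<open>G * V\<close> itself.\<close>
    have "bilin r G (G * V) V = 0" using grad[OF c zero_carrier_mat] bilin_0 by simp
    then show "frob_sq (G * V) = 0" unfolding bilin_eq_mtrace'[OF G c V] frob_sq_trace[OF c] .
  qed
  have GTU: "G\<^sup>T * U = 0\<^sub>m d2 r"
  proof (rule frob_sq_eq_0)
    show c: "G\<^sup>T * U \<in> carrier_mat d2 r" by (rule mult_carrier_mat[OF GT U])
    have "bilin r G U (G\<^sup>T * U) = 0" using grad[OF zero_carrier_mat c] bilin_0 by simp
    then show "frob_sq (G\<^sup>T * U) = 0"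
      unfolding bilin_transpose[OF G] bilin_eq_mtrace'[OF GT c U] frob_sq_trace[OF c] .
  qed
  obtain F Y H where F: "F \<in> carrier_mat n1 r" and Y: "Y \<in> carrier_mat n2 r" and H: "H \<in> carrier_mat r n2"
    and XFH: "Xs = F * H" and FXY: "F = Xs * Y"
    and Finj: "\<And>x. x \<in> carrier_vec r \<Longrightarrow> F *\<^sub>v x = 0\<^sub>v n1 \<Longrightarrow> x = 0\<^sub>v r"
    by (rule rank_factorization[OF Xs]) blast
  \<comment> \<open>A basis of the column space of the target in the coordinates of
    \<open>A\<close>. As \<open>F = Xs * Y\<close> lies in the span of \<open>A\<close>, multiplying
    by \<open>A\<close> recovers \<open>F\<close>, so injectivity carries over.\<close>
  define F' where "F' = A\<^sup>T * F"
  have F': "F' \<in> carrier_mat d1 r" unfolding F'_def by (rule mult_carrier_mat[OF AT F])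
  have AF': "A * F' = F"
  proof -
    have "A * F' = A * (A\<^sup>T * Xs) * Y"
      unfolding F'_def unfolding FXY assoc_mult_mat[OF AT Xs(1) Y, symmetric]
      by (rule assoc_mult_mat[OF A(1) ATX Y, symmetric])
    then show ?thesis unfolding AATX using FXY by simp
  qed
  have F'inj: "x = 0\<^sub>v r" if x: "x \<in> carrier_vec r" and z: "F' *\<^sub>v x = 0\<^sub>v d1" for x
  proof -
    have "F *\<^sub>v x = A *\<^sub>v (F' *\<^sub>v x)" using assoc_mult_mat_vec[OF A(1) F' x] by (simp only: AF')
    also have "\<dots> = 0\<^sub>v n1" unfolding z using A(1) by (intro eq_vecI) auto
    finally show ?thesis by (rule Finj[OF x])
  qed
  obtain \<Psi> K where T: "orth_projection d1 r \<Psi>" "\<Psi> * F' = F'" and "K \<in> carrier_mat r d1" "\<Psi> = F' * K"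
    by (rule orth_projection_onto_columns[OF F' F'inj])
  have TMs: "\<Psi> * Ms = Ms"
  proof -
    have HB: "H * B \<in> carrier_mat r d2" by (rule mult_carrier_mat[OF H B(1)])
    have "Ms = A\<^sup>T * (F * H * B)" unfolding Ms_def assoc_mult_mat[OF AT Xs(1) B(1)] XFH[symmetric] ..
    also have "F * H * B = F * (H * B)" by (rule assoc_mult_mat[OF F H B(1)])
    also have "A\<^sup>T * (F * (H * B)) = F' * (H * B)" unfolding F'_def by (rule assoc_mult_mat[OF AT F HB, symmetric])
    finally have Ms_eq: "Ms = F' * (H * B)" .
    show ?thesis unfolding Ms_eq assoc_mult_mat[OF proj_carrier(1)[OF T(1)] F' HB, symmetric] T(2) ..
  qed
  have hess: "0 \<le> 2 * (w \<bullet> z) * (a \<bullet> (G *\<^sub>v b)) + (5 / 4 * p) * ((a \<bullet> a) * nsq (V *\<^sub>v w)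
        + nsq (U *\<^sub>v z) * (b \<bullet> b) + 2 * (a \<bullet> (U *\<^sub>v z)) * ((V *\<^sub>v w) \<bullet> b))"
    if a: "a \<in> carrier_vec d1" and b: "b \<in> carrier_vec d2" and w: "w \<in> carrier_vec r" and z: "z \<in> carrier_vec r" for a b w z
  proof -
    \<comment> \<open>In these directions the first-order change of \<open>U * V\<^sup>T\<close> is
      a sum of two rank-one matrices, and \<open>P * Q\<^sup>T\<close> is
      \<open>w \<bullet> z\<close> times the outer product of \<open>a\<close> and
      \<open>b\<close>.\<close>
    define P where "P = outer a w"
    define Q where "Q = outer b z"
    have P: "P \<in> carrier_mat d1 r" and Q: "Q \<in> carrier_mat d2 r" using a b w z by (simp_all add: P_def Q_def outer_carrier)
    have QT: "Q\<^sup>T \<in> carrier_mat r d2" using Q by simp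
    have Vw: "V *\<^sub>v w \<in> carrier_vec d2" and Uz: "U *\<^sub>v z \<in> carrier_vec d1" using U V w z by simp_all
    have PV: "P * V\<^sup>T = outer a (V *\<^sub>v w)" unfolding P_def by (rule outer_mult_transpose[OF a w V])
    have UQ: "U * Q\<^sup>T = outer (U *\<^sub>v z) b" unfolding Q_def by (rule mult_outer_transpose[OF b z U])
    define M1 where "M1 = outer a (V *\<^sub>v w)"
    define M2 where "M2 = outer (U *\<^sub>v z) b"
    have M1: "M1 \<in> carrier_mat d1 d2" and M2: "M2 \<in> carrier_mat d1 d2"
      using a b Vw Uz by (simp_all add: M1_def M2_def outer_carrier)
    have M: "M1 + M2 \<in> carrier_mat d1 d2" using M1 M2 by simp
    have lin: "L.lin U V P Q u = mtrace (?C u * (M1 + M2)\<^sup>T)" for u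
      unfolding L.lin_def bilin_eq_mtrace[OF Cc P V] bilin_eq_mtrace[OF Cc U Q] PV UQ M1_def[symmetric] M2_def[symmetric]
        mtrace_mult_transpose[OF Cc M1] mtrace_mult_transpose[OF Cc M2] mtrace_mult_transpose[OF Cc M] sum.distrib[symmetric]
      using M1 M2 by (intro sum.cong refl) (simp add: distrib_left)
    have frobM: "frob_sq (M1 + M2) = (a \<bullet> a) * nsq (V *\<^sub>v w)
        + nsq (U *\<^sub>v z) * (b \<bullet> b) + 2 * (a \<bullet> (U *\<^sub>v z)) * ((V *\<^sub>v w) \<bullet> b)"
      unfolding frob_sq_add[OF M1 M2] frob_sq_trace[OF M1] frob_sq_trace[OF M2]
      unfolding M1_def M2_def mtrace_outer_outer[OF a Vw a Vw] mtrace_outer_outer[OF Uz b Uz b] mtrace_outer_outer[OF a Vw Uz b]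
      by simp
    have GPQ: "bilin r G P Q = (w \<bullet> z) * (a \<bullet> (G *\<^sub>v b))"
    proof -
      have zw: "Q *\<^sub>v w = (w \<bullet> z) \<cdot>\<^sub>v b"
        using b w z by (intro eq_vecI) (auto simp: Q_def outer_def scalar_prod_def sum_distrib_left sum_distrib_right mult_ac intro!: sum.cong)
      have Gb: "G *\<^sub>v b \<in> carrier_vec d1" using G b by simp
      have Qw: "Q *\<^sub>v w \<in> carrier_vec d2" using Q w by simp
      have "P * Q\<^sup>T = outer a (Q *\<^sub>v w)" unfolding P_def by (rule outer_mult_transpose[OF a w Q])
      then have "bilin r G P Q = a \<bullet> (G *\<^sub>v (Q *\<^sub>v w))"
        unfolding bilin_eq_mtrace[OF G P Q] using mtrace_mult_outer[OF G a Qw] by (simp only:)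
      then show ?thesis unfolding zw mult_mat_vec[OF G b] using scalar_prod_smult_distrib[OF a Gb] by (simp only:)
    qed
    have "0 \<le> (\<Sum>u\<in>\<Omega>. (L.lin U V P Q u)\<^sup>2 + 2 * (L.res U V u * bilin r (?C u) P Q))"
      by (rule L.non_strict_saddle_hessian[OF U V ns])
    also have "\<dots> = (\<Sum>u\<in>\<Omega>. (mtrace (?C u * (M1 + M2)\<^sup>T))\<^sup>2) + 2 * bilin r G P Q"
      unfolding lin G_bilin[OF P Q] sum.distrib sum_distrib_left ..
    also have "(\<Sum>u\<in>\<Omega>. (mtrace (?C u * (M1 + M2)\<^sup>T))\<^sup>2) \<le> (5 / 4 * p) * frob_sq (M1 + M2)"
      using abs_le_D1[OF RIP[OF M]] by linarith
    finally show ?thesis unfolding frobM GPQ by (simp add: mult.assoc)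
  qed
  have lower: "(3 / 4 * p) * frob_sq (U * V\<^sup>T - Ms) \<le> mtrace (G * (U * V\<^sup>T - Ms)\<^sup>T)"
  proof -
    \<comment> \<open>The target fits the data exactly, so each residual is the measurement of the
      error \<open>E\<close>; pairing \<open>G\<close> with \<open>E\<close> therefore gives the
      sampled energy of \<open>E\<close>.\<close>
    have "mtrace (G * E\<^sup>T) = (\<Sum>w\<in>\<Omega>. (mtrace (?C w * E\<^sup>T))\<^sup>2)"
      unfolding G_mtrace[OF E] by (intro sum.cong refl) (simp add: res power2_eq_square)
    then show ?thesis using abs_le_D2[OF RIP[OF E]] unfolding E_def[symmetric] by linarith
  qed
  have UV: "U * V\<^sup>T = Ms"
    by (rule no_spurious_critical_point[OF U V Ms G r T(1) TMs GV GTU hess _ _ lower]) (use p in auto)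
  have "?f U V = 0"
  proof -
    have "E = 0\<^sub>m d1 d2" using Ms by (intro eq_matI) (auto simp: E_def UV)
    then have "mtrace (?C w * E\<^sup>T) = 0" for w using mtrace_mult_transpose[OF Cc E] by simp
    then have "(bilin r (?C w) U V - Xs $$ w)\<^sup>2 = 0" if "w \<in> \<Omega>" for w using res[OF that] by (simp add: L.res_def)
    then show ?thesis unfolding f_eq[OF U V] by (intro sum.neutral) auto
  qed
  moreover have "0 \<le> ?f U' V'" for U' V' by (simp add: g_obj_def frob_sq_nonneg)
  ultimately show ?thesis unfolding global_min_UV_def using UV by (simp add: Ms_def)
qed

theorem theorem3p1:
  "\<exists>C>0. \<forall>(n1::nat) (n2::nat) (d1::nat) (d2::nat) (r::nat) (\<mu>::real)
       (A::real mat) (B::real mat) (Xs::real mat) (m::nat).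
     0 < r \<and> r \<le> d1 \<and> d1 \<le> n1 \<and> r \<le> d2 \<and> d2 \<le> n2 \<and>
     A \<in> carrier_mat n1 d1 \<and> B \<in> carrier_mat n2 d2 \<and>
     incoherent_isometry \<mu> A \<and> incoherent_isometry \<mu> B \<and>
     Xs \<in> carrier_mat n1 n2 \<and> vec_space.rank n1 Xs = r \<and>
     (\<exists>W \<in> carrier_mat d1 n2. Xs = A * W) \<and>
     (\<exists>W \<in> carrier_mat n1 d2. Xs = W * B\<^sup>T) \<and>
     m \<le> n1 * n2 \<and>
     real m \<ge> C * \<mu>\<^sup>2 * real d1 * real d2 * ln (real (max n1 n2))
     \<longrightarrow>
     measure_pmf.prob (pmf_of_set {\<Omega>. \<Omega> \<subseteq> {..<n1} \<times> {..<n2} \<and> card \<Omega> = m})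
       {\<Omega>. \<forall>U \<in> carrier_mat d1 r. \<forall>V \<in> carrier_mat d2 r.
             critical_point_UV (g_obj A B \<Omega> (P_Omega \<Omega> Xs)) d1 d2 r U V \<longrightarrow>
               (global_min_UV (g_obj A B \<Omega> (P_Omega \<Omega> Xs)) d1 d2 r U V \<and>
                U * V\<^sup>T = A\<^sup>T * Xs * B)
             \<or> strict_saddle_UV (g_obj A B \<Omega> (P_Omega \<Omega> Xs)) d1 d2 r U V}
     \<ge> 1 - 2 / (real (max n1 n2))\<^sup>2"
proof (intro exI[of _ "512 :: real"] conjI allI impI)
  fix n1 n2 d1 d2 r :: nat and \<mu> :: real and A B Xs :: "real mat" and m :: nat
  assume hyp: "0 < r \<and> r \<le> d1 \<and> d1 \<le> n1 \<and> r \<le> d2 \<and> d2 \<le> n2 \<and>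
     A \<in> carrier_mat n1 d1 \<and> B \<in> carrier_mat n2 d2 \<and>
     incoherent_isometry \<mu> A \<and> incoherent_isometry \<mu> B \<and>
     Xs \<in> carrier_mat n1 n2 \<and> vec_space.rank n1 Xs = r \<and>
     (\<exists>W \<in> carrier_mat d1 n2. Xs = A * W) \<and>
     (\<exists>W \<in> carrier_mat n1 d2. Xs = W * B\<^sup>T) \<and>
     m \<le> n1 * n2 \<and>
     real m \<ge> 512 * \<mu>\<^sup>2 * real d1 * real d2 * ln (real (max n1 n2))"
  define n where "n = max n1 n2"
  define good where "good = {\<Omega>. \<forall>U \<in> carrier_mat d1 r. \<forall>V \<in> carrier_mat d2 r.
             critical_point_UV (g_obj A B \<Omega> (P_Omega \<Omega> Xs)) d1 d2 r U V \<longrightarrow>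
               (global_min_UV (g_obj A B \<Omega> (P_Omega \<Omega> Xs)) d1 d2 r U V \<and>
                U * V\<^sup>T = A\<^sup>T * Xs * B)
             \<or> strict_saddle_UV (g_obj A B \<Omega> (P_Omega \<Omega> Xs)) d1 d2 r U V}"
  from hyp have r: "0 < r" and d: "0 < d1" "0 < d2" "d1 \<le> n1" "d2 \<le> n2" and nn: "0 < n1" "0 < n2" by auto
  from hyp have A: "A \<in> carrier_mat n1 d1" "incoherent_isometry \<mu> A" and B: "B \<in> carrier_mat n2 d2" "incoherent_isometry \<mu> B"
    and Xs: "Xs \<in> carrier_mat n1 n2" "vec_space.rank n1 Xs = r" and m: "m \<le> n1 * n2"
    and mC: "512 * \<mu>\<^sup>2 * real d1 * real d2 * ln (real n) \<le> real m" unfolding n_def by auto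
  obtain W1 where W1: "W1 \<in> carrier_mat d1 n2" "Xs = A * W1" using hyp by blast
  obtain W2 where W2: "W2 \<in> carrier_mat n1 d2" "Xs = W2 * B\<^sup>T" using hyp by blast
  have iso: "isometry A" "isometry B" using A B by (auto simp: incoherent_isometry_def)
  have \<mu>: "1 \<le> \<mu>" using incoherence_ge_1[OF A(2,1)] d nn by simp
  let ?S = "{..<n1} \<times> {..<n2}"
  let ?P = "{\<Omega>. \<Omega> \<subseteq> ?S \<and> card \<Omega> = m}"
  define N where "N = n1 * n2"
  define D where "D = d1 * d2"
  have N: "card ?S = N" "0 < N" using nn by (simp_all add: N_def)
  have D: "0 < D" using d by (simp add: D_def)
  show "1 - 2 / (real (max n1 n2))\<^sup>2 \<le> measure_pmf.prob (pmf_of_set ?P) good"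
  proof (cases "n = 1")
    \<comment> \<open>For \<open>n = 1\<close> the claimed bound is negative. The case is separated
      because \<open>ln n = 0\<close> there would allow \<open>m = 0\<close>.\<close>
    case True
    then have "1 - 2 / (real (max n1 n2))\<^sup>2 \<le> 0" by (simp add: n_def)
    also have "0 \<le> measure_pmf.prob (pmf_of_set ?P) good" by simp
    finally show ?thesis .
  next
    case False
    then have n2: "2 \<le> n" using nn by (auto simp: n_def)
    have m0: "0 < m"
    proof -
      have "0 < 512 * \<mu>\<^sup>2 * real d1 * real d2 * ln (real n)" using n2 \<mu> d by simp
      then show ?thesis using mC by (cases m) auto
    qed
    define L where "L = \<mu>\<^sup>2 * D / N"
    have L0: "0 < L" using \<mu> D N by (simp add: L_def)
    define v where "v w = flat (coef A B w)" for w
    interpret I: isotropic_frame D ?S v L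
    proof
      show "frame_op D v ?S = 1\<^sub>m D" unfolding v_def D_def by (rule coef_frame_isotropic[OF A(1) iso(1) B(1) iso(2)])
      fix w assume w: "w \<in> ?S"
      show "v w \<in> carrier_vec D" unfolding v_def D_def by (rule flat_carrier[OF coef_carrier[OF A(1) B(1)]])
      show "v w \<bullet> v w \<le> L" using coef_norm_bound[OF A B w] \<mu> by (simp add: v_def L_def D_def N_def)
    qed (use L0 in auto)
    define p where "p = real m / real N"
    have p0: "0 < p" using m0 N by (simp add: p_def)
    let ?ex = "(1 / 4)\<^sup>2 * m / (8 * L * card ?S)"
    define bad where "bad = {W. W \<subseteq> ?S \<and> card W = m \<and> (\<exists>x\<in>carrier_vec D. 1 / 4 * (m / card ?S) * (x \<bullet> x) <
      \<bar>x \<bullet> (frame_op D v W *\<^sub>v x) - m / card ?S * (x \<bullet> x)\<bar>)}"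
    have "real (card bad) \<le> real (N choose m) * (2 * real D * exp (- ?ex))"
      using I.card_deviating_le[of "1 / 4" m] m N unfolding bad_def N_def by simp
    also have "2 * real D * exp (- ?ex) \<le> 2 / (real n)\<^sup>2"
    proof -
      have LN: "L * N = \<mu>\<^sup>2 * D" using N by (simp add: L_def)
      \<comment> \<open>With tolerance 1/4 the tail exponent is
        \<open>m / (128 * \<mu>^2 * D)\<close>, where \<open>128 = 8 * 4^2\<close>; the constant
        \<open>512 = 4 * 128\<close> makes it at least \<open>4 * ln n\<close>.\<close>
      have "4 * ln (real n) \<le> ?ex"
      proof -
        have pos: "0 < \<mu>\<^sup>2 * D" using \<mu> D by simp
        have "512 * (\<mu>\<^sup>2 * D) * ln (real n) \<le> m" using mC by (simp add: D_def mult_ac)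
        then have "4 * ln (real n) \<le> m / (128 * (\<mu>\<^sup>2 * D))" using pos by (simp add: field_simps)
        also have "\<dots> = (1 / 4)\<^sup>2 * m / (8 * (L * N))" unfolding LN by (simp add: power2_eq_square)
        finally show ?thesis using N by (simp add: mult.assoc)
      qed
      then have "exp (- ?ex) \<le> exp (- (4 * ln (real n)))" by simp
      also have "exp (- (4 * ln (real n))) = 1 / real n ^ 4"
      proof -
        have "exp (4 * ln (real n)) = exp (ln (real n)) ^ 4" using exp_of_nat_mult[of 4 "ln (real n)"] by simp
        also have "exp (ln (real n)) = real n" using n2 by simp
        finally show ?thesis by (simp add: exp_minus inverse_eq_divide)
      qed
      finally have e: "exp (- ?ex) \<le> 1 / real n ^ 4" .
      \<comment> \<open>The dimension factor of the tail bound costs at most \<open>n^2\<close>, so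
        \<open>n^(-4)\<close> is what leaves a failure probability of order
        \<open>n^(-2)\<close>.\<close>
      have "D \<le> n * n" unfolding D_def n_def using d by (intro mult_mono) auto
      then have "real D \<le> (real n)\<^sup>2" by (metis of_nat_le_iff of_nat_mult power2_eq_square)
      then have "2 * real D * exp (- ?ex) \<le> 2 * (real n)\<^sup>2 * (1 / real n ^ 4)"
        using e by (intro mult_mono) auto
      also have "\<dots> = 2 / (real n)\<^sup>2" using n2 by (simp add: power2_eq_square eval_nat_numeral)
      finally show ?thesis .
    qed
    finally have card_bad: "real (card bad) \<le> real (N choose m) * (2 / (real n)\<^sup>2)"
      by (simp add: mult_left_mono)
    have good: "\<Omega> \<in> good" if O: "\<Omega> \<in> ?P" and nb: "\<Omega> \<notin> bad" for \<Omega>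
    proof -
      have sub: "\<Omega> \<subseteq> ?S" "card \<Omega> = m" using O by auto
      have RIP: "\<bar>(\<Sum>w\<in>\<Omega>. (mtrace (coef A B w * M\<^sup>T))\<^sup>2) - p * frob_sq M\<bar> \<le> p / 4 * frob_sq M"
        if M: "M \<in> carrier_mat d1 d2" for M
      proof -
        have x: "flat M \<in> carrier_vec D" unfolding D_def by (rule flat_carrier[OF M])
        have fin: "finite \<Omega>" using sub(1) finite_subset by blast
        have "flat M \<bullet> (frame_op D v \<Omega> *\<^sub>v flat M) = (\<Sum>w\<in>\<Omega>. (v w \<bullet> flat M) * (v w \<bullet> flat M))"
          using I.v_carrier sub by (intro frame_op_bilinear fin x) auto
        also have "\<dots> = (\<Sum>w\<in>\<Omega>. (mtrace (coef A B w * M\<^sup>T))\<^sup>2)"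
          unfolding v_def flat_scalar_prod[OF coef_carrier[OF A(1) B(1)] M] power2_eq_square ..
        finally have q: "flat M \<bullet> (frame_op D v \<Omega> *\<^sub>v flat M) = (\<Sum>w\<in>\<Omega>. (mtrace (coef A B w * M\<^sup>T))\<^sup>2)" .
        have f: "flat M \<bullet> flat M = frob_sq M" unfolding flat_scalar_prod[OF M M] frob_sq_trace[OF M] ..
        have "\<not> 1 / 4 * (m / card ?S) * (flat M \<bullet> flat M) <
            \<bar>flat M \<bullet> (frame_op D v \<Omega> *\<^sub>v flat M) - m / card ?S * (flat M \<bullet> flat M)\<bar>"
          using nb sub x unfolding bad_def by blast
        then show ?thesis unfolding q f N(1) p_def by (simp add: not_less mult.commute)
      qed
      show ?thesis unfolding good_def
        using benign_landscape[OF A(1) iso(1) B(1) iso(2) Xs r W1 W2 sub(1) p0 RIP] by blast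
    qed
    have finP: "finite ?P" by simp
    have cP: "card ?P = N choose m" using n_subsets[of ?S m] N by simp
    \<comment> \<open>\<open>m \<le> n1 * n2\<close> makes the sample space nonempty, as the uniform
      distribution on it requires.\<close>
    have cP0: "0 < N choose m" using m by (simp add: N_def)
    then have Pne: "?P \<noteq> {}" using cP by (metis card.empty less_irrefl)
    have "?P \<subseteq> (?P \<inter> good) \<union> bad" using good by blast
    moreover have "bad \<subseteq> ?P" by (auto simp: bad_def)
    then have "finite ((?P \<inter> good) \<union> bad)" using finP finite_subset by blast
    ultimately have "card ?P \<le> card (?P \<inter> good) + card bad" by (meson card_Un_le card_mono order_trans)
    then have "real (N choose m) \<le> real (card (?P \<inter> good)) + real (N choose m) * (2 / (real n)\<^sup>2)"
      using card_bad cP by linarith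
    then have "real (N choose m) * (1 - 2 / (real n)\<^sup>2) \<le> real (card (?P \<inter> good))"
      by (simp add: right_diff_distrib)
    then have "1 - 2 / (real n)\<^sup>2 \<le> real (card (?P \<inter> good)) / real (N choose m)"
      using cP0 by (simp add: pos_le_divide_eq mult.commute)
    also have "\<dots> = measure_pmf.prob (pmf_of_set ?P) good"
      unfolding measure_pmf_of_set[OF Pne finP] cP ..
    finally show ?thesis by (simp add: n_def)
  qed
qed simp

end
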